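(* The Markov category $\mathsf{ProDet}(\mathsf{FinKer})$ is causal.
   Context: A Markov category is a symmetric monoidal category in which the monoidal unit is terminal and every object $X$ carries a commutative comonoid structure $\mathsf{copy}_X : X\to X\otimes X$, $\mathsf{del}_X : X\to 1$, compatible with the monoidal product. A Markov category is causal if, for all morphisms $f:A\to B$, $g:B\to C$ and $h_1,h_2:C\to D$, whenever the two composites $$(h_i\otimes 1_C)\circ\mathsf{copy}_C\circ g\circ f:A\to D\otimes C\qquad(i=1,2)$$ are equal, the two composites $$\big(((h_i\otimes 1_C)\circ\mathsf{copy}_C\circ g)\otimes 1_B\big)\circ\mathsf{copy}_B\circ f:A\to D\otimes C\otimes B\qquad(i=1,2)$$ are also equal. $\mathsf{FinKer}$ is the Markov category of finite sets and stochastic matrices (finite probability kernels), with tensor given by the cartesian product of sets; its deterministic morphisms form the category $\mathsf{Fin}$ of finite sets and functions. $\mathsf{Pro}(-)$ denotes the category of pro-objects (free completion under small cofiltered limits), with $\mathsf{Pro}(\mathcal{C})(\lim_iX_i,\lim_jY_j)=\lim_j\operatorname{colim}_i\mathcal{C}(X_i,Y_j)$. $\mathsf{ProDet}(\mathsf{FinKer})$ is the full subcategory of $\mathsf{Pro}(\mathsf{FinKer})$ on the limits of cofiltered diagrams that factorize through $\mathsf{Fin}$ (equivalently, the full image of $\mathsf{Pro}(\mathsf{Fin})\to\mathsf{Pro}(\mathsf{FinKer})$). It is a Markov category with tensor $X\otimes Y=\lim_{X\to X',\,Y\to Y'}X'\otimes Y'$, where $X\to X'$, $Y\to Y'$ range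 over maps in $\mathsf{Pro}(\mathsf{Fin})$ with $X',Y'$ finite sets (i.e. the cartesian product in $\mathsf{Pro}(\mathsf{Fin})$); the tensor of morphisms is determined by tensoring representatives in $\mathsf{FinKer}$ of the components, the unit is the one-point set $1$, and the copy map of $X$ has components $X\to X'\xrightarrow{\mathsf{copy}}X'\otimes X'$. *)

theory Defs
  imports Complex_Main
begin

section \<open>Categories, functors and cofiltered categories\<close>

record ('o, 'm) cat_data =
  Obj :: "'o set"
  Arr :: "'m set"
  Dom :: "'m \<Rightarrow> 'o"
  Cod :: "'m \<Rightarrow> 'o"
  Ident :: "'o \<Rightarrow> 'm" ("\<one>\<index>")
  Comp :: "'m \<Rightarrow> 'm \<Rightarrow> 'm" (infixr "\<cdot>\<index>" 65)

definition Hom :: "('o, 'm, 'z) cat_data_scheme \<Rightarrow> 'o \<Rightarrow> 'o \<Rightarrow> 'm set" where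
  "Hom C x y = {f \<in> Arr C. Dom C f = x \<and> Cod C f = y}"

locale category =
  fixes C :: "('o, 'm, 'z) cat_data_scheme" (structure)
  assumes Dom_in_Obj: "f \<in> Arr C \<Longrightarrow> Dom C f \<in> Obj C"
    and Cod_in_Obj: "f \<in> Arr C \<Longrightarrow> Cod C f \<in> Obj C"
    and Ident_in_Hom: "x \<in> Obj C \<Longrightarrow> \<one> x \<in> Hom C x x"
    and Comp_in_Hom: "f \<in> Hom C x y \<Longrightarrow> g \<in> Hom C y z \<Longrightarrow> g \<cdot> f \<in> Hom C x z"
    and Comp_Ident: "f \<in> Hom C x y \<Longrightarrow> f \<cdot> \<one> x = f"
    and Ident_Comp: "f \<in> Hom C x y \<Longrightarrow> \<one> y \<cdot> f = f"
    and Comp_assoc: "f \<in> Hom C w x \<Longrightarrow> g \<in> Hom C x y \<Longrightarrow> h \<in> Hom C y z \<Longrightarrow>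
          (h \<cdot> g) \<cdot> f = h \<cdot> (g \<cdot> f)"

definition inverse_arrows :: "('o, 'm, 'z) cat_data_scheme \<Rightarrow> 'm \<Rightarrow> 'm \<Rightarrow> bool" where
  "inverse_arrows C f g \<longleftrightarrow>
     f \<in> Arr C \<and> g \<in> Hom C (Cod C f) (Dom C f) \<and>
     g \<cdot>\<^bsub>C\<^esub> f = \<one>\<^bsub>C\<^esub> (Dom C f) \<and> f \<cdot>\<^bsub>C\<^esub> g = \<one>\<^bsub>C\<^esub> (Cod C f)"

definition is_iso :: "('o, 'm, 'z) cat_data_scheme \<Rightarrow> 'm \<Rightarrow> bool" where
  "is_iso C f \<longleftrightarrow> (\<exists>g. inverse_arrows C f g)"

definition inverse_of :: "('o, 'm, 'z) cat_data_scheme \<Rightarrow> 'm \<Rightarrow> 'm" where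
  "inverse_of C f = (THE g. inverse_arrows C f g)"

definition is_functor ::
  "('o, 'm, 'y) cat_data_scheme \<Rightarrow> ('p, 'n, 'z) cat_data_scheme \<Rightarrow> ('o \<Rightarrow> 'p) \<Rightarrow> ('m \<Rightarrow> 'n) \<Rightarrow> bool"
  where
  "is_functor I C F G \<longleftrightarrow>
     (\<forall>i\<in>Obj I. F i \<in> Obj C \<and> G (\<one>\<^bsub>I\<^esub> i) = \<one>\<^bsub>C\<^esub> (F i)) \<and>
     (\<forall>a\<in>Arr I. G a \<in> Hom C (F (Dom I a)) (F (Cod I a))) \<and>
     (\<forall>a\<in>Arr I. \<forall>b\<in>Arr I. Dom I b = Cod I a \<longrightarrow> G (b \<cdot>\<^bsub>I\<^esub> a) = G b \<cdot>\<^bsub>C\<^esub> G a)"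

definition full_subcategory :: "('o, 'm) cat_data \<Rightarrow> 'o set \<Rightarrow> ('o, 'm) cat_data" where
  "full_subcategory C S =
     C\<lparr>Obj := Obj C \<inter> S, Arr := {f \<in> Arr C. Dom C f \<in> S \<and> Cod C f \<in> S}\<rparr>"

locale cofiltered_category = category I for I :: "('o, 'm, 'z) cat_data_scheme" (structure) +
  assumes nonempty: "Obj I \<noteq> {}"
    and cone_objects: "i \<in> Obj I \<Longrightarrow> j \<in> Obj I \<Longrightarrow>
          \<exists>k\<in>Obj I. Hom I k i \<noteq> {} \<and> Hom I k j \<noteq> {}"
    and cone_arrows: "a \<in> Hom I i j \<Longrightarrow> b \<in> Hom I i j \<Longrightarrow>
          \<exists>k\<in>Obj I. \<exists>c\<in>Hom I k i. a \<cdot> c = b \<cdot> c"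


section \<open>Causal Markov categories\<close>

text \<open>The monoidal product is \<open>\<odot>\<close> on objects and \<open>\<otimes>\<close> on arrows.\<close>

record ('o, 'm) markov_data = "('o, 'm) cat_data" +
  TensorO :: "'o \<Rightarrow> 'o \<Rightarrow> 'o" (infixr "\<odot>\<index>" 70)
  TensorA :: "'m \<Rightarrow> 'm \<Rightarrow> 'm" (infixr "\<otimes>\<index>" 70)
  Unit :: 'o
  Assoc :: "'o \<Rightarrow> 'o \<Rightarrow> 'o \<Rightarrow> 'm" \<comment> \<open>\<open>(X \<odot> Y) \<odot> Z \<rightarrow> X \<odot> (Y \<odot> Z)\<close>\<close>
  Lunit :: "'o \<Rightarrow> 'm"
  Runit :: "'o \<Rightarrow> 'm"
  Swap :: "'o \<Rightarrow> 'o \<Rightarrow> 'm"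
  Copy :: "'o \<Rightarrow> 'm"
  Del :: "'o \<Rightarrow> 'm"

locale symmetric_monoidal_category =
  category M for M :: "('o, 'm, 'z) markov_data_scheme" (structure) +
  assumes TensorO_in_Obj: "x \<in> Obj M \<Longrightarrow> y \<in> Obj M \<Longrightarrow> x \<odot> y \<in> Obj M"
    and TensorA_in_Hom: "f \<in> Hom M x y \<Longrightarrow> g \<in> Hom M x' y' \<Longrightarrow>
          f \<otimes> g \<in> Hom M (x \<odot> x') (y \<odot> y')"
    and TensorA_Ident: "x \<in> Obj M \<Longrightarrow> y \<in> Obj M \<Longrightarrow> \<one> x \<otimes> \<one> y = \<one> (x \<odot> y)"
    and TensorA_Comp: "f \<in> Hom M x y \<Longrightarrow> g \<in> Hom M y z \<Longrightarrow> f' \<in> Hom M x' y' \<Longrightarrow> g' \<in> Hom M y' z' \<Longrightarrow>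
          (g \<cdot> f) \<otimes> (g' \<cdot> f') = (g \<otimes> g') \<cdot> (f \<otimes> f')"
    and Unit_in_Obj: "Unit M \<in> Obj M"
    and Assoc_in_Hom: "x \<in> Obj M \<Longrightarrow> y \<in> Obj M \<Longrightarrow> z \<in> Obj M \<Longrightarrow>
          Assoc M x y z \<in> Hom M ((x \<odot> y) \<odot> z) (x \<odot> (y \<odot> z))"
    and Assoc_iso: "x \<in> Obj M \<Longrightarrow> y \<in> Obj M \<Longrightarrow> z \<in> Obj M \<Longrightarrow> is_iso M (Assoc M x y z)"
    and Assoc_natural: "f \<in> Hom M x x' \<Longrightarrow> g \<in> Hom M y y' \<Longrightarrow> h \<in> Hom M z z' \<Longrightarrow>
          Assoc M x' y' z' \<cdot> ((f \<otimes> g) \<otimes> h) = (f \<otimes> (g \<otimes> h)) \<cdot> Assoc M x y z"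
    and Lunit_in_Hom: "x \<in> Obj M \<Longrightarrow> Lunit M x \<in> Hom M (Unit M \<odot> x) x"
    and Lunit_iso: "x \<in> Obj M \<Longrightarrow> is_iso M (Lunit M x)"
    and Lunit_natural: "f \<in> Hom M x y \<Longrightarrow> Lunit M y \<cdot> (\<one> (Unit M) \<otimes> f) = f \<cdot> Lunit M x"
    and Runit_in_Hom: "x \<in> Obj M \<Longrightarrow> Runit M x \<in> Hom M (x \<odot> Unit M) x"
    and Runit_iso: "x \<in> Obj M \<Longrightarrow> is_iso M (Runit M x)"
    and Runit_natural: "f \<in> Hom M x y \<Longrightarrow> Runit M y \<cdot> (f \<otimes> \<one> (Unit M)) = f \<cdot> Runit M x"
    and pentagon: "w \<in> Obj M \<Longrightarrow> x \<in> Obj M \<Longrightarrow> y \<in> Obj M \<Longrightarrow> z \<in> Obj M \<Longrightarrow>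
          Assoc M w x (y \<odot> z) \<cdot> Assoc M (w \<odot> x) y z =
          (\<one> w \<otimes> Assoc M x y z) \<cdot> Assoc M w (x \<odot> y) z \<cdot> (Assoc M w x y \<otimes> \<one> z)"
    and triangle: "x \<in> Obj M \<Longrightarrow> y \<in> Obj M \<Longrightarrow>
          (\<one> x \<otimes> Lunit M y) \<cdot> Assoc M x (Unit M) y = Runit M x \<otimes> \<one> y"
    and Swap_in_Hom: "x \<in> Obj M \<Longrightarrow> y \<in> Obj M \<Longrightarrow> Swap M x y \<in> Hom M (x \<odot> y) (y \<odot> x)"
    and Swap_natural: "f \<in> Hom M x x' \<Longrightarrow> g \<in> Hom M y y' \<Longrightarrow>
          Swap M x' y' \<cdot> (f \<otimes> g) = (g \<otimes> f) \<cdot> Swap M x y"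
    and Swap_Swap: "x \<in> Obj M \<Longrightarrow> y \<in> Obj M \<Longrightarrow> Swap M y x \<cdot> Swap M x y = \<one> (x \<odot> y)"
    and hexagon: "x \<in> Obj M \<Longrightarrow> y \<in> Obj M \<Longrightarrow> z \<in> Obj M \<Longrightarrow>
          Assoc M y z x \<cdot> Swap M x (y \<odot> z) \<cdot> Assoc M x y z =
          (\<one> y \<otimes> Swap M x z) \<cdot> Assoc M y x z \<cdot> (Swap M x y \<otimes> \<one> z)"

text \<open>The middle-four interchange \<open>(X \<odot> X) \<odot> (Y \<odot> Y) \<rightarrow> (X \<odot> Y) \<odot> (X \<odot> Y)\<close>.\<close>

definition Interchange :: "('o, 'm, 'z) markov_data_scheme \<Rightarrow> 'o \<Rightarrow> 'o \<Rightarrow> 'm" where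
  "Interchange M x y =
     inverse_of M (Assoc M x y (x \<odot>\<^bsub>M\<^esub> y)) \<cdot>\<^bsub>M\<^esub>
     (\<one>\<^bsub>M\<^esub> x \<otimes>\<^bsub>M\<^esub> (Assoc M y x y \<cdot>\<^bsub>M\<^esub> (Swap M x y \<otimes>\<^bsub>M\<^esub> \<one>\<^bsub>M\<^esub> y) \<cdot>\<^bsub>M\<^esub> inverse_of M (Assoc M x y y))) \<cdot>\<^bsub>M\<^esub>
     Assoc M x x (y \<odot>\<^bsub>M\<^esub> y)"

locale markov_category =
  symmetric_monoidal_category M for M :: "('o, 'm, 'z) markov_data_scheme" (structure) +
  assumes Unit_terminal: "x \<in> Obj M \<Longrightarrow> \<exists>!t. t \<in> Hom M x (Unit M)"
    and Copy_in_Hom: "x \<in> Obj M \<Longrightarrow> Copy M x \<in> Hom M x (x \<odot> x)"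
    and Del_in_Hom: "x \<in> Obj M \<Longrightarrow> Del M x \<in> Hom M x (Unit M)"
    and Copy_coassoc: "x \<in> Obj M \<Longrightarrow>
          Assoc M x x x \<cdot> (Copy M x \<otimes> \<one> x) \<cdot> Copy M x = (\<one> x \<otimes> Copy M x) \<cdot> Copy M x"
    and Copy_counit_left: "x \<in> Obj M \<Longrightarrow> Lunit M x \<cdot> (Del M x \<otimes> \<one> x) \<cdot> Copy M x = \<one> x"
    and Copy_counit_right: "x \<in> Obj M \<Longrightarrow> Runit M x \<cdot> (\<one> x \<otimes> Del M x) \<cdot> Copy M x = \<one> x"
    and Copy_comm: "x \<in> Obj M \<Longrightarrow> Swap M x x \<cdot> Copy M x = Copy M x"
    and Copy_Tensor: "x \<in> Obj M \<Longrightarrow> y \<in> Obj M \<Longrightarrow>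
          Copy M (x \<odot> y) = Interchange M x y \<cdot> (Copy M x \<otimes> Copy M y)"
    and Del_Tensor: "x \<in> Obj M \<Longrightarrow> y \<in> Obj M \<Longrightarrow>
          Del M (x \<odot> y) = Lunit M (Unit M) \<cdot> (Del M x \<otimes> Del M y)"
    and Copy_Unit: "Lunit M (Unit M) \<cdot> Copy M (Unit M) = \<one> (Unit M)"
    and Del_Unit: "Del M (Unit M) = \<one> (Unit M)"

locale causal_markov_category =
  markov_category M for M :: "('o, 'm, 'z) markov_data_scheme" (structure) +
  assumes causal:
    "f \<in> Hom M a b \<Longrightarrow> g \<in> Hom M b c \<Longrightarrow> h\<^sub>1 \<in> Hom M c d \<Longrightarrow> h\<^sub>2 \<in> Hom M c d \<Longrightarrow>
     (h\<^sub>1 \<otimes> \<one> c) \<cdot> Copy M c \<cdot> g \<cdot> f = (h\<^sub>2 \<otimes> \<one> c) \<cdot> Copy M c \<cdot> g \<cdot> f \<Longrightarrow>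
     (((h\<^sub>1 \<otimes> \<one> c) \<cdot> Copy M c \<cdot> g) \<otimes> \<one> b) \<cdot> Copy M b \<cdot> f =
     (((h\<^sub>2 \<otimes> \<one> c) \<cdot> Copy M c \<cdot> g) \<otimes> \<one> b) \<cdot> Copy M b \<cdot> f"


section \<open>Finite sets, functions and kernels\<close>

text \<open>
  Finite sets have elements in, and small categories have objects and arrows in, a type closed
  under pairing. The parameter \<open>'a\<close> is arbitrary, so there is no bound on the cardinality
  of the index categories.
\<close>

datatype 'a univ = Atom 'a | Pt | Pair (pfst: "'a univ") (psnd: "'a univ")

definition pairs :: "'a univ set \<Rightarrow> 'a univ set \<Rightarrow> 'a univ set" where
  "pairs A B = {Pair x y | x y. x \<in> A \<and> y \<in> B}"

record ('o, 'b) arrow =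
  source :: 'o
  target :: 'o
  body :: 'b

type_synonym 'a fun_arrow = "('a univ set, 'a univ \<Rightarrow> 'a univ) arrow"
type_synonym 'a kernel = "('a univ set, 'a univ \<Rightarrow> 'a univ \<Rightarrow> real) arrow"

definition Fin :: "('a univ set, 'a fun_arrow) cat_data" where
  "Fin = \<lparr>
     Obj = {A. finite A},
     Arr = {f. finite (source f) \<and> finite (target f) \<and>
               (\<forall>x\<in>source f. body f x \<in> target f) \<and>
               (\<forall>x. x \<notin> source f \<longrightarrow> body f x = undefined)},
     Dom = source,
     Cod = target,
     Ident = (\<lambda>A. \<lparr>source = A, target = A, body = (\<lambda>x. if x \<in> A then x else undefined)\<rparr>),
     Comp = (\<lambda>g f. \<lparr>source = source f, target = target g,
               body = (\<lambda>x. if x \<in> source f then body g (body f x) else undefined)\<rparr>)\<rparr>"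

text \<open>The entry \<open>body k x y\<close> is the probability of \<open>y\<close> given \<open>x\<close>.\<close>

definition stochastic :: "'a kernel \<Rightarrow> bool" where
  "stochastic k \<longleftrightarrow>
     (\<forall>x\<in>source k. (\<forall>y\<in>target k. 0 \<le> body k x y) \<and> (\<Sum>y\<in>target k. body k x y) = 1) \<and>
     (\<forall>x y. x \<notin> source k \<or> y \<notin> target k \<longrightarrow> body k x y = 0)"

definition fun_kernel :: "'a univ set \<Rightarrow> 'a univ set \<Rightarrow> ('a univ \<Rightarrow> 'a univ) \<Rightarrow> 'a kernel" where
  "fun_kernel A B u =
     \<lparr>source = A, target = B, body = (\<lambda>x y. if x \<in> A \<and> y = u x then 1 else 0)\<rparr>"

definition FinKer :: "('a univ set, 'a kernel) markov_data" where
  "FinKer = \<lparr>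
     Obj = {A. finite A},
     Arr = {k. finite (source k) \<and> finite (target k) \<and> stochastic k},
     Dom = source,
     Cod = target,
     Ident = (\<lambda>A. fun_kernel A A (\<lambda>x. x)),
     Comp = (\<lambda>l k. \<lparr>source = source k, target = target l,
               body = (\<lambda>x z. \<Sum>y\<in>target k. body k x y * body l y z)\<rparr>),
     TensorO = pairs,
     TensorA = (\<lambda>k l. \<lparr>source = pairs (source k) (source l), target = pairs (target k) (target l),
               body = (\<lambda>p q. if p \<in> pairs (source k) (source l) \<and> q \<in> pairs (target k) (target l)
                             then body k (pfst p) (pfst q) * body l (psnd p) (psnd q) else 0)\<rparr>),
     Unit = {Pt},
     Assoc = (\<lambda>A B C. fun_kernel (pairs (pairs A B) C) (pairs A (pairs B C))
               (\<lambda>p. Pair (pfst (pfst p)) (Pair (psnd (pfst p)) (psnd p)))),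
     Lunit = (\<lambda>A. fun_kernel (pairs {Pt} A) A psnd),
     Runit = (\<lambda>A. fun_kernel (pairs A {Pt}) A pfst),
     Swap = (\<lambda>A B. fun_kernel (pairs A B) (pairs B A) (\<lambda>p. Pair (psnd p) (pfst p))),
     Copy = (\<lambda>A. fun_kernel A (pairs A A) (\<lambda>x. Pair x x)),
     Del = (\<lambda>A. fun_kernel A {Pt} (\<lambda>_. Pt))\<rparr>"

text \<open>The inclusion of \<^const>\<open>Fin\<close> into \<^const>\<open>FinKer\<close>.\<close>

definition kernel_of :: "'a fun_arrow \<Rightarrow> 'a kernel" where
  "kernel_of f = fun_kernel (source f) (target f) (body f)"


section \<open>Pro-objects\<close>

text \<open>A diagram stands for its formal limit.\<close>

record ('a, 'o, 'm) diagram =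
  idx :: "('a univ, 'a univ) cat_data"
  node :: "'a univ \<Rightarrow> 'o"
  edge :: "'a univ \<Rightarrow> 'm"

type_synonym ('a, 'o, 'm) pro_arrow =
  "(('a, 'o, 'm) diagram, 'a univ \<Rightarrow> ('a univ \<times> 'm) set) arrow"

definition pro_object :: "('o, 'm, 'z) cat_data_scheme \<Rightarrow> ('a, 'o, 'm) diagram \<Rightarrow> bool" where
  "pro_object C X \<longleftrightarrow> cofiltered_category (idx X) \<and> is_functor (idx X) C (node X) (edge X)"

text \<open>
  The class of \<open>f : X\<^sub>i \<rightarrow> y\<close> in the filtered colimit \<open>colim\<^sub>i C(X\<^sub>i, y)\<close>: two
  representatives are identified when they agree after restriction to some common stage.
\<close>

definition germ ::
  "('o, 'm, 'z) cat_data_scheme \<Rightarrow> ('a, 'o, 'm) diagram \<Rightarrow> 'a univ \<Rightarrow> 'm \<Rightarrow> ('a univ \<times> 'm) set" where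
  "germ C X i f = {(i', f'). i' \<in> Obj (idx X) \<and> f' \<in> Hom C (node X i') (Cod C f) \<and>
     (\<exists>k\<in>Obj (idx X). \<exists>a\<in>Hom (idx X) k i. \<exists>a'\<in>Hom (idx X) k i'.
        f \<cdot>\<^bsub>C\<^esub> edge X a = f' \<cdot>\<^bsub>C\<^esub> edge X a')}"

definition colim_Hom ::
  "('o, 'm, 'z) cat_data_scheme \<Rightarrow> ('a, 'o, 'm) diagram \<Rightarrow> 'o \<Rightarrow> ('a univ \<times> 'm) set set" where
  "colim_Hom C X y = {germ C X i f | i f. i \<in> Obj (idx X) \<and> f \<in> Hom C (node X i) y}"

text \<open>
  Operations on classes are written as the union of the results on all representatives; these
  results coincide, so the union is again a single class.
\<close>

definition post_comp ::
  "('o, 'm, 'z) cat_data_scheme \<Rightarrow> ('a, 'o, 'm) diagram \<Rightarrow> 'm \<Rightarrow> ('a univ \<times> 'm) set \<Rightarrow>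
   ('a univ \<times> 'm) set" where
  "post_comp C X g c = (\<Union>(i, f)\<in>c. germ C X i (g \<cdot>\<^bsub>C\<^esub> f))"

definition mk_pro ::
  "('a, 'o, 'm) diagram \<Rightarrow> ('a, 'o, 'm) diagram \<Rightarrow> ('a univ \<Rightarrow> ('a univ \<times> 'm) set) \<Rightarrow>
   ('a, 'o, 'm) pro_arrow" where
  "mk_pro X Y c = \<lparr>source = X, target = Y, body = (\<lambda>j. if j \<in> Obj (idx Y) then c j else {})\<rparr>"

text \<open>An arrow \<open>X \<rightarrow> Y\<close> is an element of \<open>lim\<^sub>j colim\<^sub>i C(X\<^sub>i, Y\<^sub>j)\<close>.\<close>

definition pro_arr :: "('o, 'm, 'z) cat_data_scheme \<Rightarrow> ('a, 'o, 'm) pro_arrow \<Rightarrow> bool" where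
  "pro_arr C f \<longleftrightarrow>
     pro_object C (source f) \<and> pro_object C (target f) \<and>
     (\<forall>j\<in>Obj (idx (target f)). body f j \<in> colim_Hom C (source f) (node (target f) j)) \<and>
     (\<forall>j. j \<notin> Obj (idx (target f)) \<longrightarrow> body f j = {}) \<and>
     (\<forall>b\<in>Arr (idx (target f)).
        post_comp C (source f) (edge (target f) b) (body f (Dom (idx (target f)) b)) =
        body f (Cod (idx (target f)) b))"

definition Pro ::
  "('o, 'm, 'z) cat_data_scheme \<Rightarrow> (('a, 'o, 'm) diagram, ('a, 'o, 'm) pro_arrow) cat_data" where
  "Pro C = \<lparr>
     Obj = {X. pro_object C X},
     Arr = {f. pro_arr C f},
     Dom = source,
     Cod = target,
     Ident = (\<lambda>X. mk_pro X X (\<lambda>j. germ C X j (\<one>\<^bsub>C\<^esub> (node X j)))),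
     Comp = (\<lambda>g f. mk_pro (source f) (target g)
               (\<lambda>l. \<Union>(j, m)\<in>body g l. post_comp C (source f) m (body f j)))\<rparr>"


section \<open>The Markov structure\<close>

definition product_category ::
  "('a univ, 'a univ) cat_data \<Rightarrow> ('a univ, 'a univ) cat_data \<Rightarrow> ('a univ, 'a univ) cat_data" where
  "product_category I J = \<lparr>
     Obj = pairs (Obj I) (Obj J),
     Arr = pairs (Arr I) (Arr J),
     Dom = (\<lambda>p. Pair (Dom I (pfst p)) (Dom J (psnd p))),
     Cod = (\<lambda>p. Pair (Cod I (pfst p)) (Cod J (psnd p))),
     Ident = (\<lambda>p. Pair (\<one>\<^bsub>I\<^esub> (pfst p)) (\<one>\<^bsub>J\<^esub> (psnd p))),
     Comp = (\<lambda>q p. Pair (pfst q \<cdot>\<^bsub>I\<^esub> pfst p) (psnd q \<cdot>\<^bsub>J\<^esub> psnd p))\<rparr>"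

definition point_category :: "('a univ, 'a univ) cat_data" where
  "point_category = \<lparr>Obj = {Pt}, Arr = {Pt}, Dom = (\<lambda>_. Pt), Cod = (\<lambda>_. Pt),
     Ident = (\<lambda>_. Pt), Comp = (\<lambda>_ _. Pt)\<rparr>"

text \<open>
  For \<open>X = lim\<^sub>i X\<^sub>i\<close> and \<open>Y = lim\<^sub>j Y\<^sub>j\<close>, the diagram \<open>(i, j) \<mapsto> X\<^sub>i \<otimes> Y\<^sub>j\<close>
  presents the limit of \<open>X' \<otimes> Y'\<close> over all maps \<open>X \<rightarrow> X'\<close>, \<open>Y \<rightarrow> Y'\<close> in \<open>Pro(Fin)\<close> to finite
  sets, since each such map factors through some \<open>X\<^sub>i\<close>, respectively \<open>Y\<^sub>j\<close>.
\<close>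

definition pro_tensor ::
  "('o, 'm, 'z) markov_data_scheme \<Rightarrow> ('a, 'o, 'm) diagram \<Rightarrow> ('a, 'o, 'm) diagram \<Rightarrow>
   ('a, 'o, 'm) diagram" where
  "pro_tensor M X Y = \<lparr>
     idx = product_category (idx X) (idx Y),
     node = (\<lambda>p. node X (pfst p) \<odot>\<^bsub>M\<^esub> node Y (psnd p)),
     edge = (\<lambda>p. edge X (pfst p) \<otimes>\<^bsub>M\<^esub> edge Y (psnd p))\<rparr>"

definition pro_unit :: "('o, 'm, 'z) markov_data_scheme \<Rightarrow> ('a, 'o, 'm) diagram" where
  "pro_unit M = \<lparr>idx = point_category, node = (\<lambda>_. Unit M), edge = (\<lambda>_. \<one>\<^bsub>M\<^esub> (Unit M))\<rparr>"

definition factors_through_Fin :: "('a, 'a univ set, 'a kernel) diagram \<Rightarrow> bool" where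
  "factors_through_Fin X \<longleftrightarrow>
     (\<exists>F G. is_functor (idx X) Fin F G \<and>
        (\<forall>i\<in>Obj (idx X). node X i = F i) \<and> (\<forall>a\<in>Arr (idx X). edge X a = kernel_of (G a)))"

text \<open>
  The component of a copy map at \<open>(j, j')\<close> is computed at any common stage \<open>k\<close>; at
  \<open>(j, j)\<close> it is the class of the copy map of \<open>X\<^sub>j\<close>.
\<close>

definition pro_markov ::
  "('o, 'm, 'z) markov_data_scheme \<Rightarrow> (('a, 'o, 'm) diagram, ('a, 'o, 'm) pro_arrow) cat_data \<Rightarrow>
   (('a, 'o, 'm) diagram, ('a, 'o, 'm) pro_arrow) markov_data" where
  "pro_markov M P = cat_data.extend P (markov_data.fields
     (pro_tensor M)
     (\<lambda>f g. mk_pro (pro_tensor M (source f) (source g)) (pro_tensor M (target f) (target g))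
        (\<lambda>q. \<Union>(i, k)\<in>body f (pfst q). \<Union>(j, l)\<in>body g (psnd q).
           germ M (pro_tensor M (source f) (source g)) (Pair i j) (k \<otimes>\<^bsub>M\<^esub> l)))
     (pro_unit M)
     (\<lambda>X Y Z. mk_pro (pro_tensor M (pro_tensor M X Y) Z) (pro_tensor M X (pro_tensor M Y Z))
        (\<lambda>p. let i = pfst p; j = pfst (psnd p); k = psnd (psnd p) in
           germ M (pro_tensor M (pro_tensor M X Y) Z) (Pair (Pair i j) k)
             (Assoc M (node X i) (node Y j) (node Z k))))
     (\<lambda>X. mk_pro (pro_tensor M (pro_unit M) X) X
        (\<lambda>j. germ M (pro_tensor M (pro_unit M) X) (Pair Pt j) (Lunit M (node X j))))
     (\<lambda>X. mk_pro (pro_tensor M X (pro_unit M)) X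
        (\<lambda>j. germ M (pro_tensor M X (pro_unit M)) (Pair j Pt) (Runit M (node X j))))
     (\<lambda>X Y. mk_pro (pro_tensor M X Y) (pro_tensor M Y X)
        (\<lambda>p. germ M (pro_tensor M X Y) (Pair (psnd p) (pfst p))
           (Swap M (node X (psnd p)) (node Y (pfst p)))))
     (\<lambda>X. mk_pro X (pro_tensor M X X)
        (\<lambda>p. \<Union>k\<in>Obj (idx X). \<Union>a\<in>Hom (idx X) k (pfst p). \<Union>b\<in>Hom (idx X) k (psnd p).
           germ M X k ((edge X a \<otimes>\<^bsub>M\<^esub> edge X b) \<cdot>\<^bsub>M\<^esub> Copy M (node X k))))
     (\<lambda>X. mk_pro X (pro_unit M) (\<lambda>_. \<Union>k\<in>Obj (idx X). germ M X k (Del M (node X k)))))"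

definition ProDet_FinKer ::
  "(('a, 'a univ set, 'a kernel) diagram, ('a, 'a univ set, 'a kernel) pro_arrow) markov_data" where
  "ProDet_FinKer =
     pro_markov FinKer (full_subcategory (Pro FinKer) {X. factors_through_Fin X})"

end

theory Submission
  imports Defs
begin

text \<open>
  The category \<open>FinKer\<close> is causal because it is a matter of supports: conditioning on a value \<open>c\<close> of
  positive probability determines \<open>h(d|c)\<close>, and a pair \<open>(b, c)\<close> can only have positive probability
  given \<open>a\<close> if \<open>c\<close> has (\<open>FinKer_causal\<close>). This passes to pro-objects because an equation between arrows of pro-objects
  can be tested one component at a time, and a single component involves only finitely many arrows of
  \<open>FinKer\<close>. These have representatives at common stages, and an equality of germs becomes an equality in
  \<open>FinKer\<close> after restriction to an earlier stage of the source, so causality for representatives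
  gives causality for the germs (\<open>N_causal\<close>).

  The same principle yields the Markov structure, and it uses little about \<open>FinKer\<close>. For any symmetric
  monoidal category \<open>M\<close>, the relation \<open>rep\<close> records that a component is represented by a given
  arrow of \<open>M\<close> at a given stage. It is compatible with composition and tensor product (\<open>rep_Comp\<close>,
  \<open>rep_Tensor\<close>), and structural arrows of pro-objects are represented by those of \<open>M\<close>. Two arrows that
  share representatives at a cofinal family of indices are equal (\<open>rep_eqI\<close>). So each coherence law for
  pro-objects is inherited from \<open>M\<close> (\<open>N_symmetric_monoidal\<close>). For the copy maps the transition arrows
  must be deterministic, as they are for diagrams of finite sets and functions; then the laws for copying
  need to be compared only at diagonal indices, which are cofinal (\<open>N_markov\<close>).
\<close>

section \<open>Categories and cofiltered categories\<close>

lemma HomI: "f \<in> Arr C \<Longrightarrow> Dom C f = x \<Longrightarrow> Cod C f = y \<Longrightarrow> f \<in> Hom C x y"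
  by (simp add: Hom_def)

lemma HomD:
  assumes "f \<in> Hom C x y"
  shows "f \<in> Arr C" "Dom C f = x" "Cod C f = y"
  using assms by (auto simp: Hom_def)

context category
begin

lemma Hom_objs:
  assumes "f \<in> Hom C x y"
  shows "x \<in> Obj C" "y \<in> Obj C"
  using assms Dom_in_Obj Cod_in_Obj by (auto simp: Hom_def)

lemma inverse_arrowsI:
  assumes "f \<in> Hom C x y" "g \<in> Hom C y x" "g \<cdot> f = \<one> x" "f \<cdot> g = \<one> y"
  shows "inverse_arrows C f g"
  using assms by (auto simp: inverse_arrows_def Hom_def)

lemma inverse_of_eqI:
  assumes "f \<in> Hom C x y" "g \<in> Hom C y x" "g \<cdot> f = \<one> x" "f \<cdot> g = \<one> y"
  shows "inverse_of C f = g"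
  unfolding inverse_of_def
proof (rule the_equality)
  show "inverse_arrows C f g" using assms by (rule inverse_arrowsI)
next
  fix h assume "inverse_arrows C f h"
  then have h: "h \<in> Hom C y x" "h \<cdot> f = \<one> x"
    using assms(1) by (auto simp: inverse_arrows_def Hom_def)
  have "h = h \<cdot> (f \<cdot> g)" using h(1) assms(4) by (simp add: Comp_Ident)
  also have "\<dots> = (h \<cdot> f) \<cdot> g" using Comp_assoc[OF assms(2,1) h(1)] by simp
  also have "\<dots> = g" using h assms by (simp add: Ident_Comp)
  finally show "h = g" .
qed

lemma inverse_of_iso:
  assumes "f \<in> Hom C x y" "is_iso C f"
  shows "inverse_of C f \<in> Hom C y x" "inverse_of C f \<cdot> f = \<one> x" "f \<cdot> inverse_of C f = \<one> y"
proof -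
  obtain g where g: "inverse_arrows C f g" using assms(2) by (auto simp: is_iso_def)
  then have *: "g \<in> Hom C y x" "g \<cdot> f = \<one> x" "f \<cdot> g = \<one> y"
    using assms(1) by (auto simp: inverse_arrows_def Hom_def)
  then have "inverse_of C f = g" using assms(1) by (intro inverse_of_eqI)
  with * show "inverse_of C f \<in> Hom C y x" "inverse_of C f \<cdot> f = \<one> x" "f \<cdot> inverse_of C f = \<one> y"
    by auto
qed

lemma inverse_of_natural:
  assumes f: "f \<in> Hom C x y" "is_iso C f" and g: "g \<in> Hom C x' y'" "is_iso C g"
    and u: "u \<in> Hom C x x'" and v: "v \<in> Hom C y y'" and sq: "g \<cdot> u = v \<cdot> f"
  shows "inverse_of C g \<cdot> v = u \<cdot> inverse_of C f"
proof -
  note F = inverse_of_iso[OF f] and G = inverse_of_iso[OF g]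
  have "inverse_of C g \<cdot> v = inverse_of C g \<cdot> (v \<cdot> (f \<cdot> inverse_of C f))"
    using F v by (simp add: Comp_Ident)
  also have "\<dots> = inverse_of C g \<cdot> ((v \<cdot> f) \<cdot> inverse_of C f)"
    using F v f by (simp add: Comp_assoc)
  also have "\<dots> = inverse_of C g \<cdot> (g \<cdot> (u \<cdot> inverse_of C f))"
    using F u g by (simp add: Comp_assoc flip: sq)
  also have "\<dots> = (inverse_of C g \<cdot> g) \<cdot> (u \<cdot> inverse_of C f)"
    using Comp_assoc[OF Comp_in_Hom[OF F(1) u] g(1) G(1)] by simp
  also have "\<dots> = u \<cdot> inverse_of C f"
    using G Ident_Comp[OF Comp_in_Hom[OF F(1) u]] by simp
  finally show ?thesis .
qed

end

lemma full_subcategory_Hom: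
  "f \<in> Hom (full_subcategory C S) x y \<longleftrightarrow> f \<in> Hom C x y \<and> x \<in> S \<and> y \<in> S"
  by (auto simp: Hom_def full_subcategory_def)

lemma full_subcategory_simps:
  "Obj (full_subcategory C S) = Obj C \<inter> S" "Arr (full_subcategory C S) = {f \<in> Arr C. Dom C f \<in> S \<and> Cod C f \<in> S}"
  "Dom (full_subcategory C S) = Dom C" "Cod (full_subcategory C S) = Cod C"
  "Ident (full_subcategory C S) = Ident C" "Comp (full_subcategory C S) = Comp C"
  by (simp_all add: full_subcategory_def)

lemma full_subcategory_category:
  assumes "category C"
  shows "category (full_subcategory C S)"
proof -
  interpret category C by fact
  show ?thesis
    by unfold_locales
      (auto simp: full_subcategory_Hom full_subcategory_simps Dom_in_Obj Cod_in_Obj Ident_in_Hom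
        Comp_Ident Ident_Comp Comp_assoc intro: Comp_in_Hom)
qed

context cofiltered_category
begin

lemma cospan_completion:
  assumes a: "a \<in> Hom I k i" and b: "b \<in> Hom I l i"
  shows "\<exists>n. \<exists>c\<in>Hom I n k. \<exists>d\<in>Hom I n l. a \<cdot> c = b \<cdot> d"
proof -
  obtain m c d where m: "c \<in> Hom I m k" "d \<in> Hom I m l"
    using cone_objects Hom_objs[OF a] Hom_objs[OF b] by blast
  obtain n e where e: "e \<in> Hom I n m" "(a \<cdot> c) \<cdot> e = (b \<cdot> d) \<cdot> e"
    using cone_arrows[OF Comp_in_Hom[OF m(1) a] Comp_in_Hom[OF m(2) b]] by blast
  then have "a \<cdot> (c \<cdot> e) = b \<cdot> (d \<cdot> e)"
    using Comp_assoc[OF e(1) m(1) a] Comp_assoc[OF e(1) m(2) b] by simp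
  then show ?thesis
    using e m Comp_in_Hom by blast
qed

text \<open>
  This makes a construction from a stage \<open>k\<close> with arrows to \<open>i\<close> and \<open>j\<close> independent of that stage:
  one cospan is completed over \<open>i\<close>, then the two resulting arrows to \<open>j\<close> are equalised.
\<close>

lemma span_refinement:
  assumes a: "a \<in> Hom I k i" and b: "b \<in> Hom I k j"
    and a': "a' \<in> Hom I k' i" and b': "b' \<in> Hom I k' j"
  shows "\<exists>n. \<exists>c\<in>Hom I n k. \<exists>c'\<in>Hom I n k'. a \<cdot> c = a' \<cdot> c' \<and> b \<cdot> c = b' \<cdot> c'"
proof -
  obtain m d d' where d: "d \<in> Hom I m k" "d' \<in> Hom I m k'" "a \<cdot> d = a' \<cdot> d'"
    using cospan_completion[OF a a'] by blast
  obtain n e where e: "e \<in> Hom I n m" "(b \<cdot> d) \<cdot> e = (b' \<cdot> d') \<cdot> e"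
    using cone_arrows[OF Comp_in_Hom[OF d(1) b] Comp_in_Hom[OF d(2) b']] by blast
  have 1: "a \<cdot> (d \<cdot> e) = a' \<cdot> (d' \<cdot> e)"
    using Comp_assoc[OF e(1) d(1) a] Comp_assoc[OF e(1) d(2) a'] d(3) by simp
  have 2: "b \<cdot> (d \<cdot> e) = b' \<cdot> (d' \<cdot> e)"
    using Comp_assoc[OF e(1) d(1) b] Comp_assoc[OF e(1) d(2) b'] e(2) by simp
  show ?thesis using 1 2 e d Comp_in_Hom by blast
qed

lemma cone_three_objects:
  assumes "i \<in> Obj I" "j \<in> Obj I" "k \<in> Obj I"
  shows "\<exists>n\<in>Obj I. Hom I n i \<noteq> {} \<and> Hom I n j \<noteq> {} \<and> Hom I n k \<noteq> {}"
proof -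
  obtain m a b where m: "m \<in> Obj I" "a \<in> Hom I m i" "b \<in> Hom I m j"
    using cone_objects assms by blast
  obtain n c d where n: "n \<in> Obj I" "c \<in> Hom I n m" "d \<in> Hom I n k"
    using cone_objects assms m by blast
  show ?thesis using n m Comp_in_Hom[OF n(2)] by blast
qed

end


section \<open>Germs\<close>

lemma UN_case_const:
  assumes "\<And>i f. (i, f) \<in> A \<Longrightarrow> G i f = B" "(i, f) \<in> A"
  shows "(\<Union>(i, f)\<in>A. G i f) = B"
proof -
  have "(\<lambda>(i, f). G i f) ` A = {B}" using assms by (auto simp: image_iff split: prod.splits)
  then show ?thesis by simp
qed

lemma pro_objectD:
  assumes "pro_object C X"
  shows "cofiltered_category (idx X)"
    and "i \<in> Obj (idx X) \<Longrightarrow> node X i \<in> Obj C"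
    and "i \<in> Obj (idx X) \<Longrightarrow> edge X (\<one>\<^bsub>idx X\<^esub> i) = \<one>\<^bsub>C\<^esub> (node X i)"
    and "a \<in> Hom (idx X) i j \<Longrightarrow> edge X a \<in> Hom C (node X i) (node X j)"
    and "a \<in> Hom (idx X) i j \<Longrightarrow> b \<in> Hom (idx X) j k \<Longrightarrow>
      edge X (b \<cdot>\<^bsub>idx X\<^esub> a) = edge X b \<cdot>\<^bsub>C\<^esub> edge X a"
  using assms by (auto simp: pro_object_def is_functor_def Hom_def)

context category
begin

lemma Comp_edge:
  assumes X: "pro_object C X" and f: "f \<in> Hom C (node X i) y"
    and a: "a \<in> Hom (idx X) k i" and c: "c \<in> Hom (idx X) n k"
  shows "f \<cdot> edge X (a \<cdot>\<^bsub>idx X\<^esub> c) = (f \<cdot> edge X a) \<cdot> edge X c"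
  using pro_objectD(5)[OF X c a] Comp_assoc[OF pro_objectD(4)[OF X c] pro_objectD(4)[OF X a] f]
  by simp

lemma germ_iff:
  assumes "f \<in> Hom C (node X i) y"
  shows "(i', f') \<in> germ C X i f \<longleftrightarrow>
    f' \<in> Hom C (node X i') y \<and> i' \<in> Obj (idx X) \<and>
    (\<exists>k\<in>Obj (idx X). \<exists>a\<in>Hom (idx X) k i. \<exists>a'\<in>Hom (idx X) k i'. f \<cdot> edge X a = f' \<cdot> edge X a')"
  using assms by (auto simp: germ_def HomD)

lemma germI:
  assumes "pro_object C X" "f \<in> Hom C (node X i) y" "f' \<in> Hom C (node X i') y"
    and "a \<in> Hom (idx X) k i" "a' \<in> Hom (idx X) k i'" "f \<cdot> edge X a = f' \<cdot> edge X a'"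
  shows "(i', f') \<in> germ C X i f"
proof -
  interpret I: cofiltered_category "idx X" using pro_objectD(1)[OF assms(1)] .
  show ?thesis
    unfolding germ_iff[OF assms(2)] using assms I.Hom_objs[OF assms(4)] I.Hom_objs[OF assms(5)] by blast
qed

lemma germ_refl:
  assumes X: "pro_object C X" and i: "i \<in> Obj (idx X)" and f: "f \<in> Hom C (node X i) y"
  shows "(i, f) \<in> germ C X i f"
proof -
  interpret I: cofiltered_category "idx X" using pro_objectD(1)[OF X] .
  show ?thesis unfolding germ_iff[OF f] using I.Ident_in_Hom[OF i] i f by blast
qed

lemma germ_sym:
  assumes "f \<in> Hom C (node X i) y" "i \<in> Obj (idx X)" "(i', f') \<in> germ C X i f"
  shows "(i, f) \<in> germ C X i' f'"
proof -
  have f': "f' \<in> Hom C (node X i') y" using assms germ_iff by blast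
  show ?thesis using assms unfolding germ_iff[OF f'] germ_iff[OF assms(1)] by metis
qed

lemma germ_trans:
  assumes X: "pro_object C X" and f: "f \<in> Hom C (node X i) y"
    and 1: "(i', f') \<in> germ C X i f" and 2: "(i'', f'') \<in> germ C X i' f'"
  shows "(i'', f'') \<in> germ C X i f"
proof -
  interpret I: cofiltered_category "idx X" using pro_objectD(1)[OF X] .
  have f': "f' \<in> Hom C (node X i') y" using 1 f germ_iff by blast
  obtain k a a' where k: "a \<in> Hom (idx X) k i" "a' \<in> Hom (idx X) k i'"
    "f \<cdot> edge X a = f' \<cdot> edge X a'"
    using 1 germ_iff[OF f] by blast
  obtain l b b' where l: "b \<in> Hom (idx X) l i'" "b' \<in> Hom (idx X) l i''"
    "f' \<cdot> edge X b = f'' \<cdot> edge X b'" and f'': "f'' \<in> Hom C (node X i'') y" "i'' \<in> Obj (idx X)"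
    using 2 germ_iff[OF f'] by blast
  obtain n c d where n: "c \<in> Hom (idx X) n k" "d \<in> Hom (idx X) n l"
    "a' \<cdot>\<^bsub>idx X\<^esub> c = b \<cdot>\<^bsub>idx X\<^esub> d"
    using I.cospan_completion[OF k(2) l(1)] by blast
  have "f \<cdot> edge X (a \<cdot>\<^bsub>idx X\<^esub> c) = f' \<cdot> edge X (a' \<cdot>\<^bsub>idx X\<^esub> c)"
    using Comp_edge[OF X f k(1) n(1)] Comp_edge[OF X f' k(2) n(1)] k(3) by simp
  also have "\<dots> = f'' \<cdot> edge X (b' \<cdot>\<^bsub>idx X\<^esub> d)"
    using Comp_edge[OF X f' l(1) n(2)] Comp_edge[OF X f''(1) l(2) n(2)] l(3) n(3) by simp
  finally have "f \<cdot> edge X (a \<cdot>\<^bsub>idx X\<^esub> c) = f'' \<cdot> edge X (b' \<cdot>\<^bsub>idx X\<^esub> d)" .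
  then show ?thesis
    unfolding germ_iff[OF f]
    using f'' I.Comp_in_Hom[OF n(1) k(1)] I.Comp_in_Hom[OF n(2) l(2)] I.Hom_objs(1)[OF n(1)] by blast
qed

lemma germ_eqI:
  assumes X: "pro_object C X" and i: "i \<in> Obj (idx X)" and f: "f \<in> Hom C (node X i) y"
    and m: "(i', f') \<in> germ C X i f"
  shows "germ C X i' f' = germ C X i f"
proof -
  have f': "f' \<in> Hom C (node X i') y" using m f germ_iff by blast
  have "p \<in> germ C X i' f' \<longleftrightarrow> p \<in> germ C X i f" for p
    using germ_trans[OF X f m] germ_trans[OF X f' germ_sym[OF f i m]] by (cases p) blast
  then show ?thesis by blast
qed

lemma germ_restrict:
  assumes X: "pro_object C X" and f: "f \<in> Hom C (node X i) y" and a: "a \<in> Hom (idx X) k i"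
  shows "(k, f \<cdot> edge X a) \<in> germ C X i f"
proof -
  interpret I: cofiltered_category "idx X" using pro_objectD(1)[OF X] .
  note ki = I.Hom_objs[OF a]
  have fa: "f \<cdot> edge X a \<in> Hom C (node X k) y" using f pro_objectD(4)[OF X a] Comp_in_Hom by blast
  have "f \<cdot> edge X a = (f \<cdot> edge X a) \<cdot> edge X (\<one>\<^bsub>idx X\<^esub> k)"
    using fa ki pro_objectD(3)[OF X] by (simp add: Comp_Ident)
  then show ?thesis
    unfolding germ_iff[OF f] using fa ki a I.Ident_in_Hom[OF ki(1)] by blast
qed

lemma germ_compose:
  assumes X: "pro_object C X" and f: "f \<in> Hom C (node X i) y" and g: "g \<in> Hom C y z"
    and m: "(i', f') \<in> germ C X i f"
  shows "(i', g \<cdot> f') \<in> germ C X i (g \<cdot> f)"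
proof -
  obtain k a a' where k: "k \<in> Obj (idx X)" "a \<in> Hom (idx X) k i" "a' \<in> Hom (idx X) k i'"
    "f \<cdot> edge X a = f' \<cdot> edge X a'" and f': "f' \<in> Hom C (node X i') y" "i' \<in> Obj (idx X)"
    using m germ_iff[OF f] by blast
  have "(g \<cdot> f) \<cdot> edge X a = (g \<cdot> f') \<cdot> edge X a'"
    using k(4) f f'(1) g pro_objectD(4)[OF X k(2)] pro_objectD(4)[OF X k(3)]
    by (simp add: Comp_assoc)
  then show ?thesis
    unfolding germ_iff[OF Comp_in_Hom[OF f g]] using k f' Comp_in_Hom[OF _ g] by blast
qed

text \<open>
  The definition of a germ allows two different arrows out of the witnessing stage. For
  representatives at one stage these are parallel, so they can be equalised. Causality below needs
  this form, since its two composites must be restricted along the same arrow.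
\<close>

lemma germ_same_stage:
  assumes X: "pro_object C X" and f: "f \<in> Hom C (node X i) y" and m: "(i, f') \<in> germ C X i f"
  shows "\<exists>k. \<exists>a\<in>Hom (idx X) k i. f \<cdot> edge X a = f' \<cdot> edge X a"
proof -
  interpret I: cofiltered_category "idx X" using pro_objectD(1)[OF X] .
  obtain k a a' where k: "a \<in> Hom (idx X) k i" "a' \<in> Hom (idx X) k i"
    "f \<cdot> edge X a = f' \<cdot> edge X a'" and f': "f' \<in> Hom C (node X i) y"
    using m germ_iff[OF f] by blast
  obtain n c where c: "c \<in> Hom (idx X) n k" "a \<cdot>\<^bsub>idx X\<^esub> c = a' \<cdot>\<^bsub>idx X\<^esub> c"
    using I.cone_arrows[OF k(1,2)] by blast
  have "f \<cdot> edge X (a \<cdot>\<^bsub>idx X\<^esub> c) = f' \<cdot> edge X (a \<cdot>\<^bsub>idx X\<^esub> c)"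
    using Comp_edge[OF X f k(1) c(1)] Comp_edge[OF X f' k(2) c(1)] k(3) c(2) by simp
  then show ?thesis using c I.Comp_in_Hom[OF c(1) k(1)] by auto
qed


section \<open>Arrows between pro-objects\<close>

lemma pro_HomD:
  assumes F: "F \<in> Hom (Pro C) X Y"
  shows "pro_object C X" "pro_object C Y" "source F = X" "target F = Y"
  using F by (auto simp: Hom_def Pro_def pro_arr_def)

lemma pro_body_germ:
  assumes F: "F \<in> Hom (Pro C) X Y" and j: "j \<in> Obj (idx Y)" and m: "(i, \<phi>) \<in> body F j"
  shows "i \<in> Obj (idx X)" "\<phi> \<in> Hom C (node X i) (node Y j)" "body F j = germ C X i \<phi>"
proof -
  have "body F j \<in> colim_Hom C X (node Y j)"
    using F j by (auto simp: Hom_def Pro_def pro_arr_def)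
  then obtain i0 f where f: "body F j = germ C X i0 f" "i0 \<in> Obj (idx X)" "f \<in> Hom C (node X i0) (node Y j)"
    by (auto simp: colim_Hom_def)
  show "i \<in> Obj (idx X)" "\<phi> \<in> Hom C (node X i) (node Y j)"
    using m germ_iff[OF f(3)] f(1) by auto
  show "body F j = germ C X i \<phi>"
    using germ_eqI[OF pro_HomD(1)[OF F] f(2,3)] m f(1) by auto
qed

lemma pro_body_nonempty:
  assumes F: "F \<in> Hom (Pro C) X Y" and j: "j \<in> Obj (idx Y)"
  shows "\<exists>i \<phi>. (i, \<phi>) \<in> body F j"
proof -
  have "body F j \<in> colim_Hom C X (node Y j)"
    using F j by (auto simp: Hom_def Pro_def pro_arr_def)
  then show ?thesis
    using germ_refl[OF pro_HomD(1)[OF F]] by (auto simp: colim_Hom_def) blast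
qed

lemma post_comp_germ:
  assumes X: "pro_object C X" and i: "i \<in> Obj (idx X)" and f: "f \<in> Hom C (node X i) y"
    and g: "g \<in> Hom C y z"
  shows "post_comp C X g (germ C X i f) = germ C X i (g \<cdot> f)"
proof -
  have "germ C X i' (g \<cdot> f') = germ C X i (g \<cdot> f)" if "(i', f') \<in> germ C X i f" for i' f'
    using germ_eqI[OF X i Comp_in_Hom[OF f g]] germ_compose[OF X f g that] by auto
  then show ?thesis
    unfolding post_comp_def by (rule UN_case_const[OF _ germ_refl[OF X i f]])
qed

lemma pro_body_edge:
  assumes F: "F \<in> Hom (Pro C) X Y" and b: "b \<in> Hom (idx Y) j j'" and m: "(i, \<phi>) \<in> body F j"
  shows "(i, edge Y b \<cdot> \<phi>) \<in> body F j'"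
proof -
  note XY = pro_HomD[OF F]
  interpret J: cofiltered_category "idx Y" using pro_objectD(1)[OF XY(2)] .
  note j = J.Hom_objs[OF b]
  note B = pro_body_germ[OF F j(1) m] and Eb = pro_objectD(4)[OF XY(2) b]
  have "post_comp C X (edge Y b) (body F j) = body F j'"
    using F b by (auto simp: Hom_def Pro_def pro_arr_def)
  then have "body F j' = germ C X i (edge Y b \<cdot> \<phi>)"
    using B post_comp_germ[OF XY(1) B(1,2) Eb] by simp
  then show ?thesis using germ_refl[OF XY(1) B(1) Comp_in_Hom[OF B(2) Eb]] by simp
qed

lemma pro_body_restrict:
  assumes F: "F \<in> Hom (Pro C) X Y" and j: "j \<in> Obj (idx Y)" and a: "a \<in> Hom (idx X) k i"
    and m: "(i, \<phi>) \<in> body F j"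
  shows "(k, \<phi> \<cdot> edge X a) \<in> body F j"
  using pro_body_germ[OF F j m] germ_restrict[OF pro_HomD(1)[OF F] _ a] by simp

text \<open>
  A component determines all components below it, so it is enough to compare two arrows at a
  cofinal family of indices. For copy maps these will be the diagonal indices.
\<close>

lemma pro_arrow_eqI:
  assumes F: "F \<in> Hom (Pro C) X Y" and G: "G \<in> Hom (Pro C) X Y"
    and eq: "\<And>j. j \<in> Obj (idx Y) \<Longrightarrow> \<exists>j' i \<phi>. Hom (idx Y) j' j \<noteq> {} \<and> (i, \<phi>) \<in> body F j' \<and> (i, \<phi>) \<in> body G j'"
  shows "F = G"
proof -
  have "body F j = body G j" for j
  proof (cases "j \<in> Obj (idx Y)")
    case True
    then obtain j' i \<phi> b where b: "b \<in> Hom (idx Y) j' j" "(i, \<phi>) \<in> body F j'" "(i, \<phi>) \<in> body G j'"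
      using eq by blast
    show ?thesis
      using pro_body_germ(3)[OF F True pro_body_edge[OF F b(1,2)]]
        pro_body_germ(3)[OF G True pro_body_edge[OF G b(1,3)]] by simp
  next
    case False
    then show ?thesis using F G by (auto simp: Hom_def Pro_def pro_arr_def)
  qed
  then show ?thesis using pro_HomD[OF F] pro_HomD[OF G] by (auto intro!: arrow.equality)
qed

lemma mk_pro_body: "j \<in> Obj (idx Y) \<Longrightarrow> body (mk_pro X Y c) j = c j"
  by (simp add: mk_pro_def)

lemma mk_pro_in_Hom:
  assumes X: "pro_object C X" and Y: "pro_object C Y"
    and c: "\<And>j. j \<in> Obj (idx Y) \<Longrightarrow> \<exists>i\<in>Obj (idx X). \<exists>\<phi>\<in>Hom C (node X i) (node Y j). c j = germ C X i \<phi>"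
    and e: "\<And>b j j' i \<phi>. b \<in> Hom (idx Y) j j' \<Longrightarrow> (i, \<phi>) \<in> c j \<Longrightarrow> (i, edge Y b \<cdot> \<phi>) \<in> c j'"
  shows "mk_pro X Y c \<in> Hom (Pro C) X Y"
proof -
  interpret J: cofiltered_category "idx Y" using pro_objectD(1)[OF Y] .
  have "post_comp C X (edge Y b) (c j) = c j'" if b: "b \<in> Hom (idx Y) j j'" for b j j'
  proof -
    note j = J.Hom_objs[OF b] and Eb = pro_objectD(4)[OF Y b]
    obtain i \<phi> where i: "i \<in> Obj (idx X)" "\<phi> \<in> Hom C (node X i) (node Y j)" "c j = germ C X i \<phi>"
      using c[OF j(1)] by blast
    obtain i' \<phi>' where i': "i' \<in> Obj (idx X)" "\<phi>' \<in> Hom C (node X i') (node Y j')" "c j' = germ C X i' \<phi>'"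
      using c[OF j(2)] by blast
    have "(i, edge Y b \<cdot> \<phi>) \<in> germ C X i' \<phi>'"
      using e[OF b] i germ_refl[OF X i(1,2)] i' by simp
    then show ?thesis
      using germ_eqI[OF X i'(1,2)] post_comp_germ[OF X i(1,2) Eb] i i' by simp
  qed
  then have "\<forall>b\<in>Arr (idx Y). post_comp C X (edge Y b) (c (Dom (idx Y) b)) = c (Cod (idx Y) b)"
    by (auto simp: Hom_def)
  then show ?thesis
    using X Y c J.Dom_in_Obj J.Cod_in_Obj
    by (auto simp: Hom_def Pro_def pro_arr_def mk_pro_def colim_Hom_def) blast
qed

text \<open>
  Most of the arrows needed below choose one stage \<open>s j\<close> and one representative for each
  component. If \<open>s\<close> can be lifted to arrows compatibly with the representatives, these are the
  components of an arrow between pro-objects.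
\<close>

lemma level_arrow:
  assumes X: "pro_object C X" and Y: "pro_object C Y"
    and s: "\<And>j. j \<in> Obj (idx Y) \<Longrightarrow> s j \<in> Obj (idx X)"
    and \<phi>: "\<And>j. j \<in> Obj (idx Y) \<Longrightarrow> \<phi> j \<in> Hom C (node X (s j)) (node Y j)"
    and nat: "\<And>b j j'. b \<in> Hom (idx Y) j j' \<Longrightarrow>
      \<exists>a\<in>Hom (idx X) (s j) (s j'). edge Y b \<cdot> \<phi> j = \<phi> j' \<cdot> edge X a"
  shows "mk_pro X Y (\<lambda>j. germ C X (s j) (\<phi> j)) \<in> Hom (Pro C) X Y"
    and "j \<in> Obj (idx Y) \<Longrightarrow> (s j, \<phi> j) \<in> body (mk_pro X Y (\<lambda>j. germ C X (s j) (\<phi> j))) j"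
proof -
  interpret J: cofiltered_category "idx Y" using pro_objectD(1)[OF Y] .
  show "mk_pro X Y (\<lambda>j. germ C X (s j) (\<phi> j)) \<in> Hom (Pro C) X Y"
  proof (rule mk_pro_in_Hom[OF X Y])
    fix b j j' i \<psi>
    assume b: "b \<in> Hom (idx Y) j j'" and m: "(i, \<psi>) \<in> germ C X (s j) (\<phi> j)"
    note j = J.Hom_objs[OF b] and Eb = pro_objectD(4)[OF Y b]
    obtain a where a: "a \<in> Hom (idx X) (s j) (s j')" "edge Y b \<cdot> \<phi> j = \<phi> j' \<cdot> edge X a"
      using nat[OF b] by blast
    have "(s j, edge Y b \<cdot> \<phi> j) \<in> germ C X (s j') (\<phi> j')"
      unfolding a(2) by (rule germ_restrict[OF X \<phi>[OF j(2)] a(1)])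
    then show "(i, edge Y b \<cdot> \<psi>) \<in> germ C X (s j') (\<phi> j')"
      using germ_trans[OF X \<phi>[OF j(2)]] germ_compose[OF X \<phi>[OF j(1)] Eb m] by blast
  qed (use s \<phi> in blast)
  show "(s j, \<phi> j) \<in> body (mk_pro X Y (\<lambda>j. germ C X (s j) (\<phi> j))) j" if "j \<in> Obj (idx Y)"
    using that germ_refl[OF X s \<phi>] by (simp add: mk_pro_body)
qed

lemma pro_Ident:
  assumes X: "pro_object C X"
  shows "\<one>\<^bsub>Pro C\<^esub> X \<in> Hom (Pro C) X X"
    and "j \<in> Obj (idx X) \<Longrightarrow> (j, \<one> (node X j)) \<in> body (\<one>\<^bsub>Pro C\<^esub> X) j"
proof -
  have eq: "\<one>\<^bsub>Pro C\<^esub> X = mk_pro X X (\<lambda>j. germ C X j (\<one> (node X j)))"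
    by (simp add: Pro_def)
  have nat: "\<exists>a\<in>Hom (idx X) j j'. edge X b \<cdot> \<one> (node X j) = \<one> (node X j') \<cdot> edge X a"
    if "b \<in> Hom (idx X) j j'" for b j j'
    using that Comp_Ident[OF pro_objectD(4)[OF X that]] Ident_Comp[OF pro_objectD(4)[OF X that]]
    by (intro bexI[of _ b]) simp_all
  show "\<one>\<^bsub>Pro C\<^esub> X \<in> Hom (Pro C) X X"
    unfolding eq using nat Ident_in_Hom pro_objectD(2)[OF X] by (intro level_arrow[OF X X]) auto
  show "j \<in> Obj (idx X) \<Longrightarrow> (j, \<one> (node X j)) \<in> body (\<one>\<^bsub>Pro C\<^esub> X) j"
    unfolding eq using nat Ident_in_Hom pro_objectD(2)[OF X] by (intro level_arrow[OF X X]) auto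
qed

text \<open>
  Two representatives of the component of \<open>G\<close> become equal after restriction along arrows of the
  index category of \<open>Y\<close>, and the components of \<open>F\<close> are compatible with these arrows.
\<close>

lemma pro_Comp_body:
  assumes F: "F \<in> Hom (Pro C) X Y" and G: "G \<in> Hom (Pro C) Y Z" and l: "l \<in> Obj (idx Z)"
    and g: "(j, \<gamma>) \<in> body G l" and f: "(i, \<phi>) \<in> body F j"
  shows "body (G \<cdot>\<^bsub>Pro C\<^esub> F) l = germ C X i (\<gamma> \<cdot> \<phi>)"
proof -
  note XY = pro_HomD[OF F] and YZ = pro_HomD[OF G]
  interpret J: cofiltered_category "idx Y" using pro_objectD(1)[OF XY(2)] .
  note gB = pro_body_germ[OF G l g]
  note fB = pro_body_germ[OF F gB(1) f]
  have piece: "post_comp C X \<gamma>' (body F j') = germ C X i (\<gamma> \<cdot> \<phi>)" if g': "(j', \<gamma>') \<in> body G l" for j' \<gamma>'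
  proof -
    note gB' = pro_body_germ[OF G l g']
    obtain n b b' where n: "n \<in> Obj (idx Y)" "b \<in> Hom (idx Y) n j" "b' \<in> Hom (idx Y) n j'"
      "\<gamma> \<cdot> edge Y b = \<gamma>' \<cdot> edge Y b'"
      using g' germ_iff[OF gB(2)] gB(3) by blast
    obtain m \<psi> where p: "(m, \<psi>) \<in> body F n" using pro_body_nonempty[OF F n(1)] by blast
    note pB = pro_body_germ[OF F n(1) p]
    note pb = pro_body_edge[OF F n(2) p] and pb' = pro_body_edge[OF F n(3) p]
    note Eb = pro_objectD(4)[OF XY(2) n(2)] and Eb' = pro_objectD(4)[OF XY(2) n(3)]
    have "post_comp C X \<gamma>' (body F j') = germ C X m (\<gamma>' \<cdot> (edge Y b' \<cdot> \<psi>))"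
      using post_comp_germ[OF XY(1) pB(1) Comp_in_Hom[OF pB(2) Eb'] gB'(2)]
        pro_body_germ(3)[OF F gB'(1) pb'] by simp
    also have "\<gamma>' \<cdot> (edge Y b' \<cdot> \<psi>) = \<gamma> \<cdot> (edge Y b \<cdot> \<psi>)"
      using n(4) Comp_assoc[OF pB(2) Eb' gB'(2)] Comp_assoc[OF pB(2) Eb gB(2)] by simp
    also have "germ C X m \<dots> = post_comp C X \<gamma> (body F j)"
      using post_comp_germ[OF XY(1) pB(1) Comp_in_Hom[OF pB(2) Eb] gB(2)]
        pro_body_germ(3)[OF F gB(1) pb] by simp
    also have "\<dots> = germ C X i (\<gamma> \<cdot> \<phi>)"
      using post_comp_germ[OF XY(1) fB(1,2) gB(2)] fB(3) by simp
    finally show ?thesis .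
  qed
  have "body (G \<cdot>\<^bsub>Pro C\<^esub> F) l = (\<Union>(j, m)\<in>body G l. post_comp C X m (body F j))"
    using l XY YZ by (simp add: Pro_def mk_pro_def)
  also have "\<dots> = germ C X i (\<gamma> \<cdot> \<phi>)"
    by (rule UN_case_const[OF piece g])
  finally show ?thesis .
qed

lemma pro_Comp:
  assumes F: "F \<in> Hom (Pro C) X Y" and G: "G \<in> Hom (Pro C) Y Z"
  shows "G \<cdot>\<^bsub>Pro C\<^esub> F \<in> Hom (Pro C) X Z"
    and "l \<in> Obj (idx Z) \<Longrightarrow> (j, \<gamma>) \<in> body G l \<Longrightarrow> (i, \<phi>) \<in> body F j \<Longrightarrow>
      (i, \<gamma> \<cdot> \<phi>) \<in> body (G \<cdot>\<^bsub>Pro C\<^esub> F) l"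
proof -
  note XY = pro_HomD[OF F] and YZ = pro_HomD[OF G]
  interpret K: cofiltered_category "idx Z" using pro_objectD(1)[OF YZ(2)] .
  let ?c = "\<lambda>l. \<Union>(j, m)\<in>body G l. post_comp C X m (body F j)"
  have c: "?c l = body (G \<cdot>\<^bsub>Pro C\<^esub> F) l" if "l \<in> Obj (idx Z)" for l
    using that XY YZ by (simp add: Pro_def mk_pro_def)
  have mem: "(i, \<gamma> \<cdot> \<phi>) \<in> body (G \<cdot>\<^bsub>Pro C\<^esub> F) l"
    if l: "l \<in> Obj (idx Z)" and g: "(j, \<gamma>) \<in> body G l" and f: "(i, \<phi>) \<in> body F j" for l j i \<gamma> \<phi>
    using pro_Comp_body[OF F G l g f] pro_body_germ(1,2)[OF G l g] pro_body_germ(1,2)[OF F _ f]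
      germ_refl[OF XY(1) _ Comp_in_Hom] by metis
  then show "l \<in> Obj (idx Z) \<Longrightarrow> (j, \<gamma>) \<in> body G l \<Longrightarrow> (i, \<phi>) \<in> body F j \<Longrightarrow>
      (i, \<gamma> \<cdot> \<phi>) \<in> body (G \<cdot>\<^bsub>Pro C\<^esub> F) l" .
  have "mk_pro X Z ?c \<in> Hom (Pro C) X Z"
  proof (rule mk_pro_in_Hom[OF XY(1) YZ(2)])
    fix l assume l: "l \<in> Obj (idx Z)"
    obtain j \<gamma> where g: "(j, \<gamma>) \<in> body G l" using pro_body_nonempty[OF G l] by blast
    note gB = pro_body_germ[OF G l g]
    obtain i \<phi> where f: "(i, \<phi>) \<in> body F j" using pro_body_nonempty[OF F gB(1)] by blast
    note fB = pro_body_germ[OF F gB(1) f]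
    show "\<exists>i\<in>Obj (idx X). \<exists>\<phi>\<in>Hom C (node X i) (node Z l). ?c l = germ C X i \<phi>"
      using pro_Comp_body[OF F G l g f] c[OF l] fB(1) Comp_in_Hom[OF fB(2) gB(2)] by auto
  next
    fix b l l' m \<psi> assume b: "b \<in> Hom (idx Z) l l'" and m: "(m, \<psi>) \<in> ?c l"
    note l = K.Hom_objs[OF b] and Eb = pro_objectD(4)[OF YZ(2) b]
    obtain j \<gamma> where g: "(j, \<gamma>) \<in> body G l" using pro_body_nonempty[OF G l(1)] by blast
    note gB = pro_body_germ[OF G l(1) g]
    obtain i \<phi> where f: "(i, \<phi>) \<in> body F j" using pro_body_nonempty[OF F gB(1)] by blast
    note fB = pro_body_germ[OF F gB(1) f]
    have "(m, \<psi>) \<in> germ C X i (\<gamma> \<cdot> \<phi>)"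
      using m c[OF l(1)] pro_Comp_body[OF F G l(1) g f] by simp
    then have "(m, edge Z b \<cdot> \<psi>) \<in> germ C X i (edge Z b \<cdot> (\<gamma> \<cdot> \<phi>))"
      by (rule germ_compose[OF XY(1) Comp_in_Hom[OF fB(2) gB(2)] Eb])
    also have "edge Z b \<cdot> (\<gamma> \<cdot> \<phi>) = (edge Z b \<cdot> \<gamma>) \<cdot> \<phi>"
      using Comp_assoc[OF fB(2) gB(2) Eb] by simp
    also have "germ C X i \<dots> = ?c l'"
      using c[OF l(2)] pro_Comp_body[OF F G l(2) pro_body_edge[OF G b g] f] by simp
    finally show "(m, edge Z b \<cdot> \<psi>) \<in> ?c l'" .
  qed
  then show "G \<cdot>\<^bsub>Pro C\<^esub> F \<in> Hom (Pro C) X Z"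
    using XY YZ by (simp add: Pro_def)
qed

lemma Pro_objects: "X \<in> Obj (Pro C) \<longleftrightarrow> pro_object C X"
  by (simp add: Pro_def)

lemma Pro_category: "category (Pro C)"
proof
  fix F assume "F \<in> Arr (Pro C)"
  then show "Dom (Pro C) F \<in> Obj (Pro C)" "Cod (Pro C) F \<in> Obj (Pro C)"
    by (auto simp: Pro_def pro_arr_def)
next
  fix X assume "X \<in> Obj (Pro C)"
  then show "\<one>\<^bsub>Pro C\<^esub> X \<in> Hom (Pro C) X X" by (simp add: Pro_objects pro_Ident)
next
  fix F G X Y Z assume "F \<in> Hom (Pro C) X Y" "G \<in> Hom (Pro C) Y Z"
  then show "G \<cdot>\<^bsub>Pro C\<^esub> F \<in> Hom (Pro C) X Z" by (rule pro_Comp)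
next
  fix F X Y assume F: "F \<in> Hom (Pro C) X Y"
  note XY = pro_HomD[OF F]
  interpret J: cofiltered_category "idx Y" using pro_objectD(1)[OF XY(2)] .
  have id: "Hom (idx Y) j j \<noteq> {}" if "j \<in> Obj (idx Y)" for j using J.Ident_in_Hom[OF that] by blast
  show "F \<cdot>\<^bsub>Pro C\<^esub> \<one>\<^bsub>Pro C\<^esub> X = F"
  proof (rule pro_arrow_eqI[OF pro_Comp(1)[OF pro_Ident(1)[OF XY(1)] F] F])
    fix j assume j: "j \<in> Obj (idx Y)"
    obtain i \<phi> where f: "(i, \<phi>) \<in> body F j" using pro_body_nonempty[OF F j] by blast
    note fB = pro_body_germ[OF F j f]
    show "\<exists>j' i \<phi>. Hom (idx Y) j' j \<noteq> {} \<and> (i, \<phi>) \<in> body (F \<cdot>\<^bsub>Pro C\<^esub> \<one>\<^bsub>Pro C\<^esub> X) j' \<and> (i, \<phi>) \<in> body F j'"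
      using id[OF j] f pro_Comp(2)[OF pro_Ident(1)[OF XY(1)] F j f pro_Ident(2)[OF XY(1) fB(1)]]
        Comp_Ident[OF fB(2)] by auto
  qed
  show "\<one>\<^bsub>Pro C\<^esub> Y \<cdot>\<^bsub>Pro C\<^esub> F = F"
  proof (rule pro_arrow_eqI[OF pro_Comp(1)[OF F pro_Ident(1)[OF XY(2)]] F])
    fix j assume j: "j \<in> Obj (idx Y)"
    obtain i \<phi> where f: "(i, \<phi>) \<in> body F j" using pro_body_nonempty[OF F j] by blast
    note fB = pro_body_germ[OF F j f]
    show "\<exists>j' i \<phi>. Hom (idx Y) j' j \<noteq> {} \<and> (i, \<phi>) \<in> body (\<one>\<^bsub>Pro C\<^esub> Y \<cdot>\<^bsub>Pro C\<^esub> F) j' \<and> (i, \<phi>) \<in> body F j'"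
      using id[OF j] f pro_Comp(2)[OF F pro_Ident(1)[OF XY(2)] j pro_Ident(2)[OF XY(2) j] f]
        Ident_Comp[OF fB(2)] by auto
  qed
next
  fix F G H W X Y Z
  assume F: "F \<in> Hom (Pro C) W X" and G: "G \<in> Hom (Pro C) X Y" and H: "H \<in> Hom (Pro C) Y Z"
  interpret J: cofiltered_category "idx Z" using pro_objectD(1)[OF pro_HomD(2)[OF H]] .
  note GF = pro_Comp[OF F G] and HG = pro_Comp[OF G H]
  show "(H \<cdot>\<^bsub>Pro C\<^esub> G) \<cdot>\<^bsub>Pro C\<^esub> F = H \<cdot>\<^bsub>Pro C\<^esub> (G \<cdot>\<^bsub>Pro C\<^esub> F)"
  proof (rule pro_arrow_eqI[OF pro_Comp(1)[OF F HG(1)] pro_Comp(1)[OF GF(1) H]])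
    fix l assume l: "l \<in> Obj (idx Z)"
    obtain k \<eta> where h: "(k, \<eta>) \<in> body H l" using pro_body_nonempty[OF H l] by blast
    note hB = pro_body_germ[OF H l h]
    obtain j \<gamma> where g: "(j, \<gamma>) \<in> body G k" using pro_body_nonempty[OF G hB(1)] by blast
    note gB = pro_body_germ[OF G hB(1) g]
    obtain i \<phi> where f: "(i, \<phi>) \<in> body F j" using pro_body_nonempty[OF F gB(1)] by blast
    note fB = pro_body_germ[OF F gB(1) f]
    show "\<exists>j' i \<phi>. Hom (idx Z) j' l \<noteq> {} \<and> (i, \<phi>) \<in> body ((H \<cdot>\<^bsub>Pro C\<^esub> G) \<cdot>\<^bsub>Pro C\<^esub> F) j' \<and>
        (i, \<phi>) \<in> body (H \<cdot>\<^bsub>Pro C\<^esub> (G \<cdot>\<^bsub>Pro C\<^esub> F)) j'"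
      using J.Ident_in_Hom[OF l] Comp_assoc[OF fB(2) gB(2) hB(2)]
        pro_Comp(2)[OF F HG(1) l HG(2)[OF l h g] f] pro_Comp(2)[OF GF(1) H l h GF(2)[OF hB(1) g f]]
      by auto
  qed
qed

end


section \<open>Products of index categories\<close>

lemma Pair_in_pairs [simp]: "Pair x y \<in> pairs A B \<longleftrightarrow> x \<in> A \<and> y \<in> B"
  by (simp add: pairs_def)

lemma pairsE [elim!]:
  assumes "p \<in> pairs A B"
  obtains x y where "p = Pair x y" "x \<in> A" "y \<in> B"
  using assms by (auto simp: pairs_def)

lemma product_category_simps [simp]:
  "Obj (product_category I J) = pairs (Obj I) (Obj J)"
  "Arr (product_category I J) = pairs (Arr I) (Arr J)"
  "Dom (product_category I J) p = Pair (Dom I (pfst p)) (Dom J (psnd p))"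
  "Cod (product_category I J) p = Pair (Cod I (pfst p)) (Cod J (psnd p))"
  "Ident (product_category I J) p = Pair (\<one>\<^bsub>I\<^esub> (pfst p)) (\<one>\<^bsub>J\<^esub> (psnd p))"
  "Comp (product_category I J) q p = Pair (pfst q \<cdot>\<^bsub>I\<^esub> pfst p) (psnd q \<cdot>\<^bsub>J\<^esub> psnd p)"
  by (simp_all add: product_category_def)

lemma product_Hom_Pair [simp]:
  "Pair a b \<in> Hom (product_category I J) (Pair i j) (Pair i' j') \<longleftrightarrow> a \<in> Hom I i i' \<and> b \<in> Hom J j j'"
  by (auto simp: Hom_def)

lemma product_HomE:
  assumes "p \<in> Hom (product_category I J) q q'"
  obtains a b i j i' j' where "p = Pair a b" "q = Pair i j" "q' = Pair i' j'"
    "a \<in> Hom I i i'" "b \<in> Hom J j j'"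
  using assms by (auto simp: Hom_def)

lemma product_Hom_iff:
  "p \<in> Hom (product_category I J) q q' \<longleftrightarrow>
    (\<exists>a b i j i' j'. p = Pair a b \<and> q = Pair i j \<and> q' = Pair i' j' \<and> a \<in> Hom I i i' \<and> b \<in> Hom J j j')"
  by (auto elim!: product_HomE)

lemma product_category_category:
  assumes "category I" "category J"
  shows "category (product_category I J)"
proof -
  interpret I: category I by fact
  interpret J: category J by fact
  show ?thesis
  proof
    fix p assume "p \<in> Arr (product_category I J)"
    then show "Dom (product_category I J) p \<in> Obj (product_category I J)"
      "Cod (product_category I J) p \<in> Obj (product_category I J)"
      by (auto simp: I.Dom_in_Obj J.Dom_in_Obj I.Cod_in_Obj J.Cod_in_Obj)
  next
    fix x assume "x \<in> Obj (product_category I J)"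
    then show "\<one>\<^bsub>product_category I J\<^esub> x \<in> Hom (product_category I J) x x"
      by (auto simp: I.Ident_in_Hom J.Ident_in_Hom)
  next
    fix f g x y z assume "f \<in> Hom (product_category I J) x y" "g \<in> Hom (product_category I J) y z"
    then show "g \<cdot>\<^bsub>product_category I J\<^esub> f \<in> Hom (product_category I J) x z"
      by (elim product_HomE) (auto intro: I.Comp_in_Hom J.Comp_in_Hom)
  next
    fix f x y assume "f \<in> Hom (product_category I J) x y"
    then show "f \<cdot>\<^bsub>product_category I J\<^esub> \<one>\<^bsub>product_category I J\<^esub> x = f"
      and "\<one>\<^bsub>product_category I J\<^esub> y \<cdot>\<^bsub>product_category I J\<^esub> f = f"
      by (auto elim!: product_HomE simp: I.Comp_Ident J.Comp_Ident I.Ident_Comp J.Ident_Comp)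
  next
    fix f g h w x y z assume "f \<in> Hom (product_category I J) w x" "g \<in> Hom (product_category I J) x y"
      "h \<in> Hom (product_category I J) y z"
    then show "(h \<cdot>\<^bsub>product_category I J\<^esub> g) \<cdot>\<^bsub>product_category I J\<^esub> f =
        h \<cdot>\<^bsub>product_category I J\<^esub> (g \<cdot>\<^bsub>product_category I J\<^esub> f)"
      by (elim product_HomE) (simp add: I.Comp_assoc J.Comp_assoc)
  qed
qed

lemma product_category_cofiltered:
  assumes "cofiltered_category I" "cofiltered_category J"
  shows "cofiltered_category (product_category I J)"
proof -
  interpret I: cofiltered_category I by fact
  interpret J: cofiltered_category J by fact
  interpret P: category "product_category I J"
    by (rule product_category_category) unfold_locales
  show ?thesis
  proof
    show "Obj (product_category I J) \<noteq> {}"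
      using I.nonempty J.nonempty by (auto simp: pairs_def)
  next
    fix p q assume "p \<in> Obj (product_category I J)" "q \<in> Obj (product_category I J)"
    then obtain i j i' j' where pq: "p = Pair i j" "q = Pair i' j'" "i \<in> Obj I" "i' \<in> Obj I"
      "j \<in> Obj J" "j' \<in> Obj J" by auto
    obtain k a a' where "k \<in> Obj I" "a \<in> Hom I k i" "a' \<in> Hom I k i'"
      using I.cone_objects[OF pq(3,4)] by blast
    moreover obtain l b b' where "l \<in> Obj J" "b \<in> Hom J l j" "b' \<in> Hom J l j'"
      using J.cone_objects[OF pq(5,6)] by blast
    ultimately have "Pair k l \<in> Obj (product_category I J)"
      "Pair a b \<in> Hom (product_category I J) (Pair k l) p"
      "Pair a' b' \<in> Hom (product_category I J) (Pair k l) q" by (auto simp: pq)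
    then show "\<exists>k\<in>Obj (product_category I J). Hom (product_category I J) k p \<noteq> {} \<and>
        Hom (product_category I J) k q \<noteq> {}" by blast
  next
    fix p q x y assume p: "p \<in> Hom (product_category I J) x y" and q: "q \<in> Hom (product_category I J) x y"
    obtain a b i j i' j' where pp: "p = Pair a b" "x = Pair i j" "y = Pair i' j'"
      "a \<in> Hom I i i'" "b \<in> Hom J j j'" using p by (rule product_HomE)
    obtain a' b' where qq: "q = Pair a' b'" "a' \<in> Hom I i i'" "b' \<in> Hom J j j'"
      using q pp(2,3) by (elim product_HomE) auto
    obtain k c where "k \<in> Obj I" "c \<in> Hom I k i" "a \<cdot>\<^bsub>I\<^esub> c = a' \<cdot>\<^bsub>I\<^esub> c"
      using I.cone_arrows[OF pp(4) qq(2)] by blast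
    moreover obtain l d where "l \<in> Obj J" "d \<in> Hom J l j" "b \<cdot>\<^bsub>J\<^esub> d = b' \<cdot>\<^bsub>J\<^esub> d"
      using J.cone_arrows[OF pp(5) qq(3)] by blast
    ultimately have "Pair k l \<in> Obj (product_category I J)"
      "Pair c d \<in> Hom (product_category I J) (Pair k l) x"
      "p \<cdot>\<^bsub>product_category I J\<^esub> Pair c d = q \<cdot>\<^bsub>product_category I J\<^esub> Pair c d"
      by (auto simp: pp qq)
    then show "\<exists>k\<in>Obj (product_category I J). \<exists>c\<in>Hom (product_category I J) k x.
        p \<cdot>\<^bsub>product_category I J\<^esub> c = q \<cdot>\<^bsub>product_category I J\<^esub> c" by blast
  qed
qed

lemma point_category_simps [simp]:
  "Obj point_category = {Pt}" "Arr point_category = {Pt}" "Dom point_category a = Pt"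
  "Cod point_category a = Pt" "Ident point_category i = Pt" "Comp point_category b a = Pt"
  by (simp_all add: point_category_def)

lemma point_Hom [simp]: "a \<in> Hom point_category i j \<longleftrightarrow> a = Pt \<and> i = Pt \<and> j = Pt"
  by (auto simp: Hom_def)

lemma point_category_cofiltered: "cofiltered_category point_category"
  by unfold_locales (auto simp: ex_in_conv[symmetric])


section \<open>The monoidal structure on pro-objects\<close>

lemma pro_tensor_simps [simp]:
  "idx (pro_tensor M X Y) = product_category (idx X) (idx Y)"
  "node (pro_tensor M X Y) p = node X (pfst p) \<odot>\<^bsub>M\<^esub> node Y (psnd p)"
  "edge (pro_tensor M X Y) p = edge X (pfst p) \<otimes>\<^bsub>M\<^esub> edge Y (psnd p)"
  by (simp_all add: pro_tensor_def)

lemma pro_unit_simps [simp]: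
  "idx (pro_unit M) = point_category" "node (pro_unit M) i = Unit M"
  "edge (pro_unit M) a = \<one>\<^bsub>M\<^esub> (Unit M)"
  by (simp_all add: pro_unit_def)

lemma pro_markov_simps:
  "Obj (pro_markov M P) = Obj P" "Arr (pro_markov M P) = Arr P" "Dom (pro_markov M P) = Dom P"
  "Cod (pro_markov M P) = Cod P" "Ident (pro_markov M P) = Ident P" "Comp (pro_markov M P) = Comp P"
  "TensorO (pro_markov M P) = pro_tensor M"
  "Unit (pro_markov M P) = pro_unit M"
  by (simp_all add: pro_markov_def cat_data.defs markov_data.defs)

context symmetric_monoidal_category
begin

lemma pro_tensor_object:
  assumes X: "pro_object M X" and Y: "pro_object M Y"
  shows "pro_object M (pro_tensor M X Y)"
  unfolding pro_object_def is_functor_def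
proof (intro conjI ballI impI)
  show "cofiltered_category (idx (pro_tensor M X Y))"
    using product_category_cofiltered pro_objectD(1)[OF X] pro_objectD(1)[OF Y] by simp
next
  fix i assume "i \<in> Obj (idx (pro_tensor M X Y))"
  then show "node (pro_tensor M X Y) i \<in> Obj M"
    "edge (pro_tensor M X Y) (\<one>\<^bsub>idx (pro_tensor M X Y)\<^esub> i) = \<one> (node (pro_tensor M X Y) i)"
    using pro_objectD(2,3)[OF X] pro_objectD(2,3)[OF Y]
    by (auto simp: TensorO_in_Obj TensorA_Ident)
next
  fix a assume "a \<in> Arr (idx (pro_tensor M X Y))"
  then obtain b c where "a = Pair b c" "b \<in> Arr (idx X)" "c \<in> Arr (idx Y)" by auto
  then show "edge (pro_tensor M X Y) a \<in> Hom M
      (node (pro_tensor M X Y) (Dom (idx (pro_tensor M X Y)) a))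
      (node (pro_tensor M X Y) (Cod (idx (pro_tensor M X Y)) a))"
    using pro_objectD(4)[OF X HomI] pro_objectD(4)[OF Y HomI] by (simp add: TensorA_in_Hom)
next
  fix a b assume "a \<in> Arr (idx (pro_tensor M X Y))" "b \<in> Arr (idx (pro_tensor M X Y))"
    "Dom (idx (pro_tensor M X Y)) b = Cod (idx (pro_tensor M X Y)) a"
  then obtain p q p' q' where ab: "a = Pair p q" "b = Pair p' q'" and
    Hom: "p \<in> Hom (idx X) (Dom (idx X) p) (Cod (idx X) p)" "p' \<in> Hom (idx X) (Cod (idx X) p) (Cod (idx X) p')"
    "q \<in> Hom (idx Y) (Dom (idx Y) q) (Cod (idx Y) q)" "q' \<in> Hom (idx Y) (Cod (idx Y) q) (Cod (idx Y) q')"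
    by (auto simp: Hom_def)
  show "edge (pro_tensor M X Y) (b \<cdot>\<^bsub>idx (pro_tensor M X Y)\<^esub> a) =
      edge (pro_tensor M X Y) b \<cdot> edge (pro_tensor M X Y) a"
    using pro_objectD(5)[OF X Hom(1,2)] pro_objectD(5)[OF Y Hom(3,4)]
      TensorA_Comp[OF pro_objectD(4)[OF X Hom(1)] pro_objectD(4)[OF X Hom(2)]
        pro_objectD(4)[OF Y Hom(3)] pro_objectD(4)[OF Y Hom(4)]]
    by (simp add: ab)
qed

lemma pro_unit_object: "pro_object M (pro_unit M)"
  using point_category_cofiltered Unit_in_Obj Ident_in_Hom[OF Unit_in_Obj]
    Comp_Ident[OF Ident_in_Hom[OF Unit_in_Obj]]
  by (simp add: pro_object_def is_functor_def)

lemma germ_tensor: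
  assumes X: "pro_object M X" and Y: "pro_object M Y"
    and f: "f \<in> Hom M (node X i) x" and g: "g \<in> Hom M (node Y j) y"
    and f': "(i', f') \<in> germ M X i f" and g': "(j', g') \<in> germ M Y j g"
  shows "(Pair i' j', f' \<otimes> g') \<in> germ M (pro_tensor M X Y) (Pair i j) (f \<otimes> g)"
proof -
  obtain k a a' where k: "k \<in> Obj (idx X)" "a \<in> Hom (idx X) k i" "a' \<in> Hom (idx X) k i'"
    "f \<cdot> edge X a = f' \<cdot> edge X a'" and F: "f' \<in> Hom M (node X i') x" "i' \<in> Obj (idx X)"
    using f' germ_iff[OF f] by blast
  obtain l b b' where l: "l \<in> Obj (idx Y)" "b \<in> Hom (idx Y) l j" "b' \<in> Hom (idx Y) l j'"
    "g \<cdot> edge Y b = g' \<cdot> edge Y b'" and G: "g' \<in> Hom M (node Y j') y" "j' \<in> Obj (idx Y)"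
    using g' germ_iff[OF g] by blast
  show ?thesis
  proof (rule germI[OF pro_tensor_object[OF X Y]])
    show "Pair a b \<in> Hom (idx (pro_tensor M X Y)) (Pair k l) (Pair i j)"
      "Pair a' b' \<in> Hom (idx (pro_tensor M X Y)) (Pair k l) (Pair i' j')"
      using k l by auto
    show "f \<otimes> g \<in> Hom M (node (pro_tensor M X Y) (Pair i j)) (x \<odot> y)"
      "f' \<otimes> g' \<in> Hom M (node (pro_tensor M X Y) (Pair i' j')) (x \<odot> y)"
      using TensorA_in_Hom f g F G by auto
    show "(f \<otimes> g) \<cdot> edge (pro_tensor M X Y) (Pair a b) =
        (f' \<otimes> g') \<cdot> edge (pro_tensor M X Y) (Pair a' b')"
      using TensorA_Comp[OF pro_objectD(4)[OF X k(2)] f pro_objectD(4)[OF Y l(2)] g]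
        TensorA_Comp[OF pro_objectD(4)[OF X k(3)] F(1) pro_objectD(4)[OF Y l(3)] G(1)] k(4) l(4)
      by simp
  qed
qed

end

text \<open>
  The class \<open>S\<close> cuts out the full subcategory \<open>N\<close> of \<open>Pro(M)\<close>; for the theorem it consists of the
  diagrams that factor through finite sets and functions. The symmetric monoidal structure holds
  for every \<open>S\<close> that is closed under the tensor product.
\<close>

locale pro_monoidal = symmetric_monoidal_category M
  for M :: "('o, 'm, 'z) markov_data_scheme" (structure) +
  fixes S :: "('a, 'o, 'm) diagram set"
  assumes unit_closed: "pro_unit M \<in> S"
    and tensor_closed: "X \<in> S \<Longrightarrow> Y \<in> S \<Longrightarrow> pro_tensor M X Y \<in> S"
begin

abbreviation N :: "(('a, 'o, 'm) diagram, ('a, 'o, 'm) pro_arrow) markov_data" where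
  "N \<equiv> pro_markov M (full_subcategory (Pro M) S)"

lemma N_Hom: "F \<in> Hom N X Y \<longleftrightarrow> F \<in> Hom (Pro M) X Y \<and> X \<in> S \<and> Y \<in> S"
  by (auto simp: pro_markov_simps full_subcategory_simps Hom_def)

lemma N_Obj: "X \<in> Obj N \<longleftrightarrow> pro_object M X \<and> X \<in> S"
  by (simp add: pro_markov_simps full_subcategory_simps Pro_objects)

lemma N_category: "category N"
  using full_subcategory_category[OF Pro_category, of S]
  by (simp add: category_def pro_markov_simps Hom_def)

sublocale N: category N
  by (rule N_category)

lemma N_tensor_Obj: "X \<in> Obj N \<Longrightarrow> Y \<in> Obj N \<Longrightarrow> pro_tensor M X Y \<in> Obj N"
  by (simp add: N_Obj pro_tensor_object tensor_closed)

lemma N_unit_Obj: "pro_unit M \<in> Obj N"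
  by (simp add: N_Obj pro_unit_object unit_closed)

text \<open>
  The working notion of the whole argument: the \<open>j\<close>-th component of \<open>F : X \<rightarrow> Y\<close> has the
  representative \<open>\<phi> : X\<^sub>i \<rightarrow> Y\<^sub>j\<close>. Representatives of composites, tensor products and structural arrows
  are the corresponding composites, tensor products and structural arrows of \<open>M\<close>. Thus a law
  for \<open>N\<close> reduces to the same law for \<open>M\<close>, as soon as both sides are represented at one index
  and one stage.
\<close>

definition rep :: "('a, 'o, 'm) pro_arrow \<Rightarrow> ('a, 'o, 'm) diagram \<Rightarrow> ('a, 'o, 'm) diagram \<Rightarrow>
    'a univ \<Rightarrow> 'a univ \<Rightarrow> 'm \<Rightarrow> bool" where
  "rep F X Y j i \<phi> \<longleftrightarrow> F \<in> Hom N X Y \<and> j \<in> Obj (idx Y) \<and> (i, \<phi>) \<in> body F j"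

lemma repD:
  assumes "rep F X Y j i \<phi>"
  shows "F \<in> Hom N X Y" "j \<in> Obj (idx Y)" "i \<in> Obj (idx X)" "\<phi> \<in> Hom M (node X i) (node Y j)"
  using assms pro_body_germ(1,2)[of F X Y j i \<phi>] unfolding rep_def N_Hom by auto

lemma rep_exists:
  assumes "F \<in> Hom N X Y" "j \<in> Obj (idx Y)"
  obtains i \<phi> where "rep F X Y j i \<phi>"
  using pro_body_nonempty assms unfolding rep_def N_Hom by blast

lemma rep_restrict: "rep F X Y j i \<phi> \<Longrightarrow> a \<in> Hom (idx X) k i \<Longrightarrow> rep F X Y j k (\<phi> \<cdot> edge X a)"
  using pro_body_restrict unfolding rep_def N_Hom by blast

lemma rep_same_stage:
  assumes "rep F X Y j i \<phi>" "rep F X Y j i \<psi>"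
  shows "\<exists>k. \<exists>a\<in>Hom (idx X) k i. \<phi> \<cdot> edge X a = \<psi> \<cdot> edge X a"
proof -
  have F: "F \<in> Hom (Pro M) X Y" and j: "j \<in> Obj (idx Y)" and m: "(i, \<phi>) \<in> body F j" "(i, \<psi>) \<in> body F j"
    using assms by (auto simp: rep_def N_Hom)
  note B = pro_body_germ[OF F j m(1)]
  show ?thesis using germ_same_stage[OF pro_HomD(1)[OF F] B(2)] m B by simp
qed

lemma rep_eqI:
  assumes Y: "Y \<in> Obj N"
    and eq: "\<And>j. j \<in> Obj (idx Y) \<Longrightarrow>
      \<exists>j' i \<phi>. Hom (idx Y) j' j \<noteq> {} \<and> rep F X Y j' i \<phi> \<and> rep G X Y j' i \<phi>"
  shows "F = G"
proof -
  interpret J: cofiltered_category "idx Y" using Y pro_objectD(1) N_Obj by blast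
  obtain j where "j \<in> Obj (idx Y)" using J.nonempty by blast
  then obtain j' i \<phi> where "rep F X Y j' i \<phi>" "rep G X Y j' i \<phi>" using eq by blast
  then have FG: "F \<in> Hom (Pro M) X Y" "G \<in> Hom (Pro M) X Y" using repD(1) N_Hom by blast+
  show ?thesis
  proof (rule pro_arrow_eqI[OF FG])
    fix j assume "j \<in> Obj (idx Y)"
    then obtain j' i \<phi> where "Hom (idx Y) j' j \<noteq> {}" "rep F X Y j' i \<phi>" "rep G X Y j' i \<phi>"
      using eq by blast
    then show "\<exists>j' i \<phi>. Hom (idx Y) j' j \<noteq> {} \<and> (i, \<phi>) \<in> body F j' \<and> (i, \<phi>) \<in> body G j'"
      by (auto simp: rep_def)
  qed
qed

lemma rep_eqI_pointwise:
  assumes Y: "Y \<in> Obj N"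
    and eq: "\<And>j. j \<in> Obj (idx Y) \<Longrightarrow> \<exists>i \<phi>. rep F X Y j i \<phi> \<and> rep G X Y j i \<phi>"
  shows "F = G"
proof (rule rep_eqI[OF Y])
  interpret J: cofiltered_category "idx Y" using Y pro_objectD(1) N_Obj by blast
  show "\<exists>j' i \<phi>. Hom (idx Y) j' j \<noteq> {} \<and> rep F X Y j' i \<phi> \<and> rep G X Y j' i \<phi>"
    if "j \<in> Obj (idx Y)" for j
    using eq[OF that] J.Ident_in_Hom[OF that] by blast
qed

lemma rep_Ident: "X \<in> Obj N \<Longrightarrow> j \<in> Obj (idx X) \<Longrightarrow> rep (\<one>\<^bsub>N\<^esub> X) X X j j (\<one> (node X j))"
  using pro_Ident[of X] N_Obj[of X]
  by (simp add: rep_def N_Hom) (simp add: pro_markov_simps full_subcategory_simps)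

lemma rep_Comp:
  assumes "rep G Y Z l j \<gamma>" "rep F X Y j i \<phi>"
  shows "rep (G \<cdot>\<^bsub>N\<^esub> F) X Z l i (\<gamma> \<cdot> \<phi>)"
proof -
  have F: "F \<in> Hom (Pro M) X Y" and G: "G \<in> Hom (Pro M) Y Z"
    using assms by (auto simp: rep_def N_Hom)
  have "G \<cdot>\<^bsub>N\<^esub> F = G \<cdot>\<^bsub>Pro M\<^esub> F"
    by (simp add: pro_markov_simps full_subcategory_simps)
  then show ?thesis
    using assms pro_Comp(1)[OF F G] pro_Comp(2)[OF F G] by (auto simp: rep_def N_Hom)
qed

lemma N_level_arrow:
  assumes X: "X \<in> Obj N" and Y: "Y \<in> Obj N"
    and s: "\<And>j. j \<in> Obj (idx Y) \<Longrightarrow> s j \<in> Obj (idx X)"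
    and \<phi>: "\<And>j. j \<in> Obj (idx Y) \<Longrightarrow> \<phi> j \<in> Hom M (node X (s j)) (node Y j)"
    and nat: "\<And>b j j'. b \<in> Hom (idx Y) j j' \<Longrightarrow>
      \<exists>a\<in>Hom (idx X) (s j) (s j'). edge Y b \<cdot> \<phi> j = \<phi> j' \<cdot> edge X a"
  shows "mk_pro X Y (\<lambda>j. germ M X (s j) (\<phi> j)) \<in> Hom N X Y"
    and "j \<in> Obj (idx Y) \<Longrightarrow> rep (mk_pro X Y (\<lambda>j. germ M X (s j) (\<phi> j))) X Y j (s j) (\<phi> j)"
  using level_arrow[of X Y s \<phi>] X Y s \<phi> nat unfolding rep_def N_Hom N_Obj by auto

text \<open>
  If \<open>s\<close> is bijective with inverse \<open>t\<close> and every \<open>\<phi> j\<close> is invertible, the inverses form a level arrow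
  along \<open>t\<close>; its naturality is the given one read backwards.
\<close>

lemma N_level_iso:
  assumes X: "X \<in> Obj N" and Y: "Y \<in> Obj N"
    and s: "\<And>j. j \<in> Obj (idx Y) \<Longrightarrow> s j \<in> Obj (idx X)" "\<And>j. j \<in> Obj (idx Y) \<Longrightarrow> t (s j) = j"
    and t: "\<And>i. i \<in> Obj (idx X) \<Longrightarrow> t i \<in> Obj (idx Y)" "\<And>i. i \<in> Obj (idx X) \<Longrightarrow> s (t i) = i"
    and \<phi>: "\<And>j. j \<in> Obj (idx Y) \<Longrightarrow> \<phi> j \<in> Hom M (node X (s j)) (node Y j)"
      "\<And>j. j \<in> Obj (idx Y) \<Longrightarrow> is_iso M (\<phi> j)"
    and nat: "\<And>b j j'. b \<in> Hom (idx Y) j j' \<Longrightarrow>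
      \<exists>a\<in>Hom (idx X) (s j) (s j'). edge Y b \<cdot> \<phi> j = \<phi> j' \<cdot> edge X a"
    and nat': "\<And>a i i'. a \<in> Hom (idx X) i i' \<Longrightarrow>
      \<exists>b\<in>Hom (idx Y) (t i) (t i'). edge Y b \<cdot> \<phi> (t i) = \<phi> (t i') \<cdot> edge X a"
  shows "is_iso N (mk_pro X Y (\<lambda>j. germ M X (s j) (\<phi> j)))"
    and "i \<in> Obj (idx X) \<Longrightarrow> rep (inverse_of N (mk_pro X Y (\<lambda>j. germ M X (s j) (\<phi> j)))) Y X
      i (t i) (inverse_of M (\<phi> (t i)))"
proof -
  let ?F = "mk_pro X Y (\<lambda>j. germ M X (s j) (\<phi> j))"
  let ?\<psi> = "\<lambda>i. inverse_of M (\<phi> (t i))"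
  let ?G = "mk_pro Y X (\<lambda>i. germ M Y (t i) (?\<psi> i))"
  note F = N_level_arrow[of X Y s \<phi>, OF X Y s(1) \<phi>(1) nat]
  interpret I: cofiltered_category "idx X" using X pro_objectD(1) N_Obj by blast
  have \<phi>t: "\<phi> (t i) \<in> Hom M (node X i) (node Y (t i))" if "i \<in> Obj (idx X)" for i
    using \<phi>(1)[OF t(1)[OF that]] t(2)[OF that] by simp
  note inv = inverse_of_iso[OF \<phi>t \<phi>(2)[OF t(1)]]
  have natG: "\<exists>b\<in>Hom (idx Y) (t i) (t i'). edge X a \<cdot> ?\<psi> i = ?\<psi> i' \<cdot> edge Y b"
    if a: "a \<in> Hom (idx X) i i'" for a i i'
  proof -
    note i = I.Hom_objs[OF a]
    obtain b where b: "b \<in> Hom (idx Y) (t i) (t i')" "edge Y b \<cdot> \<phi> (t i) = \<phi> (t i') \<cdot> edge X a"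
      using nat'[OF a] by blast
    have "?\<psi> i' \<cdot> edge Y b = edge X a \<cdot> ?\<psi> i"
      using inverse_of_natural[OF \<phi>t[OF i(1)] \<phi>(2)[OF t(1)[OF i(1)]] \<phi>t[OF i(2)] \<phi>(2)[OF t(1)[OF i(2)]]]
        pro_objectD(4) X Y a b N_Obj by metis
    then show ?thesis using b by (intro bexI[of _ b]) simp_all
  qed
  note G = N_level_arrow[of Y X t ?\<psi>, OF Y X t(1) inv(1) natG]
  have "?G \<cdot>\<^bsub>N\<^esub> ?F = \<one>\<^bsub>N\<^esub> X"
  proof (rule rep_eqI_pointwise[OF X])
    fix i assume i: "i \<in> Obj (idx X)"
    have "rep (?G \<cdot>\<^bsub>N\<^esub> ?F) X X i (s (t i)) (?\<psi> i \<cdot> \<phi> (t i))"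
      by (rule rep_Comp[OF G(2) F(2)]) (use i t in auto)
    then show "\<exists>j \<phi>. rep (?G \<cdot>\<^bsub>N\<^esub> ?F) X X i j \<phi> \<and> rep (\<one>\<^bsub>N\<^esub> X) X X i j \<phi>"
      using inv(2)[OF i i] t(2)[OF i] rep_Ident[OF X i] by auto
  qed
  moreover have "?F \<cdot>\<^bsub>N\<^esub> ?G = \<one>\<^bsub>N\<^esub> Y"
  proof (rule rep_eqI_pointwise[OF Y])
    fix j assume j: "j \<in> Obj (idx Y)"
    have "rep (?F \<cdot>\<^bsub>N\<^esub> ?G) Y Y j (t (s j)) (\<phi> j \<cdot> ?\<psi> (s j))"
      by (rule rep_Comp[OF F(2) G(2)]) (use j s in auto)
    then show "\<exists>i \<phi>. rep (?F \<cdot>\<^bsub>N\<^esub> ?G) Y Y j i \<phi> \<and> rep (\<one>\<^bsub>N\<^esub> Y) Y Y j i \<phi>"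
      using inv(3)[OF s(1)[OF j] s(1)[OF j]] s(2)[OF j] rep_Ident[OF Y j] by auto
  qed
  ultimately show "is_iso N ?F"
    and "i \<in> Obj (idx X) \<Longrightarrow> rep (inverse_of N ?F) Y X i (t i) (?\<psi> i)"
    using N.inverse_arrowsI[OF F(1) G(1)] N.inverse_of_eqI[OF F(1) G(1)] G(2)
    unfolding is_iso_def by auto
qed

lemma N_TensorA_body:
  assumes F: "F \<in> Hom (Pro M) X Y" and G: "G \<in> Hom (Pro M) X' Y'"
    and j: "j \<in> Obj (idx Y)" "j' \<in> Obj (idx Y')"
    and f: "(i, \<phi>) \<in> body F j" and g: "(i', \<gamma>) \<in> body G j'"
  shows "body (F \<otimes>\<^bsub>N\<^esub> G) (Pair j j') = germ M (pro_tensor M X X') (Pair i i') (\<phi> \<otimes> \<gamma>)"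
proof -
  note XY = pro_HomD[OF F] and XY' = pro_HomD[OF G]
  note fB = pro_body_germ[OF F j(1) f] and gB = pro_body_germ[OF G j(2) g]
  note T = pro_tensor_object[OF XY(1) XY'(1)]
  have piece: "germ M (pro_tensor M X X') (Pair k k') (f' \<otimes> g') =
      germ M (pro_tensor M X X') (Pair i i') (\<phi> \<otimes> \<gamma>)"
    if "(k, f') \<in> body F j" "(k', g') \<in> body G j'" for k f' k' g'
  proof (rule germ_eqI[OF T])
    show "(Pair k k', f' \<otimes> g') \<in> germ M (pro_tensor M X X') (Pair i i') (\<phi> \<otimes> \<gamma>)"
      using germ_tensor[OF XY(1) XY'(1) fB(2) gB(2)] that fB(3) gB(3) by simp
  qed (use fB gB in \<open>auto intro: TensorA_in_Hom\<close>)
  have "body (F \<otimes>\<^bsub>N\<^esub> G) (Pair j j') = (\<Union>(i, k)\<in>body F j. \<Union>(j, l)\<in>body G j'.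
      germ M (pro_tensor M X X') (Pair i j) (k \<otimes> l))"
    using j XY XY' by (simp add: pro_markov_def cat_data.defs markov_data.defs mk_pro_def)
  also have "\<dots> = germ M (pro_tensor M X X') (Pair i i') (\<phi> \<otimes> \<gamma>)"
    by (rule UN_case_const[OF UN_case_const[OF piece g] f])
  finally show ?thesis .
qed

lemma N_TensorA:
  assumes F: "F \<in> Hom N X Y" and G: "G \<in> Hom N X' Y'"
  shows "F \<otimes>\<^bsub>N\<^esub> G \<in> Hom N (pro_tensor M X X') (pro_tensor M Y Y')"
proof -
  have F': "F \<in> Hom (Pro M) X Y" and G': "G \<in> Hom (Pro M) X' Y'" using F G by (auto simp: N_Hom)
  note XY = pro_HomD[OF F'] and XY' = pro_HomD[OF G']
  interpret J: cofiltered_category "idx Y" using pro_objectD(1)[OF XY(2)] .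
  interpret J': cofiltered_category "idx Y'" using pro_objectD(1)[OF XY'(2)] .
  let ?T = "pro_tensor M X X'"
  note T = pro_tensor_object[OF XY(1) XY'(1)] and T' = pro_tensor_object[OF XY(2) XY'(2)]
  obtain c where c: "F \<otimes>\<^bsub>N\<^esub> G = mk_pro ?T (pro_tensor M Y Y') c"
    using XY XY' by (simp add: pro_markov_def cat_data.defs markov_data.defs)
  have cb: "body (F \<otimes>\<^bsub>N\<^esub> G) q = c q" if "q \<in> Obj (idx (pro_tensor M Y Y'))" for q
    using mk_pro_body[OF that] c by metis
  have "mk_pro ?T (pro_tensor M Y Y') c \<in> Hom (Pro M) ?T (pro_tensor M Y Y')"
  proof (rule mk_pro_in_Hom[OF T T'])
    fix q assume q: "q \<in> Obj (idx (pro_tensor M Y Y'))"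
    then obtain j j' where j: "q = Pair j j'" "j \<in> Obj (idx Y)" "j' \<in> Obj (idx Y')" by auto
    obtain i \<phi> where f: "(i, \<phi>) \<in> body F j" using pro_body_nonempty[OF F' j(2)] by blast
    obtain i' \<gamma> where g: "(i', \<gamma>) \<in> body G j'" using pro_body_nonempty[OF G' j(3)] by blast
    note fB = pro_body_germ[OF F' j(2) f] and gB = pro_body_germ[OF G' j(3) g]
    show "\<exists>p\<in>Obj (idx ?T). \<exists>\<psi>\<in>Hom M (node ?T p) (node (pro_tensor M Y Y') q). c q = germ M ?T p \<psi>"
      using N_TensorA_body[OF F' G' j(2,3) f g] cb[OF q] fB gB TensorA_in_Hom[OF fB(2) gB(2)] j(1)
      by (intro bexI[of _ "Pair i i'"] bexI[of _ "\<phi> \<otimes> \<gamma>"]) simp_all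
  next
    fix b q q' p \<psi> assume b: "b \<in> Hom (idx (pro_tensor M Y Y')) q q'" and m: "(p, \<psi>) \<in> c q"
    obtain a d j j' k k' where ab: "b = Pair a d" "q = Pair j j'" "q' = Pair k k'"
      "a \<in> Hom (idx Y) j k" "d \<in> Hom (idx Y') j' k'"
      using b unfolding pro_tensor_simps by (rule product_HomE)
    note j = J.Hom_objs[OF ab(4)] and j' = J'.Hom_objs[OF ab(5)]
    obtain i \<phi> where f: "(i, \<phi>) \<in> body F j" using pro_body_nonempty[OF F' j(1)] by blast
    obtain i' \<gamma> where g: "(i', \<gamma>) \<in> body G j'" using pro_body_nonempty[OF G' j'(1)] by blast
    note fB = pro_body_germ[OF F' j(1) f] and gB = pro_body_germ[OF G' j'(1) g]
    note Ea = pro_objectD(4)[OF XY(2) ab(4)] and Ed = pro_objectD(4)[OF XY'(2) ab(5)]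
    have "(p, \<psi>) \<in> germ M ?T (Pair i i') (\<phi> \<otimes> \<gamma>)"
      using N_TensorA_body[OF F' G' j(1) j'(1) f g] cb[of q] j(1) j'(1) ab(2) m by simp
    then have "(p, (edge Y a \<otimes> edge Y' d) \<cdot> \<psi>) \<in>
        germ M ?T (Pair i i') ((edge Y a \<otimes> edge Y' d) \<cdot> (\<phi> \<otimes> \<gamma>))"
      using germ_compose[OF T _ TensorA_in_Hom[OF Ea Ed]] TensorA_in_Hom[OF fB(2) gB(2)] by simp
    also have "(edge Y a \<otimes> edge Y' d) \<cdot> (\<phi> \<otimes> \<gamma>) = (edge Y a \<cdot> \<phi>) \<otimes> (edge Y' d \<cdot> \<gamma>)"
      using TensorA_Comp[OF fB(2) Ea gB(2) Ed] by simp
    also have "germ M ?T (Pair i i') \<dots> = c q'"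
      using N_TensorA_body[OF F' G' j(2) j'(2) pro_body_edge[OF F' ab(4) f] pro_body_edge[OF G' ab(5) g]]
        cb[of q'] j(2) j'(2) ab(3) by simp
    finally show "(p, edge (pro_tensor M Y Y') b \<cdot> \<psi>) \<in> c q'" by (simp add: ab)
  qed
  then show ?thesis using F G tensor_closed unfolding N_Hom c by blast
qed

lemma rep_Tensor:
  assumes "rep F X Y j i \<phi>" "rep G X' Y' j' i' \<gamma>"
  shows "rep (F \<otimes>\<^bsub>N\<^esub> G) (pro_tensor M X X') (pro_tensor M Y Y') (Pair j j') (Pair i i') (\<phi> \<otimes> \<gamma>)"
proof -
  note 1 = repD[OF assms(1)] and 2 = repD[OF assms(2)]
  note T = pro_tensor_object[OF pro_HomD(1) pro_HomD(1)]
  have "(Pair i i', \<phi> \<otimes> \<gamma>) \<in> body (F \<otimes>\<^bsub>N\<^esub> G) (Pair j j')"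
    using N_TensorA_body[of F X Y G X' Y' j j' i \<phi> i' \<gamma>] assms 1 2 germ_refl[OF T, of F X Y G X' Y']
      TensorA_in_Hom[OF 1(4) 2(4)]
    by (simp add: rep_def N_Hom)
  then show ?thesis using N_TensorA[OF 1(1) 2(1)] 1 2 by (simp add: rep_def)
qed

end


context pro_monoidal
begin

text \<open>
  In the rules for structural arrows the nodes occur through equations such as \<open>x = node X i\<close>, because
  a node of a tensor product is normally written as a tensor product of nodes.
\<close>

lemma N_Assoc:
  assumes X: "X \<in> Obj N" and Y: "Y \<in> Obj N" and Z: "Z \<in> Obj N"
  shows "Assoc N X Y Z \<in> Hom N (pro_tensor M (pro_tensor M X Y) Z) (pro_tensor M X (pro_tensor M Y Z))"
    and "is_iso N (Assoc N X Y Z)"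
    and rep_Assoc: "i \<in> Obj (idx X) \<Longrightarrow> j \<in> Obj (idx Y) \<Longrightarrow> k \<in> Obj (idx Z) \<Longrightarrow>
      x = node X i \<Longrightarrow> y = node Y j \<Longrightarrow> z = node Z k \<Longrightarrow>
      rep (Assoc N X Y Z) (pro_tensor M (pro_tensor M X Y) Z) (pro_tensor M X (pro_tensor M Y Z))
        (Pair i (Pair j k)) (Pair (Pair i j) k) (Assoc M x y z)"
    and rep_inverse_Assoc: "i \<in> Obj (idx X) \<Longrightarrow> j \<in> Obj (idx Y) \<Longrightarrow> k \<in> Obj (idx Z) \<Longrightarrow>
      x = node X i \<Longrightarrow> y = node Y j \<Longrightarrow> z = node Z k \<Longrightarrow>
      rep (inverse_of N (Assoc N X Y Z)) (pro_tensor M X (pro_tensor M Y Z)) (pro_tensor M (pro_tensor M X Y) Z)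
        (Pair (Pair i j) k) (Pair i (Pair j k)) (inverse_of M (Assoc M x y z))"
proof -
  let ?A = "pro_tensor M (pro_tensor M X Y) Z" and ?B = "pro_tensor M X (pro_tensor M Y Z)"
  define s t :: "'a univ \<Rightarrow> 'a univ" and \<phi> where
    "s = (\<lambda>p. Pair (Pair (pfst p) (pfst (psnd p))) (psnd (psnd p)))" and
    "t = (\<lambda>p. Pair (pfst (pfst p)) (Pair (psnd (pfst p)) (psnd p)))" and
    "\<phi> = (\<lambda>p. Assoc M (node X (pfst p)) (node Y (pfst (psnd p))) (node Z (psnd (psnd p))))"
  note stphi = s_def t_def \<phi>_def
  have eq: "Assoc N X Y Z = mk_pro ?A ?B (\<lambda>p. germ M ?A (s p) (\<phi> p))"
    by (simp add: pro_markov_def cat_data.defs markov_data.defs stphi Let_def)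
  have A: "?A \<in> Obj N" and B: "?B \<in> Obj N" using X Y Z by (simp_all add: N_tensor_Obj)
  note nodes = pro_objectD(2)[of M X] pro_objectD(2)[of M Y] pro_objectD(2)[of M Z]
  have ob: "pro_object M X" "pro_object M Y" "pro_object M Z" using X Y Z by (simp_all add: N_Obj)
  note E = pro_objectD(4)[OF ob(1)] pro_objectD(4)[OF ob(2)] pro_objectD(4)[OF ob(3)]
  have c: "s j \<in> Obj (idx ?A)" "t (s j) = j" "\<phi> j \<in> Hom M (node ?A (s j)) (node ?B j)" "is_iso M (\<phi> j)"
    if "j \<in> Obj (idx ?B)" for j
    using that nodes ob by (auto simp: stphi Assoc_in_Hom Assoc_iso)
  have c': "t i \<in> Obj (idx ?B)" "s (t i) = i" if "i \<in> Obj (idx ?A)" for i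
    using that by (auto simp: stphi)
  have nat: "\<exists>a\<in>Hom (idx ?A) (s j) (s j'). edge ?B b \<cdot> \<phi> j = \<phi> j' \<cdot> edge ?A a"
    if m: "b \<in> Hom (idx ?B) j j'" for b j j'
  proof -
    obtain a1 a2 a3 i1 i2 i3 j1 j2 j3 where "b = Pair a1 (Pair a2 a3)"
      "j = Pair i1 (Pair i2 i3)" "j' = Pair j1 (Pair j2 j3)"
      and H: "a1 \<in> Hom (idx X) i1 j1" "a2 \<in> Hom (idx Y) i2 j2" "a3 \<in> Hom (idx Z) i3 j3"
      using m by (auto simp: product_Hom_iff)
    then show ?thesis
      using Assoc_natural[OF E(1)[OF H(1)] E(2)[OF H(2)] E(3)[OF H(3)]]
      by (intro bexI[of _ "Pair (Pair a1 a2) a3"]) (simp_all add: stphi)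
  qed
  have nat': "\<exists>b\<in>Hom (idx ?B) (t i) (t i'). edge ?B b \<cdot> \<phi> (t i) = \<phi> (t i') \<cdot> edge ?A a"
    if m: "a \<in> Hom (idx ?A) i i'" for a i i'
  proof -
    obtain a1 a2 a3 i1 i2 i3 j1 j2 j3 where "a = Pair (Pair a1 a2) a3"
      "i = Pair (Pair i1 i2) i3" "i' = Pair (Pair j1 j2) j3"
      and H: "a1 \<in> Hom (idx X) i1 j1" "a2 \<in> Hom (idx Y) i2 j2" "a3 \<in> Hom (idx Z) i3 j3"
      using m by (auto simp: product_Hom_iff)
    then show ?thesis
      using Assoc_natural[OF E(1)[OF H(1)] E(2)[OF H(2)] E(3)[OF H(3)]]
      by (intro bexI[of _ "Pair a1 (Pair a2 a3)"]) (simp_all add: stphi)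
  qed
  note L = N_level_arrow[of ?A ?B s \<phi>, OF A B c(1,3) nat]
  note I = N_level_iso[of ?A ?B s t \<phi>, OF A B c(1,2) c' c(3,4) nat nat']
  show "Assoc N X Y Z \<in> Hom N ?A ?B" "is_iso N (Assoc N X Y Z)"
    unfolding eq by (rule L(1) I(1); assumption)+
  assume ijk: "i \<in> Obj (idx X)" "j \<in> Obj (idx Y)" "k \<in> Obj (idx Z)"
    "x = node X i" "y = node Y j" "z = node Z k"
  show "rep (Assoc N X Y Z) ?A ?B (Pair i (Pair j k)) (Pair (Pair i j) k) (Assoc M x y z)"
    unfolding eq using L(2)[of "Pair i (Pair j k)"] ijk by (simp add: stphi)
  show "rep (inverse_of N (Assoc N X Y Z)) ?B ?A (Pair (Pair i j) k) (Pair i (Pair j k))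
      (inverse_of M (Assoc M x y z))"
    unfolding eq using I(2)[of "Pair (Pair i j) k"] ijk by (simp add: stphi)
qed

lemma N_Lunit:
  assumes X: "X \<in> Obj N"
  shows "Lunit N X \<in> Hom N (pro_tensor M (pro_unit M) X) X"
    and "is_iso N (Lunit N X)"
    and rep_Lunit: "i \<in> Obj (idx X) \<Longrightarrow> x = node X i \<Longrightarrow>
      rep (Lunit N X) (pro_tensor M (pro_unit M) X) X i (Pair Pt i) (Lunit M x)"
proof -
  let ?A = "pro_tensor M (pro_unit M) X"
  define s t :: "'a univ \<Rightarrow> 'a univ" and \<phi> where
    "s = (\<lambda>j. Pair Pt j)" and "t = (\<lambda>p. psnd p)" and "\<phi> = (\<lambda>j. Lunit M (node X j))"
  note stphi = s_def t_def \<phi>_def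
  have eq: "Lunit N X = mk_pro ?A X (\<lambda>p. germ M ?A (s p) (\<phi> p))"
    by (simp add: pro_markov_def cat_data.defs markov_data.defs stphi)
  have A: "?A \<in> Obj N" using X by (simp add: N_tensor_Obj N_unit_Obj)
  have ob: "pro_object M X" using X by (simp add: N_Obj)
  note E = pro_objectD(4)[OF ob]
  have c: "s j \<in> Obj (idx ?A)" "t (s j) = j" "\<phi> j \<in> Hom M (node ?A (s j)) (node X j)" "is_iso M (\<phi> j)"
    if "j \<in> Obj (idx X)" for j
    using that pro_objectD(2)[OF ob] by (auto simp: stphi Lunit_in_Hom Lunit_iso)
  have c': "t i \<in> Obj (idx X)" "s (t i) = i" if "i \<in> Obj (idx ?A)" for i
    using that by (auto simp: stphi)
  have nat: "\<exists>a\<in>Hom (idx ?A) (s j) (s j'). edge X b \<cdot> \<phi> j = \<phi> j' \<cdot> edge ?A a"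
    if "b \<in> Hom (idx X) j j'" for b j j'
    using that Lunit_natural[OF E[OF that]] by (intro bexI[of _ "Pair Pt b"]) (simp_all add: stphi)
  have nat': "\<exists>b\<in>Hom (idx X) (t i) (t i'). edge X b \<cdot> \<phi> (t i) = \<phi> (t i') \<cdot> edge ?A a"
    if m: "a \<in> Hom (idx ?A) i i'" for a i i'
  proof -
    obtain b j j' where "a = Pair Pt b" "i = Pair Pt j" "i' = Pair Pt j'" and H: "b \<in> Hom (idx X) j j'"
      using m by (auto simp: product_Hom_iff)
    then show ?thesis
      using Lunit_natural[OF E[OF H]] by (intro bexI[of _ b]) (simp_all add: stphi)
  qed
  note L = N_level_arrow[of ?A X s \<phi>, OF A X c(1,3) nat]
  note I = N_level_iso[of ?A X s t \<phi>, OF A X c(1,2) c' c(3,4) nat nat']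
  show "Lunit N X \<in> Hom N ?A X" "is_iso N (Lunit N X)"
    unfolding eq by (rule L(1) I(1); assumption)+
  assume "i \<in> Obj (idx X)" "x = node X i"
  then show "rep (Lunit N X) ?A X i (Pair Pt i) (Lunit M x)"
    unfolding eq using L(2)[of i] by (simp add: stphi)
qed

lemma N_Runit:
  assumes X: "X \<in> Obj N"
  shows "Runit N X \<in> Hom N (pro_tensor M X (pro_unit M)) X"
    and "is_iso N (Runit N X)"
    and rep_Runit: "i \<in> Obj (idx X) \<Longrightarrow> x = node X i \<Longrightarrow>
      rep (Runit N X) (pro_tensor M X (pro_unit M)) X i (Pair i Pt) (Runit M x)"
proof -
  let ?A = "pro_tensor M X (pro_unit M)"
  define s t :: "'a univ \<Rightarrow> 'a univ" and \<phi> where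
    "s = (\<lambda>j. Pair j Pt)" and "t = (\<lambda>p. pfst p)" and "\<phi> = (\<lambda>j. Runit M (node X j))"
  note stphi = s_def t_def \<phi>_def
  have eq: "Runit N X = mk_pro ?A X (\<lambda>p. germ M ?A (s p) (\<phi> p))"
    by (simp add: pro_markov_def cat_data.defs markov_data.defs stphi)
  have A: "?A \<in> Obj N" using X by (simp add: N_tensor_Obj N_unit_Obj)
  have ob: "pro_object M X" using X by (simp add: N_Obj)
  note E = pro_objectD(4)[OF ob]
  have c: "s j \<in> Obj (idx ?A)" "t (s j) = j" "\<phi> j \<in> Hom M (node ?A (s j)) (node X j)" "is_iso M (\<phi> j)"
    if "j \<in> Obj (idx X)" for j
    using that pro_objectD(2)[OF ob] by (auto simp: stphi Runit_in_Hom Runit_iso)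
  have c': "t i \<in> Obj (idx X)" "s (t i) = i" if "i \<in> Obj (idx ?A)" for i
    using that by (auto simp: stphi)
  have nat: "\<exists>a\<in>Hom (idx ?A) (s j) (s j'). edge X b \<cdot> \<phi> j = \<phi> j' \<cdot> edge ?A a"
    if "b \<in> Hom (idx X) j j'" for b j j'
    using that Runit_natural[OF E[OF that]] by (intro bexI[of _ "Pair b Pt"]) (simp_all add: stphi)
  have nat': "\<exists>b\<in>Hom (idx X) (t i) (t i'). edge X b \<cdot> \<phi> (t i) = \<phi> (t i') \<cdot> edge ?A a"
    if m: "a \<in> Hom (idx ?A) i i'" for a i i'
  proof -
    obtain b j j' where "a = Pair b Pt" "i = Pair j Pt" "i' = Pair j' Pt" and H: "b \<in> Hom (idx X) j j'"
      using m by (auto simp: product_Hom_iff)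
    then show ?thesis
      using Runit_natural[OF E[OF H]] by (intro bexI[of _ b]) (simp_all add: stphi)
  qed
  note L = N_level_arrow[of ?A X s \<phi>, OF A X c(1,3) nat]
  note I = N_level_iso[of ?A X s t \<phi>, OF A X c(1,2) c' c(3,4) nat nat']
  show "Runit N X \<in> Hom N ?A X" "is_iso N (Runit N X)"
    unfolding eq by (rule L(1) I(1); assumption)+
  assume "i \<in> Obj (idx X)" "x = node X i"
  then show "rep (Runit N X) ?A X i (Pair i Pt) (Runit M x)"
    unfolding eq using L(2)[of i] by (simp add: stphi)
qed

lemma N_Swap:
  assumes X: "X \<in> Obj N" and Y: "Y \<in> Obj N"
  shows "Swap N X Y \<in> Hom N (pro_tensor M X Y) (pro_tensor M Y X)"
    and rep_Swap: "i \<in> Obj (idx X) \<Longrightarrow> j \<in> Obj (idx Y) \<Longrightarrow> x = node X i \<Longrightarrow> y = node Y j \<Longrightarrow>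
      rep (Swap N X Y) (pro_tensor M X Y) (pro_tensor M Y X) (Pair j i) (Pair i j) (Swap M x y)"
proof -
  let ?A = "pro_tensor M X Y" and ?B = "pro_tensor M Y X"
  define s :: "'a univ \<Rightarrow> 'a univ" and \<phi> where
    "s = (\<lambda>p. Pair (psnd p) (pfst p))" and
    "\<phi> = (\<lambda>p. Swap M (node X (psnd p)) (node Y (pfst p)))"
  note sphi = s_def \<phi>_def
  have eq: "Swap N X Y = mk_pro ?A ?B (\<lambda>p. germ M ?A (s p) (\<phi> p))"
    by (simp add: pro_markov_def cat_data.defs markov_data.defs sphi)
  have A: "?A \<in> Obj N" and B: "?B \<in> Obj N" using X Y by (simp_all add: N_tensor_Obj)
  have ob: "pro_object M X" "pro_object M Y" using X Y by (simp_all add: N_Obj)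
  note E = pro_objectD(4)[OF ob(1)] pro_objectD(4)[OF ob(2)]
  have c: "s j \<in> Obj (idx ?A)" "\<phi> j \<in> Hom M (node ?A (s j)) (node ?B j)"
    if "j \<in> Obj (idx ?B)" for j
    using that pro_objectD(2)[OF ob(1)] pro_objectD(2)[OF ob(2)] by (auto simp: sphi Swap_in_Hom)
  have nat: "\<exists>a\<in>Hom (idx ?A) (s j) (s j'). edge ?B b \<cdot> \<phi> j = \<phi> j' \<cdot> edge ?A a"
    if m: "b \<in> Hom (idx ?B) j j'" for b j j'
  proof -
    obtain a1 a2 i1 i2 j1 j2 where "b = Pair a2 a1" "j = Pair i2 i1" "j' = Pair j2 j1"
      and H: "a1 \<in> Hom (idx X) i1 j1" "a2 \<in> Hom (idx Y) i2 j2"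
      using m by (auto simp: product_Hom_iff)
    then show ?thesis
      using Swap_natural[OF E(1)[OF H(1)] E(2)[OF H(2)]]
      by (intro bexI[of _ "Pair a1 a2"]) (simp_all add: sphi)
  qed
  note L = N_level_arrow[of ?A ?B s \<phi>, OF A B c nat]
  show "Swap N X Y \<in> Hom N ?A ?B"
    unfolding eq by (rule L(1); assumption)
  assume "i \<in> Obj (idx X)" "j \<in> Obj (idx Y)" "x = node X i" "y = node Y j"
  then show "rep (Swap N X Y) ?A ?B (Pair j i) (Pair i j) (Swap M x y)"
    unfolding eq using L(2)[of "Pair j i"] by (simp add: sphi)
qed

lemma rep_Ident': "X \<in> Obj N \<Longrightarrow> j \<in> Obj (idx X) \<Longrightarrow> x = node X j \<Longrightarrow> rep (\<one>\<^bsub>N\<^esub> X) X X j j (\<one> x)"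
  using rep_Ident by blast

text \<open>
  This splits the comparison of two arrows into a representative of each and an equation in \<open>M\<close>.
\<close>

lemma rep_agree: "rep F X Y j i \<phi> \<Longrightarrow> rep G X Y j i \<psi> \<Longrightarrow> \<phi> = \<psi> \<Longrightarrow>
    \<exists>i \<phi>. rep F X Y j i \<phi> \<and> rep G X Y j i \<phi>"
  by blast

lemmas rep_rules = rep_Comp rep_Tensor rep_Assoc rep_inverse_Assoc rep_Lunit rep_Runit rep_Swap rep_Ident'

lemma N_TensorO [simp]: "TensorO N = pro_tensor M"
  by (simp add: pro_markov_simps)

lemma N_Unit [simp]: "Unit N = pro_unit M"
  by (simp add: pro_markov_simps)

lemma N_node: "X \<in> Obj N \<Longrightarrow> i \<in> Obj (idx X) \<Longrightarrow> node X i \<in> Obj M"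
  by (simp add: N_Obj pro_objectD(2))

lemmas N_obj_simps = N_tensor_Obj N_unit_Obj

theorem N_symmetric_monoidal: "symmetric_monoidal_category N"
proof (intro symmetric_monoidal_category.intro symmetric_monoidal_category_axioms.intro,
    unfold N_TensorO N_Unit)
  show "category N" by (rule N_category)
next
  fix x y assume "x \<in> Obj N" "y \<in> Obj N"
  then show "pro_tensor M x y \<in> Obj N" by (rule N_tensor_Obj)
next
  fix f x y g x' y' assume "f \<in> Hom N x y" "g \<in> Hom N x' y'"
  then show "f \<otimes>\<^bsub>N\<^esub> g \<in> Hom N (pro_tensor M x x') (pro_tensor M y y')" by (rule N_TensorA)
next
  fix X Y assume XY: "X \<in> Obj N" "Y \<in> Obj N"
  show "\<one>\<^bsub>N\<^esub> X \<otimes>\<^bsub>N\<^esub> \<one>\<^bsub>N\<^esub> Y = \<one>\<^bsub>N\<^esub> (pro_tensor M X Y)"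
  proof (rule rep_eqI_pointwise[OF N_tensor_Obj[OF XY]])
    fix q assume "q \<in> Obj (idx (pro_tensor M X Y))"
    then obtain i j where q: "q = Pair i j" "i \<in> Obj (idx X)" "j \<in> Obj (idx Y)" by auto
    have "rep (\<one>\<^bsub>N\<^esub> X \<otimes>\<^bsub>N\<^esub> \<one>\<^bsub>N\<^esub> Y) (pro_tensor M X Y) (pro_tensor M X Y) q q (\<one> (node X i) \<otimes> \<one> (node Y j))"
      unfolding q by (rule rep_rules | simp add: XY q)+
    moreover have "rep (\<one>\<^bsub>N\<^esub> (pro_tensor M X Y)) (pro_tensor M X Y) (pro_tensor M X Y) q q (\<one> (node X i \<odot> node Y j))"
      unfolding q by (rule rep_rules | simp add: XY q N_obj_simps)+
    ultimately show "\<exists>i \<phi>. rep (\<one>\<^bsub>N\<^esub> X \<otimes>\<^bsub>N\<^esub> \<one>\<^bsub>N\<^esub> Y) (pro_tensor M X Y) (pro_tensor M X Y) q i \<phi> \<and>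
        rep (\<one>\<^bsub>N\<^esub> (pro_tensor M X Y)) (pro_tensor M X Y) (pro_tensor M X Y) q i \<phi>"
      by (rule rep_agree) (rule TensorA_Ident N_node XY q)+
  qed
next
  fix F X Y G Z F' X' Y' G' Z'
  assume F: "F \<in> Hom N X Y" and G: "G \<in> Hom N Y Z" and F': "F' \<in> Hom N X' Y'" and G': "G' \<in> Hom N Y' Z'"
  show "(G \<cdot>\<^bsub>N\<^esub> F) \<otimes>\<^bsub>N\<^esub> (G' \<cdot>\<^bsub>N\<^esub> F') = (G \<otimes>\<^bsub>N\<^esub> G') \<cdot>\<^bsub>N\<^esub> (F \<otimes>\<^bsub>N\<^esub> F')"
  proof (rule rep_eqI_pointwise[OF N_tensor_Obj[OF N.Hom_objs(2)[OF G] N.Hom_objs(2)[OF G']]])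
    fix q assume "q \<in> Obj (idx (pro_tensor M Z Z'))"
    then obtain l l' where q: "q = Pair l l'" "l \<in> Obj (idx Z)" "l' \<in> Obj (idx Z')" by auto
    obtain j \<gamma> where g: "rep G Y Z l j \<gamma>" using G q(2) by (rule rep_exists)
    obtain i \<phi> where f: "rep F X Y j i \<phi>" using F repD(3)[OF g] by (rule rep_exists)
    obtain j' \<gamma>' where g': "rep G' Y' Z' l' j' \<gamma>'" using G' q(3) by (rule rep_exists)
    obtain i' \<phi>' where f': "rep F' X' Y' j' i' \<phi>'" using F' repD(3)[OF g'] by (rule rep_exists)
    have "rep ((G \<cdot>\<^bsub>N\<^esub> F) \<otimes>\<^bsub>N\<^esub> (G' \<cdot>\<^bsub>N\<^esub> F')) (pro_tensor M X X') (pro_tensor M Z Z') q (Pair i i')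
        ((\<gamma> \<cdot> \<phi>) \<otimes> (\<gamma>' \<cdot> \<phi>'))"
      unfolding q by (rule f g f' g' rep_rules)+
    moreover have "rep ((G \<otimes>\<^bsub>N\<^esub> G') \<cdot>\<^bsub>N\<^esub> (F \<otimes>\<^bsub>N\<^esub> F')) (pro_tensor M X X') (pro_tensor M Z Z') q (Pair i i')
        ((\<gamma> \<otimes> \<gamma>') \<cdot> (\<phi> \<otimes> \<phi>'))"
      unfolding q by (rule f g f' g' rep_rules)+
    ultimately show "\<exists>i \<phi>. rep ((G \<cdot>\<^bsub>N\<^esub> F) \<otimes>\<^bsub>N\<^esub> (G' \<cdot>\<^bsub>N\<^esub> F')) (pro_tensor M X X') (pro_tensor M Z Z') q i \<phi> \<and>
        rep ((G \<otimes>\<^bsub>N\<^esub> G') \<cdot>\<^bsub>N\<^esub> (F \<otimes>\<^bsub>N\<^esub> F')) (pro_tensor M X X') (pro_tensor M Z Z') q i \<phi>"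
      by (rule rep_agree) (rule TensorA_Comp repD(4) f g f' g')+
  qed
next
  show "pro_unit M \<in> Obj N" by (rule N_unit_Obj)
next
  fix x y z assume "x \<in> Obj N" "y \<in> Obj N" "z \<in> Obj N"
  then show "Assoc N x y z \<in> Hom N (pro_tensor M (pro_tensor M x y) z) (pro_tensor M x (pro_tensor M y z))"
    "is_iso N (Assoc N x y z)" by (rule N_Assoc)+
next
  fix F X X' G Y Y' H Z Z'
  assume F: "F \<in> Hom N X X'" and G: "G \<in> Hom N Y Y'" and H: "H \<in> Hom N Z Z'"
  note obs = N.Hom_objs[OF F] N.Hom_objs[OF G] N.Hom_objs[OF H]
  let ?A = "pro_tensor M (pro_tensor M X Y) Z" and ?B = "pro_tensor M X' (pro_tensor M Y' Z')"
  show "Assoc N X' Y' Z' \<cdot>\<^bsub>N\<^esub> ((F \<otimes>\<^bsub>N\<^esub> G) \<otimes>\<^bsub>N\<^esub> H) = (F \<otimes>\<^bsub>N\<^esub> (G \<otimes>\<^bsub>N\<^esub> H)) \<cdot>\<^bsub>N\<^esub> Assoc N X Y Z" (is "?L = ?R")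
  proof (rule rep_eqI_pointwise)
    show "?B \<in> Obj N" by (simp add: obs N_obj_simps)
    fix q assume "q \<in> Obj (idx ?B)"
    then obtain i' j' k' where q: "q = Pair i' (Pair j' k')" "i' \<in> Obj (idx X')" "j' \<in> Obj (idx Y')"
      "k' \<in> Obj (idx Z')" by auto
    obtain i \<phi> where f: "rep F X X' i' i \<phi>" using F q(2) by (rule rep_exists)
    obtain j \<gamma> where g: "rep G Y Y' j' j \<gamma>" using G q(3) by (rule rep_exists)
    obtain k \<eta> where h: "rep H Z Z' k' k \<eta>" using H q(4) by (rule rep_exists)
    note st = repD(3)[OF f] repD(3)[OF g] repD(3)[OF h]
    have "rep ?L ?A ?B q (Pair (Pair i j) k)
        (Assoc M (node X' i') (node Y' j') (node Z' k') \<cdot> ((\<phi> \<otimes> \<gamma>) \<otimes> \<eta>))"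
      unfolding q by (rule f g h rep_rules | simp add: obs q st)+
    moreover have "rep ?R ?A ?B q (Pair (Pair i j) k)
        ((\<phi> \<otimes> (\<gamma> \<otimes> \<eta>)) \<cdot> Assoc M (node X i) (node Y j) (node Z k))"
      unfolding q by (rule f g h rep_rules | simp add: obs q st)+
    ultimately show "\<exists>i \<phi>. rep ?L ?A ?B q i \<phi> \<and> rep ?R ?A ?B q i \<phi>"
      by (rule rep_agree) (rule Assoc_natural repD(4) f g h)+
  qed
next
  fix X assume "X \<in> Obj N"
  then show "Lunit N X \<in> Hom N (pro_tensor M (pro_unit M) X) X" "is_iso N (Lunit N X)"
    "Runit N X \<in> Hom N (pro_tensor M X (pro_unit M)) X" "is_iso N (Runit N X)"
    by (rule N_Lunit N_Runit)+
next
  fix F X Y assume F: "F \<in> Hom N X Y"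
  note obs = N.Hom_objs[OF F]
  show "Lunit N Y \<cdot>\<^bsub>N\<^esub> (\<one>\<^bsub>N\<^esub> (pro_unit M) \<otimes>\<^bsub>N\<^esub> F) = F \<cdot>\<^bsub>N\<^esub> Lunit N X" (is "?L = ?R")
  proof (rule rep_eqI_pointwise)
    show "Y \<in> Obj N" by (rule obs)
    fix j assume j: "j \<in> Obj (idx Y)"
    obtain i \<phi> where f: "rep F X Y j i \<phi>" using F j by (rule rep_exists)
    note st = repD(3)[OF f]
    have "rep ?L (pro_tensor M (pro_unit M) X) Y j (Pair Pt i) (Lunit M (node Y j) \<cdot> (\<one> (Unit M) \<otimes> \<phi>))"
      by (rule f rep_rules | simp add: obs j st N_obj_simps)+
    moreover have "rep ?R (pro_tensor M (pro_unit M) X) Y j (Pair Pt i) (\<phi> \<cdot> Lunit M (node X i))"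
      by (rule f rep_rules | simp add: obs j st N_obj_simps)+
    ultimately show "\<exists>i \<phi>. rep ?L (pro_tensor M (pro_unit M) X) Y j i \<phi> \<and> rep ?R (pro_tensor M (pro_unit M) X) Y j i \<phi>"
      by (rule rep_agree) (rule Lunit_natural repD(4) f)+
  qed
  show "Runit N Y \<cdot>\<^bsub>N\<^esub> (F \<otimes>\<^bsub>N\<^esub> \<one>\<^bsub>N\<^esub> (pro_unit M)) = F \<cdot>\<^bsub>N\<^esub> Runit N X" (is "?L = ?R")
  proof (rule rep_eqI_pointwise)
    show "Y \<in> Obj N" by (rule obs)
    fix j assume j: "j \<in> Obj (idx Y)"
    obtain i \<phi> where f: "rep F X Y j i \<phi>" using F j by (rule rep_exists)
    note st = repD(3)[OF f]
    have "rep ?L (pro_tensor M X (pro_unit M)) Y j (Pair i Pt) (Runit M (node Y j) \<cdot> (\<phi> \<otimes> \<one> (Unit M)))"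
      by (rule f rep_rules | simp add: obs j st N_obj_simps)+
    moreover have "rep ?R (pro_tensor M X (pro_unit M)) Y j (Pair i Pt) (\<phi> \<cdot> Runit M (node X i))"
      by (rule f rep_rules | simp add: obs j st N_obj_simps)+
    ultimately show "\<exists>i \<phi>. rep ?L (pro_tensor M X (pro_unit M)) Y j i \<phi> \<and> rep ?R (pro_tensor M X (pro_unit M)) Y j i \<phi>"
      by (rule rep_agree) (rule Runit_natural repD(4) f)+
  qed
next
  fix W X Y Z assume obs: "W \<in> Obj N" "X \<in> Obj N" "Y \<in> Obj N" "Z \<in> Obj N"
  let ?A = "pro_tensor M (pro_tensor M (pro_tensor M W X) Y) Z"
  let ?B = "pro_tensor M W (pro_tensor M X (pro_tensor M Y Z))"
  show "Assoc N W X (pro_tensor M Y Z) \<cdot>\<^bsub>N\<^esub> Assoc N (pro_tensor M W X) Y Z =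
      (\<one>\<^bsub>N\<^esub> W \<otimes>\<^bsub>N\<^esub> Assoc N X Y Z) \<cdot>\<^bsub>N\<^esub> Assoc N W (pro_tensor M X Y) Z \<cdot>\<^bsub>N\<^esub> (Assoc N W X Y \<otimes>\<^bsub>N\<^esub> \<one>\<^bsub>N\<^esub> Z)"
    (is "?L = ?R")
  proof (rule rep_eqI_pointwise)
    show "?B \<in> Obj N" by (simp add: obs N_obj_simps)
    fix q assume "q \<in> Obj (idx ?B)"
    then obtain h i j k where q: "q = Pair h (Pair i (Pair j k))" "h \<in> Obj (idx W)" "i \<in> Obj (idx X)"
      "j \<in> Obj (idx Y)" "k \<in> Obj (idx Z)" by auto
    have "rep ?L ?A ?B q (Pair (Pair (Pair h i) j) k)
        (Assoc M (node W h) (node X i) (node Y j \<odot> node Z k) \<cdot> Assoc M (node W h \<odot> node X i) (node Y j) (node Z k))"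
      unfolding q by (rule rep_rules | simp add: obs q N_obj_simps)+
    moreover have "rep ?R ?A ?B q (Pair (Pair (Pair h i) j) k)
        ((\<one> (node W h) \<otimes> Assoc M (node X i) (node Y j) (node Z k)) \<cdot>
         Assoc M (node W h) (node X i \<odot> node Y j) (node Z k) \<cdot>
         (Assoc M (node W h) (node X i) (node Y j) \<otimes> \<one> (node Z k)))"
      unfolding q by (rule rep_rules | simp add: obs q N_obj_simps)+
    ultimately show "\<exists>i \<phi>. rep ?L ?A ?B q i \<phi> \<and> rep ?R ?A ?B q i \<phi>"
      by (rule rep_agree) (rule pentagon N_node obs q)+
  qed
next
  fix X Y assume obs: "X \<in> Obj N" "Y \<in> Obj N"
  let ?A = "pro_tensor M (pro_tensor M X (pro_unit M)) Y"
  let ?B = "pro_tensor M X Y"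
  show "(\<one>\<^bsub>N\<^esub> X \<otimes>\<^bsub>N\<^esub> Lunit N Y) \<cdot>\<^bsub>N\<^esub> Assoc N X (pro_unit M) Y = Runit N X \<otimes>\<^bsub>N\<^esub> \<one>\<^bsub>N\<^esub> Y"
    (is "?L = ?R")
  proof (rule rep_eqI_pointwise)
    show "?B \<in> Obj N" by (simp add: obs N_obj_simps)
    fix q assume "q \<in> Obj (idx ?B)"
    then obtain i j where q: "q = Pair i j" "i \<in> Obj (idx X)" "j \<in> Obj (idx Y)" by auto
    have "rep ?L ?A ?B q (Pair (Pair i Pt) j)
        ((\<one> (node X i) \<otimes> Lunit M (node Y j)) \<cdot> Assoc M (node X i) (Unit M) (node Y j))"
      unfolding q by (rule rep_rules | simp add: obs q N_obj_simps)+
    moreover have "rep ?R ?A ?B q (Pair (Pair i Pt) j) (Runit M (node X i) \<otimes> \<one> (node Y j))"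
      unfolding q by (rule rep_rules | simp add: obs q N_obj_simps)+
    ultimately show "\<exists>i \<phi>. rep ?L ?A ?B q i \<phi> \<and> rep ?R ?A ?B q i \<phi>"
      by (rule rep_agree) (rule triangle N_node obs q)+
  qed
next
  fix X Y assume "X \<in> Obj N" "Y \<in> Obj N"
  then show "Swap N X Y \<in> Hom N (pro_tensor M X Y) (pro_tensor M Y X)" by (rule N_Swap)
next
  fix F X X' G Y Y' assume F: "F \<in> Hom N X X'" and G: "G \<in> Hom N Y Y'"
  note obs = N.Hom_objs[OF F] N.Hom_objs[OF G]
  let ?A = "pro_tensor M X Y" and ?B = "pro_tensor M Y' X'"
  show "Swap N X' Y' \<cdot>\<^bsub>N\<^esub> (F \<otimes>\<^bsub>N\<^esub> G) = (G \<otimes>\<^bsub>N\<^esub> F) \<cdot>\<^bsub>N\<^esub> Swap N X Y" (is "?L = ?R")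
  proof (rule rep_eqI_pointwise)
    show "?B \<in> Obj N" by (simp add: obs N_obj_simps)
    fix q assume "q \<in> Obj (idx ?B)"
    then obtain i' j' where q: "q = Pair j' i'" "i' \<in> Obj (idx X')" "j' \<in> Obj (idx Y')" by auto
    obtain i \<phi> where f: "rep F X X' i' i \<phi>" using F q(2) by (rule rep_exists)
    obtain j \<gamma> where g: "rep G Y Y' j' j \<gamma>" using G q(3) by (rule rep_exists)
    note st = repD(3)[OF f] repD(3)[OF g]
    have "rep ?L ?A ?B q (Pair i j) (Swap M (node X' i') (node Y' j') \<cdot> (\<phi> \<otimes> \<gamma>))"
      unfolding q by (rule f g rep_rules | simp add: obs q st)+
    moreover have "rep ?R ?A ?B q (Pair i j) ((\<gamma> \<otimes> \<phi>) \<cdot> Swap M (node X i) (node Y j))"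
      unfolding q by (rule f g rep_rules | simp add: obs q st)+
    ultimately show "\<exists>i \<phi>. rep ?L ?A ?B q i \<phi> \<and> rep ?R ?A ?B q i \<phi>"
      by (rule rep_agree) (rule Swap_natural repD(4) f g)+
  qed
next
  fix X Y assume obs: "X \<in> Obj N" "Y \<in> Obj N"
  let ?A = "pro_tensor M X Y"
  show "Swap N Y X \<cdot>\<^bsub>N\<^esub> Swap N X Y = \<one>\<^bsub>N\<^esub> (pro_tensor M X Y)" (is "?L = ?R")
  proof (rule rep_eqI_pointwise)
    show "?A \<in> Obj N" by (simp add: obs N_obj_simps)
    fix q assume "q \<in> Obj (idx ?A)"
    then obtain i j where q: "q = Pair i j" "i \<in> Obj (idx X)" "j \<in> Obj (idx Y)" by auto
    have "rep ?L ?A ?A q q (Swap M (node Y j) (node X i) \<cdot> Swap M (node X i) (node Y j))"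
      unfolding q by (rule rep_rules | simp add: obs q)+
    moreover have "rep ?R ?A ?A q q (\<one> (node X i \<odot> node Y j))"
      unfolding q by (rule rep_rules | simp add: obs q N_obj_simps)+
    ultimately show "\<exists>i \<phi>. rep ?L ?A ?A q i \<phi> \<and> rep ?R ?A ?A q i \<phi>"
      by (rule rep_agree) (rule Swap_Swap N_node obs q)+
  qed
next
  fix X Y Z assume obs: "X \<in> Obj N" "Y \<in> Obj N" "Z \<in> Obj N"
  let ?A = "pro_tensor M (pro_tensor M X Y) Z"
  let ?B = "pro_tensor M Y (pro_tensor M Z X)"
  show "Assoc N Y Z X \<cdot>\<^bsub>N\<^esub> Swap N X (pro_tensor M Y Z) \<cdot>\<^bsub>N\<^esub> Assoc N X Y Z =
      (\<one>\<^bsub>N\<^esub> Y \<otimes>\<^bsub>N\<^esub> Swap N X Z) \<cdot>\<^bsub>N\<^esub> Assoc N Y X Z \<cdot>\<^bsub>N\<^esub> (Swap N X Y \<otimes>\<^bsub>N\<^esub> \<one>\<^bsub>N\<^esub> Z)" (is "?L = ?R")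
  proof (rule rep_eqI_pointwise)
    show "?B \<in> Obj N" by (simp add: obs N_obj_simps)
    fix q assume "q \<in> Obj (idx ?B)"
    then obtain i j k where q: "q = Pair j (Pair k i)" "i \<in> Obj (idx X)"
      "j \<in> Obj (idx Y)" "k \<in> Obj (idx Z)" by auto
    have "rep ?L ?A ?B q (Pair (Pair i j) k)
        (Assoc M (node Y j) (node Z k) (node X i) \<cdot> Swap M (node X i) (node Y j \<odot> node Z k) \<cdot>
         Assoc M (node X i) (node Y j) (node Z k))"
      unfolding q by (rule rep_rules | simp add: obs q N_obj_simps)+
    moreover have "rep ?R ?A ?B q (Pair (Pair i j) k)
        ((\<one> (node Y j) \<otimes> Swap M (node X i) (node Z k)) \<cdot> Assoc M (node Y j) (node X i) (node Z k) \<cdot>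
         (Swap M (node X i) (node Y j) \<otimes> \<one> (node Z k)))"
      unfolding q by (rule rep_rules | simp add: obs q N_obj_simps)+
    ultimately show "\<exists>i \<phi>. rep ?L ?A ?B q i \<phi> \<and> rep ?R ?A ?B q i \<phi>"
      by (rule rep_agree) (rule hexagon N_node obs q)+
  qed
qed

end


section \<open>Copying, discarding and causality for pro-objects\<close>

text \<open>
  Copying is natural only for deterministic arrows. For the copy maps of the stages to be compatible,
  the transition arrows of the diagrams have to be deterministic.
\<close>

locale pro_markov_category = pro_monoidal M S + markov_category M
  for M :: "('o, 'm, 'z) markov_data_scheme" (structure) and S :: "('a, 'o, 'm) diagram set" +
  assumes deterministic: "X \<in> S \<Longrightarrow> pro_object M X \<Longrightarrow> a \<in> Hom (idx X) i j \<Longrightarrow>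
    Copy M (node X j) \<cdot> edge X a = (edge X a \<otimes> edge X a) \<cdot> Copy M (node X i)"
begin

lemma Hom_Unit_unique: "t \<in> Hom M x (Unit M) \<Longrightarrow> t' \<in> Hom M x (Unit M) \<Longrightarrow> t = t'"
  using Unit_terminal Hom_objs(1) by blast

lemma copy_component_in_Hom:
  assumes X: "X \<in> Obj N" and a: "a \<in> Hom (idx X) k i" and b: "b \<in> Hom (idx X) k j"
  shows "(edge X a \<otimes> edge X b) \<cdot> Copy M (node X k) \<in> Hom M (node X k) (node X i \<odot> node X j)"
proof -
  have ob: "pro_object M X" using X by (simp add: N_Obj)
  interpret I: cofiltered_category "idx X" using pro_objectD(1)[OF ob] .
  show ?thesis
    by (rule Comp_in_Hom[OF Copy_in_Hom TensorA_in_Hom])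
      (use pro_objectD[OF ob] a b I.Hom_objs(1)[OF a] in auto)
qed

text \<open>
  Determinism of the transition arrows lets a restriction pass through the copy map, after which
  only the two composite arrows of the index category matter.
\<close>

lemma copy_component_unique:
  assumes X: "X \<in> Obj N" and a: "a \<in> Hom (idx X) k i" "b \<in> Hom (idx X) k j"
    and a': "a' \<in> Hom (idx X) k' i" "b' \<in> Hom (idx X) k' j"
  shows "germ M X k' ((edge X a' \<otimes> edge X b') \<cdot> Copy M (node X k')) =
    germ M X k ((edge X a \<otimes> edge X b) \<cdot> Copy M (node X k))"
proof -
  have ob: "pro_object M X" and XS: "X \<in> S" using X by (simp_all add: N_Obj)
  interpret I: cofiltered_category "idx X" using pro_objectD(1)[OF ob] .
  obtain n c c' where n: "c \<in> Hom (idx X) n k" "c' \<in> Hom (idx X) n k'"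
    "a \<cdot>\<^bsub>idx X\<^esub> c = a' \<cdot>\<^bsub>idx X\<^esub> c'" "b \<cdot>\<^bsub>idx X\<^esub> c = b' \<cdot>\<^bsub>idx X\<^esub> c'"
    using I.span_refinement[OF a a'] by blast
  have restr: "((edge X a \<otimes> edge X b) \<cdot> Copy M (node X k)) \<cdot> edge X c =
      (edge X (a \<cdot>\<^bsub>idx X\<^esub> c) \<otimes> edge X (b \<cdot>\<^bsub>idx X\<^esub> c)) \<cdot> Copy M (node X n)"
    if ab: "a \<in> Hom (idx X) k i" "b \<in> Hom (idx X) k j" and c: "c \<in> Hom (idx X) n k" for a b c k
  proof -
    note E = pro_objectD(4)[OF ob ab(1)] pro_objectD(4)[OF ob ab(2)] pro_objectD(4)[OF ob c]
    note nk = I.Hom_objs[OF c]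
    note Cp = Copy_in_Hom[OF pro_objectD(2)[OF ob nk(1)]] Copy_in_Hom[OF pro_objectD(2)[OF ob nk(2)]]
    have "((edge X a \<otimes> edge X b) \<cdot> Copy M (node X k)) \<cdot> edge X c =
        (edge X a \<otimes> edge X b) \<cdot> (edge X c \<otimes> edge X c) \<cdot> Copy M (node X n)"
      using Comp_assoc[OF E(3) Cp(2) TensorA_in_Hom[OF E(1,2)]] deterministic[OF XS ob c] by simp
    also have "\<dots> = ((edge X a \<cdot> edge X c) \<otimes> (edge X b \<cdot> edge X c)) \<cdot> Copy M (node X n)"
      using Comp_assoc[OF Cp(1) TensorA_in_Hom[OF E(3,3)] TensorA_in_Hom[OF E(1,2)]]
        TensorA_Comp[OF E(3,1,3,2)] by simp
    finally show ?thesis using pro_objectD(5)[OF ob c ab(1)] pro_objectD(5)[OF ob c ab(2)] by simp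
  qed
  show ?thesis
  proof (rule germ_eqI[OF ob I.Hom_objs(1)[OF a(1)] copy_component_in_Hom[OF X a]])
    show "(k', (edge X a' \<otimes> edge X b') \<cdot> Copy M (node X k')) \<in>
        germ M X k ((edge X a \<otimes> edge X b) \<cdot> Copy M (node X k))"
      using restr[OF a n(1)] restr[OF a' n(2)] n(3,4)
      by (intro germI[OF ob copy_component_in_Hom[OF X a] copy_component_in_Hom[OF X a'] n(1,2)]) simp
  qed
qed

lemma N_Copy:
  assumes X: "X \<in> Obj N"
  shows "Copy N X \<in> Hom N X (pro_tensor M X X)"
    and rep_Copy: "k \<in> Obj (idx X) \<Longrightarrow>
      rep (Copy N X) X (pro_tensor M X X) (Pair k k) k (Copy M (node X k))"
proof -
  have ob: "pro_object M X" using X by (simp add: N_Obj)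
  interpret I: cofiltered_category "idx X" using pro_objectD(1)[OF ob] .
  define c where "c = (\<lambda>p. \<Union>k\<in>Obj (idx X). \<Union>a\<in>Hom (idx X) k (pfst p). \<Union>b\<in>Hom (idx X) k (psnd p).
           germ M X k ((edge X a \<otimes> edge X b) \<cdot> Copy M (node X k)))"
  have eq: "Copy N X = mk_pro X (pro_tensor M X X) c"
    by (simp add: pro_markov_def cat_data.defs markov_data.defs c_def)
  have cb: "c (Pair i j) = germ M X k ((edge X a \<otimes> edge X b) \<cdot> Copy M (node X k))"
    if a: "a \<in> Hom (idx X) k i" "b \<in> Hom (idx X) k j" for a b i j k
  proof
    show "c (Pair i j) \<subseteq> germ M X k ((edge X a \<otimes> edge X b) \<cdot> Copy M (node X k))"
      unfolding c_def using copy_component_unique[OF X a] by auto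
    show "germ M X k ((edge X a \<otimes> edge X b) \<cdot> Copy M (node X k)) \<subseteq> c (Pair i j)"
      unfolding c_def using a I.Hom_objs(1)[OF a(1)] by (auto intro!: bexI)
  qed
  note T = pro_tensor_object[OF ob ob]
  have "mk_pro X (pro_tensor M X X) c \<in> Hom (Pro M) X (pro_tensor M X X)"
  proof (rule mk_pro_in_Hom[OF ob T])
    fix q assume "q \<in> Obj (idx (pro_tensor M X X))"
    then obtain i j where q: "q = Pair i j" "i \<in> Obj (idx X)" "j \<in> Obj (idx X)" by auto
    obtain k a b where k: "k \<in> Obj (idx X)" "a \<in> Hom (idx X) k i" "b \<in> Hom (idx X) k j"
      using I.cone_objects[OF q(2,3)] by blast
    show "\<exists>i\<in>Obj (idx X). \<exists>\<phi>\<in>Hom M (node X i) (node (pro_tensor M X X) q). c q = germ M X i \<phi>"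
      using cb[OF k(2,3)] k(1) copy_component_in_Hom[OF X k(2,3)] q(1)
      by (intro bexI[of _ k] bexI[of _ "(edge X a \<otimes> edge X b) \<cdot> Copy M (node X k)"]) simp_all
  next
    fix e q q' m \<psi> assume e: "e \<in> Hom (idx (pro_tensor M X X)) q q'" and m: "(m, \<psi>) \<in> c q"
    obtain d d' i j i' j' where q: "e = Pair d d'" "q = Pair i j" "q' = Pair i' j'"
      "d \<in> Hom (idx X) i i'" "d' \<in> Hom (idx X) j j'"
      using e by (auto simp: product_Hom_iff)
    obtain k a b where k: "k \<in> Obj (idx X)" "a \<in> Hom (idx X) k i" "b \<in> Hom (idx X) k j"
      using I.cone_objects[OF I.Hom_objs(1)[OF q(4)] I.Hom_objs(1)[OF q(5)]] by blast
    note E = pro_objectD(4)[OF ob q(4)] pro_objectD(4)[OF ob q(5)]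
      pro_objectD(4)[OF ob k(2)] pro_objectD(4)[OF ob k(3)]
    note Cp = Copy_in_Hom[OF pro_objectD(2)[OF ob k(1)]]
    have "(m, \<psi>) \<in> germ M X k ((edge X a \<otimes> edge X b) \<cdot> Copy M (node X k))"
      using m cb[OF k(2,3)] q(2) by simp
    then have "(m, (edge X d \<otimes> edge X d') \<cdot> \<psi>) \<in>
        germ M X k ((edge X d \<otimes> edge X d') \<cdot> (edge X a \<otimes> edge X b) \<cdot> Copy M (node X k))"
      by (rule germ_compose[OF ob copy_component_in_Hom[OF X k(2,3)] TensorA_in_Hom[OF E(1,2)]])
    also have "(edge X d \<otimes> edge X d') \<cdot> (edge X a \<otimes> edge X b) \<cdot> Copy M (node X k) =
        (edge X (d \<cdot>\<^bsub>idx X\<^esub> a) \<otimes> edge X (d' \<cdot>\<^bsub>idx X\<^esub> b)) \<cdot> Copy M (node X k)"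
      using Comp_assoc[OF Cp TensorA_in_Hom[OF E(3,4)] TensorA_in_Hom[OF E(1,2)]]
        TensorA_Comp[OF E(3,1,4,2)] pro_objectD(5)[OF ob k(2) q(4)] pro_objectD(5)[OF ob k(3) q(5)]
      by simp
    also have "germ M X k \<dots> = c q'"
      using cb[OF I.Comp_in_Hom[OF k(2) q(4)] I.Comp_in_Hom[OF k(3) q(5)]] q(3) by simp
    finally show "(m, edge (pro_tensor M X X) e \<cdot> \<psi>) \<in> c q'" by (simp add: q)
  qed
  then show Hom: "Copy N X \<in> Hom N X (pro_tensor M X X)"
    using X tensor_closed by (simp add: eq N_Hom N_Obj)
  assume k: "k \<in> Obj (idx X)"
  note nk = pro_objectD(2)[OF ob k] and id = I.Ident_in_Hom[OF k]
  have "(edge X (\<one>\<^bsub>idx X\<^esub> k) \<otimes> edge X (\<one>\<^bsub>idx X\<^esub> k)) \<cdot> Copy M (node X k) = Copy M (node X k)"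
    using pro_objectD(3)[OF ob k] TensorA_Ident[OF nk nk] Ident_Comp[OF Copy_in_Hom[OF nk]] by simp
  then have "c (Pair k k) = germ M X k (Copy M (node X k))"
    using cb[OF id id] by simp
  then show "rep (Copy N X) X (pro_tensor M X X) (Pair k k) k (Copy M (node X k))"
    using Hom k germ_refl[OF ob k Copy_in_Hom[OF nk]] by (simp add: rep_def eq mk_pro_body)
qed

lemma N_Del:
  assumes X: "X \<in> Obj N"
  shows "Del N X \<in> Hom N X (pro_unit M)"
    and rep_Del: "k \<in> Obj (idx X) \<Longrightarrow> rep (Del N X) X (pro_unit M) Pt k (Del M (node X k))"
proof -
  have ob: "pro_object M X" using X by (simp add: N_Obj)
  interpret I: cofiltered_category "idx X" using pro_objectD(1)[OF ob] .
  define c :: "'a univ \<Rightarrow> _" where "c = (\<lambda>_. \<Union>k\<in>Obj (idx X). germ M X k (Del M (node X k)))"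
  have eq: "Del N X = mk_pro X (pro_unit M) c"
    by (simp add: pro_markov_def cat_data.defs markov_data.defs c_def)
  have D: "Del M (node X k) \<in> Hom M (node X k) (Unit M)" if "k \<in> Obj (idx X)" for k
    using Del_in_Hom pro_objectD(2)[OF ob that] .
  have same: "germ M X k' (Del M (node X k')) = germ M X k (Del M (node X k))"
    if k: "k \<in> Obj (idx X)" and k': "k' \<in> Obj (idx X)" for k k'
  proof -
    obtain n a a' where n: "a \<in> Hom (idx X) n k" "a' \<in> Hom (idx X) n k'"
      using I.cone_objects[OF k k'] by blast
    have "Del M (node X k) \<cdot> edge X a = Del M (node X k') \<cdot> edge X a'"
      by (rule Hom_Unit_unique; rule Comp_in_Hom[OF pro_objectD(4)[OF ob] D]) (use n k k' in auto)
    then show ?thesis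
      by (intro germ_eqI[OF ob k D[OF k]] germI[OF ob D[OF k] D[OF k'] n])
  qed
  have cb: "c p = germ M X k (Del M (node X k))" if "k \<in> Obj (idx X)" for k p
    unfolding c_def using same[OF that] that by blast
  have "mk_pro X (pro_unit M) c \<in> Hom (Pro M) X (pro_unit M)"
  proof (rule mk_pro_in_Hom[OF ob pro_unit_object])
    fix p
    obtain k where k: "k \<in> Obj (idx X)" using I.nonempty by blast
    show "\<exists>i\<in>Obj (idx X). \<exists>\<phi>\<in>Hom M (node X i) (node (pro_unit M) p). c p = germ M X i \<phi>"
      using cb[OF k] k D[OF k] by (intro bexI[of _ k] bexI[of _ "Del M (node X k)"]) simp_all
    fix b p' m \<psi> assume m: "(m, \<psi>) \<in> c p"
    then have "\<psi> \<in> Hom M (node X m) (Unit M)"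
      using cb[OF k, of p] germ_iff[OF D[OF k]] by auto
    then show "(m, edge (pro_unit M) b \<cdot> \<psi>) \<in> c p'"
      using m cb[OF k] by (simp add: Ident_Comp)
  qed
  then show Hom: "Del N X \<in> Hom N X (pro_unit M)"
    using X unit_closed by (simp add: eq N_Hom N_Obj)
  assume k: "k \<in> Obj (idx X)"
  show "rep (Del N X) X (pro_unit M) Pt k (Del M (node X k))"
    using Hom germ_refl[OF ob k D[OF k]] cb[OF k] by (simp add: rep_def eq mk_pro_body)
qed

lemma N_Unit_unique:
  assumes F: "F \<in> Hom N X (pro_unit M)" and G: "G \<in> Hom N X (pro_unit M)"
  shows "F = G"
proof (rule rep_eqI_pointwise[OF N_unit_Obj])
  have ob: "pro_object M X" using N.Hom_objs(1)[OF F] by (simp add: N_Obj)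
  interpret I: cofiltered_category "idx X" using pro_objectD(1)[OF ob] .
  fix j assume j: "j \<in> Obj (idx (pro_unit M :: ('a, 'o, 'm) diagram))"
  obtain i \<phi> where f: "rep F X (pro_unit M) j i \<phi>" using F j by (rule rep_exists)
  obtain i' \<phi>' where g: "rep G X (pro_unit M) j i' \<phi>'" using G j by (rule rep_exists)
  obtain k a a' where k: "a \<in> Hom (idx X) k i" "a' \<in> Hom (idx X) k i'"
    using I.cone_objects[OF repD(3)[OF f] repD(3)[OF g]] by blast
  note fk = rep_restrict[OF f k(1)] and gk = rep_restrict[OF g k(2)]
  have "\<phi> \<cdot> edge X a = \<phi>' \<cdot> edge X a'"
    using Hom_Unit_unique repD(4)[OF fk] repD(4)[OF gk] by simp
  then show "\<exists>i \<phi>. rep F X (pro_unit M) j i \<phi> \<and> rep G X (pro_unit M) j i \<phi>"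
    using fk gk by auto
qed

lemma product_HomI: "Hom I i i' \<noteq> {} \<Longrightarrow> Hom J j j' \<noteq> {} \<Longrightarrow>
    Hom (product_category I J) (Pair i j) (Pair i' j') \<noteq> {}"
  using product_Hom_Pair by blast

lemmas rep_copy_rules = rep_rules rep_Copy rep_Del

text \<open>
  In the laws that involve copying, both sides are compared at the diagonal indices, where the copy map
  is represented by the copy map of a single stage. The diagonal indices are cofinal since the index
  category is cofiltered.
\<close>

lemma N_Copy_coassoc:
  assumes X: "X \<in> Obj N"
  shows "Assoc N X X X \<cdot>\<^bsub>N\<^esub> (Copy N X \<otimes>\<^bsub>N\<^esub> \<one>\<^bsub>N\<^esub> X) \<cdot>\<^bsub>N\<^esub> Copy N X =
    (\<one>\<^bsub>N\<^esub> X \<otimes>\<^bsub>N\<^esub> Copy N X) \<cdot>\<^bsub>N\<^esub> Copy N X" (is "?L = ?R")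
proof (rule rep_eqI)
  let ?B = "pro_tensor M X (pro_tensor M X X)"
  interpret I: cofiltered_category "idx X" using X pro_objectD(1) N_Obj by blast
  show "?B \<in> Obj N" by (simp add: X N_obj_simps)
  fix q assume "q \<in> Obj (idx ?B)"
  then obtain i j l where q: "q = Pair i (Pair j l)" "i \<in> Obj (idx X)" "j \<in> Obj (idx X)" "l \<in> Obj (idx X)"
    by auto
  obtain k where k: "k \<in> Obj (idx X)" "Hom (idx X) k i \<noteq> {}" "Hom (idx X) k j \<noteq> {}" "Hom (idx X) k l \<noteq> {}"
    using I.cone_three_objects[OF q(2-4)] by blast
  let ?x = "node X k" and ?q = "Pair k (Pair k k)"
  have "rep ?L X ?B ?q k (Assoc M ?x ?x ?x \<cdot> (Copy M ?x \<otimes> \<one> ?x) \<cdot> Copy M ?x)"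
    by (rule rep_copy_rules | simp add: X k N_obj_simps)+
  moreover have "rep ?R X ?B ?q k ((\<one> ?x \<otimes> Copy M ?x) \<cdot> Copy M ?x)"
    by (rule rep_copy_rules | simp add: X k N_obj_simps)+
  moreover have "Hom (idx ?B) ?q q \<noteq> {}"
    unfolding q pro_tensor_simps by (rule product_HomI k)+
  ultimately show "\<exists>j' i \<phi>. Hom (idx ?B) j' q \<noteq> {} \<and> rep ?L X ?B j' i \<phi> \<and> rep ?R X ?B j' i \<phi>"
    using Copy_coassoc[OF N_node[OF X k(1)]] by auto
qed

lemma N_Copy_counit:
  assumes X: "X \<in> Obj N"
  shows "Lunit N X \<cdot>\<^bsub>N\<^esub> (Del N X \<otimes>\<^bsub>N\<^esub> \<one>\<^bsub>N\<^esub> X) \<cdot>\<^bsub>N\<^esub> Copy N X = \<one>\<^bsub>N\<^esub> X" (is "?L = _")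
    and "Runit N X \<cdot>\<^bsub>N\<^esub> (\<one>\<^bsub>N\<^esub> X \<otimes>\<^bsub>N\<^esub> Del N X) \<cdot>\<^bsub>N\<^esub> Copy N X = \<one>\<^bsub>N\<^esub> X" (is "?R = _")
proof -
  have L: "rep ?L X X k k (Lunit M (node X k) \<cdot> (Del M (node X k) \<otimes> \<one> (node X k)) \<cdot> Copy M (node X k))"
    and R: "rep ?R X X k k (Runit M (node X k) \<cdot> (\<one> (node X k) \<otimes> Del M (node X k)) \<cdot> Copy M (node X k))"
    and I: "rep (\<one>\<^bsub>N\<^esub> X) X X k k (\<one> (node X k))"
    if k: "k \<in> Obj (idx X)" for k
    by (rule rep_copy_rules | simp add: X k N_obj_simps)+
  show "?L = \<one>\<^bsub>N\<^esub> X"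
    by (rule rep_eqI_pointwise[OF X], rule rep_agree[OF L I])
      (simp_all add: Copy_counit_left[OF N_node[OF X]])
  show "?R = \<one>\<^bsub>N\<^esub> X"
    by (rule rep_eqI_pointwise[OF X], rule rep_agree[OF R I])
      (simp_all add: Copy_counit_right[OF N_node[OF X]])
qed

lemma N_Copy_comm:
  assumes X: "X \<in> Obj N"
  shows "Swap N X X \<cdot>\<^bsub>N\<^esub> Copy N X = Copy N X" (is "?L = ?R")
proof (rule rep_eqI)
  let ?B = "pro_tensor M X X"
  interpret I: cofiltered_category "idx X" using X pro_objectD(1) N_Obj by blast
  show "?B \<in> Obj N" by (simp add: X N_obj_simps)
  fix q assume "q \<in> Obj (idx ?B)"
  then obtain i j where q: "q = Pair i j" "i \<in> Obj (idx X)" "j \<in> Obj (idx X)"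
    by auto
  obtain k where k: "k \<in> Obj (idx X)" "Hom (idx X) k i \<noteq> {}" "Hom (idx X) k j \<noteq> {}"
    using I.cone_objects[OF q(2,3)] by blast
  let ?x = "node X k" and ?q = "Pair k k"
  have "rep ?L X ?B ?q k (Swap M ?x ?x \<cdot> Copy M ?x)"
    by (rule rep_copy_rules | simp add: X k N_obj_simps)+
  moreover have "rep ?R X ?B ?q k (Copy M ?x)"
    by (rule rep_copy_rules | simp add: X k N_obj_simps)+
  moreover have "Hom (idx ?B) ?q q \<noteq> {}"
    unfolding q pro_tensor_simps by (rule product_HomI k)+
  ultimately show "\<exists>j' i \<phi>. Hom (idx ?B) j' q \<noteq> {} \<and> rep ?L X ?B j' i \<phi> \<and> rep ?R X ?B j' i \<phi>"
    using Copy_comm[OF N_node[OF X k(1)]] by auto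
qed

lemma N_Copy_Tensor:
  assumes X: "X \<in> Obj N" and Y: "Y \<in> Obj N"
  shows "Copy N (pro_tensor M X Y) = Interchange N X Y \<cdot>\<^bsub>N\<^esub> (Copy N X \<otimes>\<^bsub>N\<^esub> Copy N Y)" (is "?L = ?R")
proof (rule rep_eqI)
  let ?A = "pro_tensor M X Y" and ?B = "pro_tensor M (pro_tensor M X Y) (pro_tensor M X Y)"
  interpret I: cofiltered_category "idx X" using X pro_objectD(1) N_Obj by blast
  interpret J: cofiltered_category "idx Y" using Y pro_objectD(1) N_Obj by blast
  show "?B \<in> Obj N" by (simp add: X Y N_obj_simps)
  fix q assume "q \<in> Obj (idx ?B)"
  then obtain i j i' j' where q: "q = Pair (Pair i j) (Pair i' j')"
    "i \<in> Obj (idx X)" "i' \<in> Obj (idx X)" "j \<in> Obj (idx Y)" "j' \<in> Obj (idx Y)"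
    by auto
  obtain k where k: "k \<in> Obj (idx X)" "Hom (idx X) k i \<noteq> {}" "Hom (idx X) k i' \<noteq> {}"
    using I.cone_objects[OF q(2,3)] by blast
  obtain l where l: "l \<in> Obj (idx Y)" "Hom (idx Y) l j \<noteq> {}" "Hom (idx Y) l j' \<noteq> {}"
    using J.cone_objects[OF q(4,5)] by blast
  let ?x = "node X k" and ?y = "node Y l" and ?q = "Pair (Pair k l) (Pair k l)"
  have "rep ?L ?A ?B ?q (Pair k l) (Copy M (node (pro_tensor M X Y) (Pair k l)))"
    by (rule rep_copy_rules | simp add: X Y k l N_obj_simps)+
  moreover have "rep ?R ?A ?B ?q (Pair k l) (Interchange M ?x ?y \<cdot> (Copy M ?x \<otimes> Copy M ?y))"
    unfolding Interchange_def N_TensorO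
    by (rule rep_copy_rules | simp add: X Y k l N_obj_simps)+
  moreover have "Hom (idx ?B) ?q q \<noteq> {}"
    unfolding q pro_tensor_simps by (rule product_HomI k l)+
  ultimately show "\<exists>j' i \<phi>. Hom (idx ?B) j' q \<noteq> {} \<and> rep ?L ?A ?B j' i \<phi> \<and> rep ?R ?A ?B j' i \<phi>"
    using Copy_Tensor[OF N_node[OF X k(1)] N_node[OF Y l(1)]] by auto
qed

theorem N_markov: "markov_category N"
proof -
  interpret N: symmetric_monoidal_category N by (rule N_symmetric_monoidal)
  note Lunit_Unit = N_Lunit(1)[OF N_unit_Obj]
  show ?thesis
  proof (intro markov_category.intro N_symmetric_monoidal markov_category_axioms.intro,
      unfold N_TensorO N_Unit)
    fix X assume X: "X \<in> Obj N"
    show "\<exists>!t. t \<in> Hom N X (pro_unit M)" using N_Del(1)[OF X] N_Unit_unique by blast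
    show "Copy N X \<in> Hom N X (pro_tensor M X X)" by (rule N_Copy[OF X])
    show "Del N X \<in> Hom N X (pro_unit M)" by (rule N_Del[OF X])
    show "Assoc N X X X \<cdot>\<^bsub>N\<^esub> (Copy N X \<otimes>\<^bsub>N\<^esub> \<one>\<^bsub>N\<^esub> X) \<cdot>\<^bsub>N\<^esub> Copy N X =
      (\<one>\<^bsub>N\<^esub> X \<otimes>\<^bsub>N\<^esub> Copy N X) \<cdot>\<^bsub>N\<^esub> Copy N X" by (rule N_Copy_coassoc[OF X])
    show "Lunit N X \<cdot>\<^bsub>N\<^esub> (Del N X \<otimes>\<^bsub>N\<^esub> \<one>\<^bsub>N\<^esub> X) \<cdot>\<^bsub>N\<^esub> Copy N X = \<one>\<^bsub>N\<^esub> X"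
      "Runit N X \<cdot>\<^bsub>N\<^esub> (\<one>\<^bsub>N\<^esub> X \<otimes>\<^bsub>N\<^esub> Del N X) \<cdot>\<^bsub>N\<^esub> Copy N X = \<one>\<^bsub>N\<^esub> X" by (rule N_Copy_counit[OF X])+
    show "Swap N X X \<cdot>\<^bsub>N\<^esub> Copy N X = Copy N X" by (rule N_Copy_comm[OF X])
    fix Y assume Y: "Y \<in> Obj N"
    show "Copy N (pro_tensor M X Y) = Interchange N X Y \<cdot>\<^bsub>N\<^esub> (Copy N X \<otimes>\<^bsub>N\<^esub> Copy N Y)"
      by (rule N_Copy_Tensor[OF X Y])
    show "Del N (pro_tensor M X Y) = Lunit N (pro_unit M) \<cdot>\<^bsub>N\<^esub> (Del N X \<otimes>\<^bsub>N\<^esub> Del N Y)"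
      by (rule N_Unit_unique[OF N_Del(1)[OF N_tensor_Obj[OF X Y]]])
        (rule N.Comp_in_Hom[OF N_TensorA[OF N_Del(1)[OF X] N_Del(1)[OF Y]] Lunit_Unit])
  next
    show "Lunit N (pro_unit M) \<cdot>\<^bsub>N\<^esub> Copy N (pro_unit M) = \<one>\<^bsub>N\<^esub> (pro_unit M)"
      by (rule N_Unit_unique[OF N.Comp_in_Hom[OF N_Copy(1)[OF N_unit_Obj] Lunit_Unit]
            N.Ident_in_Hom[OF N_unit_Obj]])
    show "Del N (pro_unit M) = \<one>\<^bsub>N\<^esub> (pro_unit M)"
      by (rule N_Unit_unique[OF N_Del(1)[OF N_unit_Obj] N.Ident_in_Hom[OF N_unit_Obj]])
  qed
qed

end

locale pro_causal_markov_category = pro_markov_category M S + causal_markov_category M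
  for M :: "('o, 'm, 'z) markov_data_scheme" (structure) and S :: "('a, 'o, 'm) diagram set"
begin

text \<open>
  Given a component of the conclusion, the arrows \<open>H\<^sub>1\<close>, \<open>H\<^sub>2\<close> are represented at one stage of \<open>C\<close>, then \<open>G\<close>
  at a stage of \<open>B\<close>, then \<open>F\<close> at a stage of \<open>A\<close>. The hypothesis says that the two composites agree
  after a further restriction of the representative of \<open>F\<close>. The restricted representative
  satisfies the hypothesis of causality in \<open>M\<close>, whose conclusion is the wanted equation.
\<close>

theorem N_causal: "causal_markov_category N"
proof (intro causal_markov_category.intro N_markov causal_markov_category_axioms.intro)
  fix F G H\<^sub>1 H\<^sub>2 A B C D
  assume F: "F \<in> Hom N A B" and G: "G \<in> Hom N B C" and H1: "H\<^sub>1 \<in> Hom N C D" and H2: "H\<^sub>2 \<in> Hom N C D"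
    and eq: "(H\<^sub>1 \<otimes>\<^bsub>N\<^esub> \<one>\<^bsub>N\<^esub> C) \<cdot>\<^bsub>N\<^esub> Copy N C \<cdot>\<^bsub>N\<^esub> G \<cdot>\<^bsub>N\<^esub> F = (H\<^sub>2 \<otimes>\<^bsub>N\<^esub> \<one>\<^bsub>N\<^esub> C) \<cdot>\<^bsub>N\<^esub> Copy N C \<cdot>\<^bsub>N\<^esub> G \<cdot>\<^bsub>N\<^esub> F"
  note obs = N.Hom_objs[OF F] N.Hom_objs[OF G] N.Hom_objs[OF H1]
  interpret A: cofiltered_category "idx A" using obs(1) pro_objectD(1) N_Obj by blast
  interpret B: cofiltered_category "idx B" using obs(2) pro_objectD(1) N_Obj by blast
  interpret C: cofiltered_category "idx C" using obs(4) pro_objectD(1) N_Obj by blast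
  interpret D: cofiltered_category "idx D" using obs(6) pro_objectD(1) N_Obj by blast
  let ?T = "pro_tensor M (pro_tensor M D C) B"
  show "(((H\<^sub>1 \<otimes>\<^bsub>N\<^esub> \<one>\<^bsub>N\<^esub> C) \<cdot>\<^bsub>N\<^esub> Copy N C \<cdot>\<^bsub>N\<^esub> G) \<otimes>\<^bsub>N\<^esub> \<one>\<^bsub>N\<^esub> B) \<cdot>\<^bsub>N\<^esub> Copy N B \<cdot>\<^bsub>N\<^esub> F =
    (((H\<^sub>2 \<otimes>\<^bsub>N\<^esub> \<one>\<^bsub>N\<^esub> C) \<cdot>\<^bsub>N\<^esub> Copy N C \<cdot>\<^bsub>N\<^esub> G) \<otimes>\<^bsub>N\<^esub> \<one>\<^bsub>N\<^esub> B) \<cdot>\<^bsub>N\<^esub> Copy N B \<cdot>\<^bsub>N\<^esub> F" (is "?L = ?R")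
  proof (rule rep_eqI)
    show "?T \<in> Obj N" by (simp add: obs N_obj_simps)
    fix q assume "q \<in> Obj (idx ?T)"
    then obtain l k\<^sub>0 j\<^sub>0 where q: "q = Pair (Pair l k\<^sub>0) j\<^sub>0" "l \<in> Obj (idx D)" "k\<^sub>0 \<in> Obj (idx C)" "j\<^sub>0 \<in> Obj (idx B)"
      by auto
    obtain k\<^sub>1 \<eta>\<^sub>1 where h1: "rep H\<^sub>1 C D l k\<^sub>1 \<eta>\<^sub>1" using H1 q(2) by (rule rep_exists)
    obtain k\<^sub>2 \<eta>\<^sub>2 where h2: "rep H\<^sub>2 C D l k\<^sub>2 \<eta>\<^sub>2" using H2 q(2) by (rule rep_exists)
    \<comment> \<open>Besides making \<open>h\<^sub>1\<close>, \<open>h\<^sub>2\<close> parallel, the stages \<open>k\<close> and \<open>j\<close> dominate \<open>k\<^sub>0\<close> and \<open>j\<^sub>0\<close>, so that the index compared lies over \<open>q\<close>.\<close>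
    obtain k a\<^sub>1 a\<^sub>2 where k: "k \<in> Obj (idx C)" "a\<^sub>1 \<in> Hom (idx C) k k\<^sub>1" "a\<^sub>2 \<in> Hom (idx C) k k\<^sub>2"
      "Hom (idx C) k k\<^sub>0 \<noteq> {}"
      using C.cone_three_objects[OF repD(3)[OF h1] repD(3)[OF h2] q(3)] by blast
    obtain j\<^sub>1 \<gamma>\<^sub>1 where g1: "rep G B C k j\<^sub>1 \<gamma>\<^sub>1" using G k(1) by (rule rep_exists)
    obtain j b where j: "j \<in> Obj (idx B)" "b \<in> Hom (idx B) j j\<^sub>1" "Hom (idx B) j j\<^sub>0 \<noteq> {}"
      using B.cone_objects[OF repD(3)[OF g1] q(4)] by blast
    obtain i \<phi> where f: "rep F A B j i \<phi>" using F j(1) by (rule rep_exists)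
    define h\<^sub>1 h\<^sub>2 g where "h\<^sub>1 = \<eta>\<^sub>1 \<cdot> edge C a\<^sub>1" and "h\<^sub>2 = \<eta>\<^sub>2 \<cdot> edge C a\<^sub>2" and "g = \<gamma>\<^sub>1 \<cdot> edge B b"
    have reps: "rep H\<^sub>1 C D l k h\<^sub>1" "rep H\<^sub>2 C D l k h\<^sub>2" "rep G B C k j g"
      unfolding h\<^sub>1_def h\<^sub>2_def g_def using rep_restrict h1 h2 g1 k j by blast+
    let ?c = "node C k" and ?b = "node B j"
    note nodes = N_node[OF obs(4) k(1)] N_node[OF obs(2) j(1)]
    have E: "rep ((H \<otimes>\<^bsub>N\<^esub> \<one>\<^bsub>N\<^esub> C) \<cdot>\<^bsub>N\<^esub> Copy N C \<cdot>\<^bsub>N\<^esub> G \<cdot>\<^bsub>N\<^esub> F) A (pro_tensor M D C) (Pair l k) i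
        ((h \<otimes> \<one> ?c) \<cdot> Copy M ?c \<cdot> g \<cdot> \<phi>)" if "rep H C D l k h" for H h
      by (rule f reps that rep_copy_rules | simp add: obs k)+
    obtain i' a where a: "a \<in> Hom (idx A) i' i"
      "((h\<^sub>1 \<otimes> \<one> ?c) \<cdot> Copy M ?c \<cdot> g \<cdot> \<phi>) \<cdot> edge A a = ((h\<^sub>2 \<otimes> \<one> ?c) \<cdot> Copy M ?c \<cdot> g \<cdot> \<phi>) \<cdot> edge A a"
      using rep_same_stage[OF E[OF reps(1), unfolded eq] E[OF reps(2)]] by blast
    define f' where "f' = \<phi> \<cdot> edge A a"
    have f': "rep F A B j i' f'" unfolding f'_def by (rule rep_restrict[OF f a(1)])
    have Ea: "edge A a \<in> Hom M (node A i') (node A i)"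
      using pro_objectD(4)[OF _ a(1)] obs(1) N_Obj by blast
    note gM = repD(4)[OF reps(3)] and \<phi>M = repD(4)[OF f]
    have assoc: "((h \<otimes> \<one> ?c) \<cdot> Copy M ?c \<cdot> g \<cdot> \<phi>) \<cdot> edge A a = (h \<otimes> \<one> ?c) \<cdot> Copy M ?c \<cdot> g \<cdot> f'"
      if h: "h \<in> Hom M ?c d" for h d
    proof -
      note 1 = Comp_in_Hom[OF \<phi>M gM]
      note 2 = Comp_in_Hom[OF 1 Copy_in_Hom[OF nodes(1)]]
      show ?thesis
        unfolding f'_def
        using Comp_assoc[OF Ea 2 TensorA_in_Hom[OF h Ident_in_Hom[OF nodes(1)]]]
          Comp_assoc[OF Ea 1 Copy_in_Hom[OF nodes(1)]] Comp_assoc[OF Ea \<phi>M gM] by simp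
    qed
    have meq: "(((h\<^sub>1 \<otimes> \<one> ?c) \<cdot> Copy M ?c \<cdot> g) \<otimes> \<one> ?b) \<cdot> Copy M ?b \<cdot> f' =
        (((h\<^sub>2 \<otimes> \<one> ?c) \<cdot> Copy M ?c \<cdot> g) \<otimes> \<one> ?b) \<cdot> Copy M ?b \<cdot> f'"
      using causal[OF repD(4)[OF f'] gM repD(4)[OF reps(1)] repD(4)[OF reps(2)]] a(2)
        assoc[OF repD(4)[OF reps(1)]] assoc[OF repD(4)[OF reps(2)]] by simp
    have E': "rep ((((H \<otimes>\<^bsub>N\<^esub> \<one>\<^bsub>N\<^esub> C) \<cdot>\<^bsub>N\<^esub> Copy N C \<cdot>\<^bsub>N\<^esub> G) \<otimes>\<^bsub>N\<^esub> \<one>\<^bsub>N\<^esub> B) \<cdot>\<^bsub>N\<^esub> Copy N B \<cdot>\<^bsub>N\<^esub> F)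
        A ?T (Pair (Pair l k) j) i'
        ((((h \<otimes> \<one> ?c) \<cdot> Copy M ?c \<cdot> g) \<otimes> \<one> ?b) \<cdot> Copy M ?b \<cdot> f')" if "rep H C D l k h" for H h
      by (rule f' reps that rep_copy_rules | simp add: obs k j)+
    have "Hom (idx ?T) (Pair (Pair l k) j) q \<noteq> {}"
      unfolding q pro_tensor_simps using D.Ident_in_Hom[OF q(2)] by (intro product_HomI k j) blast
    then show "\<exists>j' i \<phi>. Hom (idx ?T) j' q \<noteq> {} \<and> rep ?L A ?T j' i \<phi> \<and> rep ?R A ?T j' i \<phi>"
      using rep_agree[OF E'[OF reps(1)] E'[OF reps(2)] meq] by blast
  qed
qed

end


section \<open>Finite probability kernels\<close>

lemma FinKer_simps:
  "Obj FinKer = {A. finite A}" "Dom FinKer = source" "Cod FinKer = target"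
  "\<one>\<^bsub>FinKer\<^esub> A = fun_kernel A A (\<lambda>x. x)" "TensorO FinKer = pairs" "Unit FinKer = {Pt}"
  "Assoc FinKer A B C = fun_kernel (pairs (pairs A B) C) (pairs A (pairs B C))
     (\<lambda>p. Pair (pfst (pfst p)) (Pair (psnd (pfst p)) (psnd p)))"
  "Lunit FinKer A = fun_kernel (pairs {Pt} A) A psnd"
  "Runit FinKer A = fun_kernel (pairs A {Pt}) A pfst"
  "Swap FinKer A B = fun_kernel (pairs A B) (pairs B A) (\<lambda>p. Pair (psnd p) (pfst p))"
  "Copy FinKer A = fun_kernel A (pairs A A) (\<lambda>x. Pair x x)"
  "Del FinKer A = fun_kernel A {Pt} (\<lambda>_. Pt)"
  by (simp_all add: FinKer_def)

lemma FinKer_Hom: "k \<in> Hom FinKer A B \<longleftrightarrow>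
    source k = A \<and> target k = B \<and> finite A \<and> finite B \<and> stochastic k"
  by (auto simp: FinKer_def Hom_def)

lemma fun_kernel_simps [simp]:
  "source (fun_kernel A B u) = A" "target (fun_kernel A B u) = B"
  "body (fun_kernel A B u) x y = (if x \<in> A \<and> y = u x then 1 else 0)"
  by (simp_all add: fun_kernel_def)

lemma FinKer_Comp_simps [simp]:
  "source (l \<cdot>\<^bsub>FinKer\<^esub> k) = source k" "target (l \<cdot>\<^bsub>FinKer\<^esub> k) = target l"
  "body (l \<cdot>\<^bsub>FinKer\<^esub> k) x z = (\<Sum>y\<in>target k. body k x y * body l y z)"
  by (simp_all add: FinKer_def)

lemma FinKer_Tensor_simps [simp]:
  "source (k \<otimes>\<^bsub>FinKer\<^esub> l) = pairs (source k) (source l)"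
  "target (k \<otimes>\<^bsub>FinKer\<^esub> l) = pairs (target k) (target l)"
  "body (k \<otimes>\<^bsub>FinKer\<^esub> l) p q = (if p \<in> pairs (source k) (source l) \<and> q \<in> pairs (target k) (target l)
     then body k (pfst p) (pfst q) * body l (psnd p) (psnd q) else 0)"
  by (simp_all add: FinKer_def)

lemma stochasticD:
  assumes "stochastic k"
  shows "x \<in> source k \<Longrightarrow> y \<in> target k \<Longrightarrow> 0 \<le> body k x y"
    "x \<in> source k \<Longrightarrow> (\<Sum>y\<in>target k. body k x y) = 1"
    "x \<notin> source k \<or> y \<notin> target k \<Longrightarrow> body k x y = 0"
  using assms by (auto simp: stochastic_def)

lemma kernel_eqI:
  assumes "k \<in> Hom FinKer A B" "l \<in> Hom FinKer A B"
    and "\<And>x y. x \<in> A \<Longrightarrow> y \<in> B \<Longrightarrow> body k x y = body l x y"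
  shows "k = l"
proof -
  have "body k x y = body l x y" for x y
    using assms stochasticD(3)[of k x y] stochasticD(3)[of l x y]
    by (cases "x \<in> A \<and> y \<in> B") (auto simp: FinKer_Hom)
  then show ?thesis using assms(1,2) by (auto intro!: arrow.equality simp: FinKer_Hom)
qed

lemma pairs_eq_image: "pairs A B = case_prod Pair ` (A \<times> B)"
  by (auto simp: pairs_def)

lemma finite_pairs [simp]: "finite A \<Longrightarrow> finite B \<Longrightarrow> finite (pairs A B)"
  by (simp add: pairs_eq_image)

lemma sum_pairs: "(\<Sum>p\<in>pairs A B. f p) = (\<Sum>x\<in>A. \<Sum>y\<in>B. f (Pair x y))"
proof -
  have "(\<Sum>p\<in>pairs A B. f p) = (\<Sum>(x, y)\<in>A \<times> B. f (Pair x y))"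
    unfolding pairs_eq_image by (subst sum.reindex) (auto simp: inj_on_def case_prod_unfold)
  then show ?thesis by (simp add: sum.cartesian_product)
qed

lemma FinKer_Comp_in_Hom:
  assumes k: "k \<in> Hom FinKer A B" and l: "l \<in> Hom FinKer B C"
  shows "l \<cdot>\<^bsub>FinKer\<^esub> k \<in> Hom FinKer A C"
proof -
  have kB: "source k = A" "target k = B" "stochastic k" and lB: "source l = B" "target l = C" "stochastic l"
    using k l by (auto simp: FinKer_Hom)
  have "(\<Sum>z\<in>C. \<Sum>y\<in>B. body k x y * body l y z) = 1" if "x \<in> A" for x
  proof -
    have "(\<Sum>z\<in>C. \<Sum>y\<in>B. body k x y * body l y z) = (\<Sum>y\<in>B. body k x y * (\<Sum>z\<in>C. body l y z))"
      by (subst sum.swap) (simp add: sum_distrib_left)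
    also have "\<dots> = 1"
      using stochasticD(2)[OF lB(3)] stochasticD(2)[OF kB(3)] that kB lB by simp
    finally show ?thesis .
  qed
  then have "stochastic (l \<cdot>\<^bsub>FinKer\<^esub> k)"
    using kB lB stochasticD[OF kB(3)] stochasticD[OF lB(3)]
    unfolding stochastic_def by (auto intro!: sum_nonneg mult_nonneg_nonneg sum.neutral)
  then show ?thesis using k l by (simp add: FinKer_Hom)
qed

lemma FinKer_Tensor_in_Hom:
  assumes k: "k \<in> Hom FinKer A B" and l: "l \<in> Hom FinKer A' B'"
  shows "k \<otimes>\<^bsub>FinKer\<^esub> l \<in> Hom FinKer (pairs A A') (pairs B B')"
proof -
  have kB: "source k = A" "target k = B" "stochastic k" and lB: "source l = A'" "target l = B'" "stochastic l"
    using k l by (auto simp: FinKer_Hom)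
  have "(\<Sum>q\<in>pairs B B'. body (k \<otimes>\<^bsub>FinKer\<^esub> l) (Pair x x') q) = 1" if "x \<in> A" "x' \<in> A'" for x x'
    using that kB lB stochasticD(2)[OF kB(3)] stochasticD(2)[OF lB(3)]
    by (simp add: sum_pairs flip: sum_distrib_left)
  then have "stochastic (k \<otimes>\<^bsub>FinKer\<^esub> l)"
    using kB lB stochasticD(1)[OF kB(3)] stochasticD(1)[OF lB(3)]
    unfolding stochastic_def by (auto intro!: mult_nonneg_nonneg)
  then show ?thesis using k l by (simp add: FinKer_Hom)
qed

definition deterministic_by :: "'a kernel \<Rightarrow> 'a univ set \<Rightarrow> 'a univ set \<Rightarrow> ('a univ \<Rightarrow> 'a univ) \<Rightarrow> bool" where
  "deterministic_by k A B u \<longleftrightarrow> k = fun_kernel A B u \<and> finite A \<and> finite B \<and> (\<forall>x\<in>A. u x \<in> B)"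

lemma det_in_Hom: "deterministic_by k A B u \<Longrightarrow> k \<in> Hom FinKer A B"
  by (auto simp: deterministic_by_def FinKer_Hom stochastic_def)

lemma det_eqI: "deterministic_by k A B u \<Longrightarrow> deterministic_by l A B v \<Longrightarrow> (\<And>x. x \<in> A \<Longrightarrow> u x = v x) \<Longrightarrow> k = l"
  by (auto simp: deterministic_by_def fun_kernel_def fun_eq_iff)

lemma det_Comp:
  assumes "deterministic_by l B C v" "deterministic_by k A B u"
  shows "deterministic_by (l \<cdot>\<^bsub>FinKer\<^esub> k) A C (\<lambda>x. v (u x))"
proof -
  have "body (l \<cdot>\<^bsub>FinKer\<^esub> k) = body (fun_kernel A C (\<lambda>x. v (u x)))"
    using assms by (intro ext) (auto simp: deterministic_by_def if_distrib[of "\<lambda>a. a * _"] sum.delta cong: if_cong)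
  then show ?thesis using assms by (auto simp: deterministic_by_def intro!: arrow.equality)
qed

lemma det_Tensor:
  assumes "deterministic_by k A B u" "deterministic_by l A' B' v"
  shows "deterministic_by (k \<otimes>\<^bsub>FinKer\<^esub> l) (pairs A A') (pairs B B') (\<lambda>p. Pair (u (pfst p)) (v (psnd p)))"
proof -
  have "body (k \<otimes>\<^bsub>FinKer\<^esub> l) =
      body (fun_kernel (pairs A A') (pairs B B') (\<lambda>p. Pair (u (pfst p)) (v (psnd p))))"
    using assms by (intro ext) (auto simp: deterministic_by_def)
  then show ?thesis using assms by (auto simp: deterministic_by_def intro!: arrow.equality)
qed

text \<open>
  All structural arrows of \<open>FinKer\<close> come from functions. Equations between their composites thus follow
  from equations between functions, with no sums to evaluate.
\<close>

lemma det_structure: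
  shows "finite A \<Longrightarrow> deterministic_by (\<one>\<^bsub>FinKer\<^esub> A) A A (\<lambda>x. x)"
    and "finite A \<Longrightarrow> finite B \<Longrightarrow> finite C \<Longrightarrow>
      deterministic_by (Assoc FinKer A B C) (pairs (pairs A B) C) (pairs A (pairs B C))
        (\<lambda>p. Pair (pfst (pfst p)) (Pair (psnd (pfst p)) (psnd p)))"
    and "finite A \<Longrightarrow> deterministic_by (Lunit FinKer A) (pairs {Pt} A) A psnd"
    and "finite A \<Longrightarrow> deterministic_by (Runit FinKer A) (pairs A {Pt}) A pfst"
    and "finite A \<Longrightarrow> finite B \<Longrightarrow>
      deterministic_by (Swap FinKer A B) (pairs A B) (pairs B A) (\<lambda>p. Pair (psnd p) (pfst p))"
    and "finite A \<Longrightarrow> deterministic_by (Copy FinKer A) A (pairs A A) (\<lambda>x. Pair x x)"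
    and "finite A \<Longrightarrow> deterministic_by (Del FinKer A) A {Pt} (\<lambda>_. Pt)"
  by (auto simp: FinKer_simps deterministic_by_def)

lemma det_Comp_body:
  assumes "k \<in> Hom FinKer B C" "deterministic_by l A B u" "x \<in> A"
  shows "body (k \<cdot>\<^bsub>FinKer\<^esub> l) x z = body k (u x) z"
  using assms by (auto simp: deterministic_by_def if_distrib[of "\<lambda>a. a * _"] sum.delta cong: if_cong)

lemma Comp_det_body:
  assumes "k \<in> Hom FinKer A B" "deterministic_by l B C v" "y \<in> B" "\<And>y'. y' \<in> B \<Longrightarrow> v y' = v y \<Longrightarrow> y' = y"
  shows "body (l \<cdot>\<^bsub>FinKer\<^esub> k) x (v y) = body k x y"
proof -
  have "(\<Sum>y'\<in>B. body k x y' * body l y' (v y)) = (\<Sum>y'\<in>B. if y' = y then body k x y' else 0)"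
    using assms by (intro sum.cong) (auto simp: deterministic_by_def)
  then show ?thesis using assms by (simp add: FinKer_Hom deterministic_by_def sum.delta)
qed

lemma FinKer_category: "category FinKer"
proof
  fix f assume "f \<in> Arr FinKer"
  then show "Dom FinKer f \<in> Obj FinKer" "Cod FinKer f \<in> Obj FinKer"
    by (auto simp: FinKer_def)
next
  fix x assume "x \<in> Obj FinKer"
  then have "finite x" by (simp add: FinKer_simps)
  then show "\<one>\<^bsub>FinKer\<^esub> x \<in> Hom FinKer x x" by (rule det_in_Hom[OF det_structure(1)])
next
  fix f g x y z assume "f \<in> Hom FinKer x y" "g \<in> Hom FinKer y z"
  then show "g \<cdot>\<^bsub>FinKer\<^esub> f \<in> Hom FinKer x z" by (rule FinKer_Comp_in_Hom)
next
  fix f x y assume f: "f \<in> Hom FinKer x y"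
  then have id: "deterministic_by (\<one>\<^bsub>FinKer\<^esub> x) x x (\<lambda>x. x)" "deterministic_by (\<one>\<^bsub>FinKer\<^esub> y) y y (\<lambda>x. x)"
    by (auto intro!: det_structure(1) simp: FinKer_Hom)
  show "f \<cdot>\<^bsub>FinKer\<^esub> \<one>\<^bsub>FinKer\<^esub> x = f"
    using det_Comp_body[OF f id(1)] by (intro kernel_eqI[OF FinKer_Comp_in_Hom[OF det_in_Hom[OF id(1)] f] f]) auto
  show "\<one>\<^bsub>FinKer\<^esub> y \<cdot>\<^bsub>FinKer\<^esub> f = f"
    using Comp_det_body[OF f id(2)] by (intro kernel_eqI[OF FinKer_Comp_in_Hom[OF f det_in_Hom[OF id(2)]] f]) auto
next
  fix f g h w x y z
  assume f: "f \<in> Hom FinKer w x" and g: "g \<in> Hom FinKer x y" and h: "h \<in> Hom FinKer y z"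
  have "(\<Sum>b\<in>x. body f a b * (\<Sum>c\<in>y. body g b c * body h c d)) =
      (\<Sum>c\<in>y. (\<Sum>b\<in>x. body f a b * body g b c) * body h c d)" for a d
    by (simp add: sum_distrib_left sum_distrib_right mult.assoc) (rule sum.swap)
  then show "(h \<cdot>\<^bsub>FinKer\<^esub> g) \<cdot>\<^bsub>FinKer\<^esub> f = h \<cdot>\<^bsub>FinKer\<^esub> (g \<cdot>\<^bsub>FinKer\<^esub> f)"
    using f g h by (intro arrow.equality ext) (auto simp: FinKer_Hom)
qed

interpretation FinKer: category FinKer
  by (rule FinKer_category)

lemma FinKer_structure_inverse:
  assumes "finite A" "finite B" "finite C"
  shows "is_iso FinKer (Assoc FinKer A B C)" "is_iso FinKer (Lunit FinKer A)" "is_iso FinKer (Runit FinKer A)"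
    and "deterministic_by (inverse_of FinKer (Assoc FinKer A B C)) (pairs A (pairs B C)) (pairs (pairs A B) C)
      (\<lambda>p. Pair (Pair (pfst p) (pfst (psnd p))) (psnd (psnd p)))"
proof -
  have inverse: "inverse_arrows FinKer k (fun_kernel Y X v)" "inverse_of FinKer k = fun_kernel Y X v"
    if k: "deterministic_by k X Y u" and v: "\<And>x. x \<in> X \<Longrightarrow> v (u x) = x" "\<And>y. y \<in> Y \<Longrightarrow> v y \<in> X \<and> u (v y) = y"
    for k X Y u v
  proof -
    have l: "deterministic_by (fun_kernel Y X v) Y X v" using k v by (auto simp: deterministic_by_def)
    have fin: "finite X" "finite Y" using k by (auto simp: deterministic_by_def)
    have "fun_kernel Y X v \<cdot>\<^bsub>FinKer\<^esub> k = \<one>\<^bsub>FinKer\<^esub> X"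
      using v by (intro det_eqI[OF det_Comp[OF l k] det_structure(1)[OF fin(1)]]) auto
    moreover have "k \<cdot>\<^bsub>FinKer\<^esub> fun_kernel Y X v = \<one>\<^bsub>FinKer\<^esub> Y"
      using v by (intro det_eqI[OF det_Comp[OF k l] det_structure(1)[OF fin(2)]]) auto
    ultimately show "inverse_arrows FinKer k (fun_kernel Y X v)" "inverse_of FinKer k = fun_kernel Y X v"
      using FinKer.inverse_arrowsI[OF det_in_Hom[OF k] det_in_Hom[OF l]]
        FinKer.inverse_of_eqI[OF det_in_Hom[OF k] det_in_Hom[OF l]] by auto
  qed
  note st = det_structure(2)[OF assms] det_structure(3,4)[OF assms(1)]
  let ?a = "\<lambda>p. Pair (Pair (pfst p) (pfst (psnd p))) (psnd (psnd p))"
  have "inverse_arrows FinKer (Assoc FinKer A B C) (fun_kernel (pairs A (pairs B C)) (pairs (pairs A B) C) ?a)"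
    and a: "inverse_of FinKer (Assoc FinKer A B C) = fun_kernel (pairs A (pairs B C)) (pairs (pairs A B) C) ?a"
    by (rule inverse[OF st(1)]; auto)+
  then show "is_iso FinKer (Assoc FinKer A B C)" unfolding is_iso_def by blast
  show "deterministic_by (inverse_of FinKer (Assoc FinKer A B C)) (pairs A (pairs B C)) (pairs (pairs A B) C) ?a"
    unfolding a deterministic_by_def using assms by auto
  have "inverse_arrows FinKer (Lunit FinKer A) (fun_kernel A (pairs {Pt} A) (\<lambda>x. Pair Pt x))"
    by (rule inverse[OF st(2)]) auto
  then show "is_iso FinKer (Lunit FinKer A)" unfolding is_iso_def by blast
  have "inverse_arrows FinKer (Runit FinKer A) (fun_kernel A (pairs A {Pt}) (\<lambda>x. Pair x Pt))"
    by (rule inverse[OF st(3)]) auto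
  then show "is_iso FinKer (Runit FinKer A)" unfolding is_iso_def by blast
qed

lemmas det_rules = det_Comp det_Tensor det_structure FinKer_structure_inverse(4)

lemma FinKer_Tensor_Comp:
  assumes f: "f \<in> Hom FinKer x y" and g: "g \<in> Hom FinKer y z"
    and f': "f' \<in> Hom FinKer x' y'" and g': "g' \<in> Hom FinKer y' z'"
  shows "(g \<cdot>\<^bsub>FinKer\<^esub> f) \<otimes>\<^bsub>FinKer\<^esub> (g' \<cdot>\<^bsub>FinKer\<^esub> f') =
    (g \<otimes>\<^bsub>FinKer\<^esub> g') \<cdot>\<^bsub>FinKer\<^esub> (f \<otimes>\<^bsub>FinKer\<^esub> f')"
proof (rule kernel_eqI)
  show "(g \<cdot>\<^bsub>FinKer\<^esub> f) \<otimes>\<^bsub>FinKer\<^esub> (g' \<cdot>\<^bsub>FinKer\<^esub> f') \<in> Hom FinKer (pairs x x') (pairs z z')"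
    and "(g \<otimes>\<^bsub>FinKer\<^esub> g') \<cdot>\<^bsub>FinKer\<^esub> (f \<otimes>\<^bsub>FinKer\<^esub> f') \<in> Hom FinKer (pairs x x') (pairs z z')"
    using assms by (blast intro: FinKer_Tensor_in_Hom FinKer_Comp_in_Hom)+
  fix p q assume "p \<in> pairs x x'" "q \<in> pairs z z'"
  then show "body ((g \<cdot>\<^bsub>FinKer\<^esub> f) \<otimes>\<^bsub>FinKer\<^esub> (g' \<cdot>\<^bsub>FinKer\<^esub> f')) p q =
    body ((g \<otimes>\<^bsub>FinKer\<^esub> g') \<cdot>\<^bsub>FinKer\<^esub> (f \<otimes>\<^bsub>FinKer\<^esub> f')) p q"
    using assms by (auto simp: FinKer_Hom sum_pairs sum_product mult_ac intro!: sum.cong)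
qed

text \<open>
  The structural isomorphisms are bijections of finite sets, so both composites in a naturality
  square are relabellings of the same matrix.
\<close>

lemma FinKer_natural:
  assumes u: "deterministic_by k X X' u" and v: "deterministic_by l Y Y' v" and f: "f \<in> Hom FinKer X Y" and g: "g \<in> Hom FinKer X' Y'"
    and w: "\<And>y. y \<in> Y \<Longrightarrow> w (v y) = y" "\<And>y'. y' \<in> Y' \<Longrightarrow> w y' \<in> Y \<and> v (w y') = y'"
    and eq: "\<And>x y. x \<in> X \<Longrightarrow> y \<in> Y \<Longrightarrow> body f x y = body g (u x) (v y)"
  shows "l \<cdot>\<^bsub>FinKer\<^esub> f = g \<cdot>\<^bsub>FinKer\<^esub> k"
proof (rule kernel_eqI)
  show "l \<cdot>\<^bsub>FinKer\<^esub> f \<in> Hom FinKer X Y'" "g \<cdot>\<^bsub>FinKer\<^esub> k \<in> Hom FinKer X Y'"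
    using FinKer_Comp_in_Hom det_in_Hom u v f g by blast+
  fix x y' assume x: "x \<in> X" and y': "y' \<in> Y'"
  have "body (l \<cdot>\<^bsub>FinKer\<^esub> f) x (v (w y')) = body f x (w y')"
  proof (rule Comp_det_body[OF f v])
    show "w y' \<in> Y" using w(2)[OF y'] by simp
    show "y = w y'" if "y \<in> Y" "v y = v (w y')" for y
      using w(1)[OF that(1)] w(1)[OF conjunct1[OF w(2)[OF y']]] that(2) by metis
  qed
  then show "body (l \<cdot>\<^bsub>FinKer\<^esub> f) x y' = body (g \<cdot>\<^bsub>FinKer\<^esub> k) x y'"
    using det_Comp_body[OF g u x] eq[OF x] w(2)[OF y'] by simp
qed

lemma FinKer_symmetric_monoidal: "symmetric_monoidal_category (FinKer :: (_, 'a kernel) markov_data)"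
proof (intro symmetric_monoidal_category.intro symmetric_monoidal_category_axioms.intro FinKer_category,
    unfold FinKer_simps(5,6))
  fix x y :: "'a univ set" assume xy: "x \<in> Obj FinKer" "y \<in> Obj FinKer"
  then have fin: "finite x" "finite y" by (auto simp: FinKer_simps)
  show "pairs x y \<in> Obj FinKer" using fin by (simp add: FinKer_simps)
  show "\<one>\<^bsub>FinKer\<^esub> x \<otimes>\<^bsub>FinKer\<^esub> \<one>\<^bsub>FinKer\<^esub> y = \<one>\<^bsub>FinKer\<^esub> (pairs x y)"
    by (rule det_eqI, (rule det_rules | simp add: fin)+) auto
  show "(\<one>\<^bsub>FinKer\<^esub> x \<otimes>\<^bsub>FinKer\<^esub> Lunit FinKer y) \<cdot>\<^bsub>FinKer\<^esub> Assoc FinKer x {Pt} y =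
      Runit FinKer x \<otimes>\<^bsub>FinKer\<^esub> \<one>\<^bsub>FinKer\<^esub> y"
    by (rule det_eqI, (rule det_rules | simp add: fin)+)
  show "Swap FinKer x y \<in> Hom FinKer (pairs x y) (pairs y x)"
    by (rule det_in_Hom, (rule det_rules | simp add: fin)+)
  show "Swap FinKer y x \<cdot>\<^bsub>FinKer\<^esub> Swap FinKer x y = \<one>\<^bsub>FinKer\<^esub> (pairs x y)"
    by (rule det_eqI, (rule det_rules | simp add: fin)+) auto
  fix z :: "'a univ set" assume "z \<in> Obj FinKer"
  then have fz: "finite z" by (auto simp: FinKer_simps)
  show "Assoc FinKer x y z \<in> Hom FinKer (pairs (pairs x y) z) (pairs x (pairs y z))"
    by (rule det_in_Hom, (rule det_rules | simp add: fin fz)+)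
  show "is_iso FinKer (Assoc FinKer x y z)" using fin fz by (rule FinKer_structure_inverse)
  show "Assoc FinKer y z x \<cdot>\<^bsub>FinKer\<^esub> Swap FinKer x (pairs y z) \<cdot>\<^bsub>FinKer\<^esub> Assoc FinKer x y z =
      (\<one>\<^bsub>FinKer\<^esub> y \<otimes>\<^bsub>FinKer\<^esub> Swap FinKer x z) \<cdot>\<^bsub>FinKer\<^esub> Assoc FinKer y x z \<cdot>\<^bsub>FinKer\<^esub>
      (Swap FinKer x y \<otimes>\<^bsub>FinKer\<^esub> \<one>\<^bsub>FinKer\<^esub> z)"
    by (rule det_eqI, (rule det_rules | simp add: fin fz)+)
  fix w :: "'a univ set" assume "w \<in> Obj FinKer"
  then have fw: "finite w" by (auto simp: FinKer_simps)
  show "Assoc FinKer x y (pairs z w) \<cdot>\<^bsub>FinKer\<^esub> Assoc FinKer (pairs x y) z w =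
      (\<one>\<^bsub>FinKer\<^esub> x \<otimes>\<^bsub>FinKer\<^esub> Assoc FinKer y z w) \<cdot>\<^bsub>FinKer\<^esub> Assoc FinKer x (pairs y z) w \<cdot>\<^bsub>FinKer\<^esub>
      (Assoc FinKer x y z \<otimes>\<^bsub>FinKer\<^esub> \<one>\<^bsub>FinKer\<^esub> w)"
    by (rule det_eqI, (rule det_rules | simp add: fin fz fw)+)
next
  fix f g :: "'a kernel" and x y x' y' assume "f \<in> Hom FinKer x y" "g \<in> Hom FinKer x' y'"
  then show "f \<otimes>\<^bsub>FinKer\<^esub> g \<in> Hom FinKer (pairs x x') (pairs y y')" by (rule FinKer_Tensor_in_Hom)
next
  fix f g f' g' :: "'a kernel" and x y z x' y' z'
  assume "f \<in> Hom FinKer x y" "g \<in> Hom FinKer y z" "f' \<in> Hom FinKer x' y'" "g' \<in> Hom FinKer y' z'"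
  then show "(g \<cdot>\<^bsub>FinKer\<^esub> f) \<otimes>\<^bsub>FinKer\<^esub> (g' \<cdot>\<^bsub>FinKer\<^esub> f') =
    (g \<otimes>\<^bsub>FinKer\<^esub> g') \<cdot>\<^bsub>FinKer\<^esub> (f \<otimes>\<^bsub>FinKer\<^esub> f')" by (rule FinKer_Tensor_Comp)
next
  show "{Pt} \<in> Obj FinKer" by (simp add: FinKer_simps)
next
  fix x :: "'a univ set" assume "x \<in> Obj FinKer"
  then have fin: "finite x" by (auto simp: FinKer_simps)
  show "Lunit FinKer x \<in> Hom FinKer (pairs {Pt} x) x" "Runit FinKer x \<in> Hom FinKer (pairs x {Pt}) x"
    by (rule det_in_Hom, (rule det_rules | simp add: fin)+)+
  show "is_iso FinKer (Lunit FinKer x)" "is_iso FinKer (Runit FinKer x)"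
    using fin by (blast intro: FinKer_structure_inverse)+
next
  fix f g h :: "'a kernel" and x x' y y' z z'
  assume f: "f \<in> Hom FinKer x x'" and g: "g \<in> Hom FinKer y y'" and h: "h \<in> Hom FinKer z z'"
  then have fin: "finite x" "finite y" "finite z" "finite x'" "finite y'" "finite z'"
    by (auto simp: FinKer_Hom)
  show "Assoc FinKer x' y' z' \<cdot>\<^bsub>FinKer\<^esub> ((f \<otimes>\<^bsub>FinKer\<^esub> g) \<otimes>\<^bsub>FinKer\<^esub> h) =
      (f \<otimes>\<^bsub>FinKer\<^esub> (g \<otimes>\<^bsub>FinKer\<^esub> h)) \<cdot>\<^bsub>FinKer\<^esub> Assoc FinKer x y z"
    by (rule FinKer_natural[OF det_structure(2)[OF fin(1-3)] det_structure(2)[OF fin(4-6)]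
          FinKer_Tensor_in_Hom[OF FinKer_Tensor_in_Hom[OF f g] h]
          FinKer_Tensor_in_Hom[OF f FinKer_Tensor_in_Hom[OF g h]],
          where w = "\<lambda>p. Pair (Pair (pfst p) (pfst (psnd p))) (psnd (psnd p))"])
      (use f g h in \<open>auto simp: FinKer_Hom\<close>)
next
  fix f :: "'a kernel" and x y assume f: "f \<in> Hom FinKer x y"
  then have fin: "finite x" "finite y" by (auto simp: FinKer_Hom)
  have id: "\<one>\<^bsub>FinKer\<^esub> {Pt} \<in> Hom FinKer {Pt} {Pt}"
    by (rule det_in_Hom[OF det_structure(1)]) simp
  show "Lunit FinKer y \<cdot>\<^bsub>FinKer\<^esub> (\<one>\<^bsub>FinKer\<^esub> {Pt} \<otimes>\<^bsub>FinKer\<^esub> f) = f \<cdot>\<^bsub>FinKer\<^esub> Lunit FinKer x"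
    by (rule FinKer_natural[OF det_structure(3)[OF fin(1)] det_structure(3)[OF fin(2)]
          FinKer_Tensor_in_Hom[OF id f] f, where w = "\<lambda>y. Pair Pt y"])
      (use f in \<open>auto simp: FinKer_Hom FinKer_simps\<close>)
  show "Runit FinKer y \<cdot>\<^bsub>FinKer\<^esub> (f \<otimes>\<^bsub>FinKer\<^esub> \<one>\<^bsub>FinKer\<^esub> {Pt}) = f \<cdot>\<^bsub>FinKer\<^esub> Runit FinKer x"
    by (rule FinKer_natural[OF det_structure(4)[OF fin(1)] det_structure(4)[OF fin(2)]
          FinKer_Tensor_in_Hom[OF f id] f, where w = "\<lambda>y. Pair y Pt"])
      (use f in \<open>auto simp: FinKer_Hom FinKer_simps\<close>)
next
  fix f g :: "'a kernel" and x x' y y'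
  assume f: "f \<in> Hom FinKer x x'" and g: "g \<in> Hom FinKer y y'"
  then have fin: "finite x" "finite y" "finite x'" "finite y'"
    by (auto simp: FinKer_Hom)
  show "Swap FinKer x' y' \<cdot>\<^bsub>FinKer\<^esub> (f \<otimes>\<^bsub>FinKer\<^esub> g) = (g \<otimes>\<^bsub>FinKer\<^esub> f) \<cdot>\<^bsub>FinKer\<^esub> Swap FinKer x y"
    by (rule FinKer_natural[OF det_structure(5)[OF fin(1,2)] det_structure(5)[OF fin(3,4)]
          FinKer_Tensor_in_Hom[OF f g] FinKer_Tensor_in_Hom[OF g f],
          where w = "\<lambda>p. Pair (psnd p) (pfst p)"])
      (use f g in \<open>auto simp: FinKer_Hom\<close>)
qed

lemma FinKer_Unit_unique:
  assumes "k \<in> Hom FinKer A {Pt}" "l \<in> Hom FinKer A {Pt}"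
  shows "k = l"
  using stochasticD(2)[of k] stochasticD(2)[of l] assms
  by (intro kernel_eqI[OF assms]) (auto simp: FinKer_Hom)

lemma FinKer_markov: "markov_category (FinKer :: (_, 'a kernel) markov_data)"
proof (intro markov_category.intro FinKer_symmetric_monoidal markov_category_axioms.intro,
    unfold FinKer_simps(5,6))
  fix x :: "'a univ set" assume x: "x \<in> Obj FinKer"
  then have fin: "finite x" by (auto simp: FinKer_simps)
  show Del: "Del FinKer x \<in> Hom FinKer x {Pt}"
    by (rule det_in_Hom, (rule det_rules | simp add: fin)+)
  then show "\<exists>!t. t \<in> Hom FinKer x {Pt}" using FinKer_Unit_unique by blast
  show "Copy FinKer x \<in> Hom FinKer x (pairs x x)"
    by (rule det_in_Hom, (rule det_rules | simp add: fin)+)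
  show "Assoc FinKer x x x \<cdot>\<^bsub>FinKer\<^esub> (Copy FinKer x \<otimes>\<^bsub>FinKer\<^esub> \<one>\<^bsub>FinKer\<^esub> x) \<cdot>\<^bsub>FinKer\<^esub> Copy FinKer x =
      (\<one>\<^bsub>FinKer\<^esub> x \<otimes>\<^bsub>FinKer\<^esub> Copy FinKer x) \<cdot>\<^bsub>FinKer\<^esub> Copy FinKer x"
    by (rule det_eqI, (rule det_rules | simp add: fin)+)
  show "Lunit FinKer x \<cdot>\<^bsub>FinKer\<^esub> (Del FinKer x \<otimes>\<^bsub>FinKer\<^esub> \<one>\<^bsub>FinKer\<^esub> x) \<cdot>\<^bsub>FinKer\<^esub> Copy FinKer x = \<one>\<^bsub>FinKer\<^esub> x"
    by (rule det_eqI, (rule det_rules | simp add: fin)+)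
  show "Runit FinKer x \<cdot>\<^bsub>FinKer\<^esub> (\<one>\<^bsub>FinKer\<^esub> x \<otimes>\<^bsub>FinKer\<^esub> Del FinKer x) \<cdot>\<^bsub>FinKer\<^esub> Copy FinKer x = \<one>\<^bsub>FinKer\<^esub> x"
    by (rule det_eqI, (rule det_rules | simp add: fin)+)
  show "Swap FinKer x x \<cdot>\<^bsub>FinKer\<^esub> Copy FinKer x = Copy FinKer x"
    by (rule det_eqI, (rule det_rules | simp add: fin)+)
  fix y :: "'a univ set" assume "y \<in> Obj FinKer"
  then have fy: "finite y" by (auto simp: FinKer_simps)
  show "Copy FinKer (pairs x y) = Interchange FinKer x y \<cdot>\<^bsub>FinKer\<^esub> (Copy FinKer x \<otimes>\<^bsub>FinKer\<^esub> Copy FinKer y)"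
    unfolding Interchange_def FinKer_simps(5)
    by (rule det_eqI, (rule det_rules | simp add: fin fy)+) auto
  show "Del FinKer (pairs x y) = Lunit FinKer {Pt} \<cdot>\<^bsub>FinKer\<^esub> (Del FinKer x \<otimes>\<^bsub>FinKer\<^esub> Del FinKer y)"
    by (rule det_eqI, (rule det_rules | simp add: fin fy)+)
next
  show "Lunit FinKer {Pt} \<cdot>\<^bsub>FinKer\<^esub> Copy FinKer {Pt} = \<one>\<^bsub>FinKer\<^esub> {Pt}"
    by (rule det_eqI, (rule det_rules | simp)+)
  show "Del FinKer {Pt} = \<one>\<^bsub>FinKer\<^esub> {Pt}"
    by (rule det_eqI, (rule det_rules | simp)+)
qed

text \<open>
  Both composites in the causality axiom have this form, the second one twice over: it is the joint
  distribution of the output of \<open>k\<close> and of \<open>h\<close> applied to that output.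
\<close>

lemma joint_kernel:
  assumes k: "k \<in> Hom FinKer A C" and h: "h \<in> Hom FinKer C D"
  shows "(h \<otimes>\<^bsub>FinKer\<^esub> \<one>\<^bsub>FinKer\<^esub> C) \<cdot>\<^bsub>FinKer\<^esub> Copy FinKer C \<cdot>\<^bsub>FinKer\<^esub> k \<in> Hom FinKer A (pairs D C)"
    and "c \<in> C \<Longrightarrow> d \<in> D \<Longrightarrow>
      body ((h \<otimes>\<^bsub>FinKer\<^esub> \<one>\<^bsub>FinKer\<^esub> C) \<cdot>\<^bsub>FinKer\<^esub> Copy FinKer C \<cdot>\<^bsub>FinKer\<^esub> k) x (Pair d c) =
      body k x c * body h c d"
proof -
  have fin: "finite C" using k by (simp add: FinKer_Hom)
  note st = det_structure(1,6)[OF fin]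
  show "(h \<otimes>\<^bsub>FinKer\<^esub> \<one>\<^bsub>FinKer\<^esub> C) \<cdot>\<^bsub>FinKer\<^esub> Copy FinKer C \<cdot>\<^bsub>FinKer\<^esub> k \<in> Hom FinKer A (pairs D C)"
    by (rule FinKer_Comp_in_Hom FinKer_Tensor_in_Hom k h det_in_Hom[OF st(1)] det_in_Hom[OF st(2)])+
  assume c: "c \<in> C" and d: "d \<in> D"
  have hC: "source h = C" "target h = D" and kC: "target k = C" using k h by (auto simp: FinKer_Hom)
  note K = FinKer_Comp_in_Hom[OF k det_in_Hom[OF st(2)]]
  have copy: "body (Copy FinKer C \<cdot>\<^bsub>FinKer\<^esub> k) x (Pair a b) = (if a = b then body k x a else 0)"
    if "a \<in> C" for a b
  proof (cases "a = b")
    case True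
    then show ?thesis using Comp_det_body[OF k st(2) that, of x] by simp
  next
    case False
    then show ?thesis by (auto simp: kC FinKer_simps intro!: sum.neutral)
  qed
  have "body ((h \<otimes>\<^bsub>FinKer\<^esub> \<one>\<^bsub>FinKer\<^esub> C) \<cdot>\<^bsub>FinKer\<^esub> Copy FinKer C \<cdot>\<^bsub>FinKer\<^esub> k) x (Pair d c) =
      (\<Sum>a\<in>C. \<Sum>b\<in>C. body (Copy FinKer C \<cdot>\<^bsub>FinKer\<^esub> k) x (Pair a b) * (body h a d * (if c = b then 1 else 0)))"
    using c d hC by (subst FinKer_Comp_simps(3)) (auto simp: FinKer_simps sum_pairs simp del: FinKer_Comp_simps(3) intro!: sum.cong)
  also have "\<dots> = (\<Sum>a\<in>C. \<Sum>b\<in>C. if b = c then (if a = c then body k x c * body h c d else 0) else 0)"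
    using copy by (intro sum.cong) auto
  also have "\<dots> = body k x c * body h c d"
    using fin c by (simp add: sum.delta)
  finally show "body ((h \<otimes>\<^bsub>FinKer\<^esub> \<one>\<^bsub>FinKer\<^esub> C) \<cdot>\<^bsub>FinKer\<^esub> Copy FinKer C \<cdot>\<^bsub>FinKer\<^esub> k) x (Pair d c) =
      body k x c * body h c d" .
qed

text \<open>
  If \<open>f(b|a) g(c|b)\<close> is not zero, then neither is the sum \<open>p(c|a)\<close> of these products over \<open>b\<close>. The hypothesis
  \<open>p(c|a) h\<^sub>1(d|c) = p(c|a) h\<^sub>2(d|c)\<close> then gives \<open>h\<^sub>1(d|c) = h\<^sub>2(d|c)\<close>. If the product vanishes, so do both sides
  of the conclusion.
\<close>

theorem FinKer_causal: "causal_markov_category (FinKer :: (_, 'a kernel) markov_data)"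
proof (intro causal_markov_category.intro FinKer_markov causal_markov_category_axioms.intro)
  fix f g h\<^sub>1 h\<^sub>2 :: "'a kernel" and A B C D
  assume f: "f \<in> Hom FinKer A B" and g: "g \<in> Hom FinKer B C"
    and h1: "h\<^sub>1 \<in> Hom FinKer C D" and h2: "h\<^sub>2 \<in> Hom FinKer C D"
    and eq: "(h\<^sub>1 \<otimes>\<^bsub>FinKer\<^esub> \<one>\<^bsub>FinKer\<^esub> C) \<cdot>\<^bsub>FinKer\<^esub> Copy FinKer C \<cdot>\<^bsub>FinKer\<^esub> g \<cdot>\<^bsub>FinKer\<^esub> f =
      (h\<^sub>2 \<otimes>\<^bsub>FinKer\<^esub> \<one>\<^bsub>FinKer\<^esub> C) \<cdot>\<^bsub>FinKer\<^esub> Copy FinKer C \<cdot>\<^bsub>FinKer\<^esub> g \<cdot>\<^bsub>FinKer\<^esub> f"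
  note gf = FinKer_Comp_in_Hom[OF f g]
  have fB: "source f = A" "target f = B" "stochastic f" "finite B"
    and gB: "source g = B" "target g = C" "stochastic g" using f g by (auto simp: FinKer_Hom)
  have key: "body f a b * (body g b c * body h\<^sub>1 c d) = body f a b * (body g b c * body h\<^sub>2 c d)"
    if "a \<in> A" "b \<in> B" "c \<in> C" "d \<in> D" for a b c d
  proof (cases "body f a b * body g b c = 0")
    case False
    have nonneg: "0 \<le> body f a b' * body g b' c" if "b' \<in> B" for b'
      using stochasticD(1)[OF fB(3)] stochasticD(1)[OF gB(3)] fB gB that \<open>a \<in> A\<close> \<open>c \<in> C\<close> by simp
    have "0 < (\<Sum>b\<in>B. body f a b * body g b c)"
      by (rule sum_pos2[OF fB(4) that(2)]) (use False nonneg that(2) in \<open>auto simp: less_le\<close>)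
    then have "0 < body (g \<cdot>\<^bsub>FinKer\<^esub> f) a c" by (simp add: fB)
    moreover have "body (g \<cdot>\<^bsub>FinKer\<^esub> f) a c * body h\<^sub>1 c d = body (g \<cdot>\<^bsub>FinKer\<^esub> f) a c * body h\<^sub>2 c d"
      using joint_kernel(2)[OF gf h1 that(3,4)] joint_kernel(2)[OF gf h2 that(3,4)] eq by metis
    ultimately show ?thesis by simp
  qed auto
  note j1 = joint_kernel[OF g h1] and j2 = joint_kernel[OF g h2]
  show "(((h\<^sub>1 \<otimes>\<^bsub>FinKer\<^esub> \<one>\<^bsub>FinKer\<^esub> C) \<cdot>\<^bsub>FinKer\<^esub> Copy FinKer C \<cdot>\<^bsub>FinKer\<^esub> g) \<otimes>\<^bsub>FinKer\<^esub> \<one>\<^bsub>FinKer\<^esub> B) \<cdot>\<^bsub>FinKer\<^esub>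
      Copy FinKer B \<cdot>\<^bsub>FinKer\<^esub> f =
    (((h\<^sub>2 \<otimes>\<^bsub>FinKer\<^esub> \<one>\<^bsub>FinKer\<^esub> C) \<cdot>\<^bsub>FinKer\<^esub> Copy FinKer C \<cdot>\<^bsub>FinKer\<^esub> g) \<otimes>\<^bsub>FinKer\<^esub> \<one>\<^bsub>FinKer\<^esub> B) \<cdot>\<^bsub>FinKer\<^esub>
      Copy FinKer B \<cdot>\<^bsub>FinKer\<^esub> f"
  proof (rule kernel_eqI[OF joint_kernel(1)[OF f j1(1)] joint_kernel(1)[OF f j2(1)]])
    fix a q assume a: "a \<in> A" and "q \<in> pairs (pairs D C) B"
    then obtain d c b where q: "q = Pair (Pair d c) b" "d \<in> D" "c \<in> C" "b \<in> B" by auto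
    then have dc: "Pair d c \<in> pairs D C" by simp
    show "body ((((h\<^sub>1 \<otimes>\<^bsub>FinKer\<^esub> \<one>\<^bsub>FinKer\<^esub> C) \<cdot>\<^bsub>FinKer\<^esub> Copy FinKer C \<cdot>\<^bsub>FinKer\<^esub> g) \<otimes>\<^bsub>FinKer\<^esub> \<one>\<^bsub>FinKer\<^esub> B) \<cdot>\<^bsub>FinKer\<^esub>
        Copy FinKer B \<cdot>\<^bsub>FinKer\<^esub> f) a q =
      body ((((h\<^sub>2 \<otimes>\<^bsub>FinKer\<^esub> \<one>\<^bsub>FinKer\<^esub> C) \<cdot>\<^bsub>FinKer\<^esub> Copy FinKer C \<cdot>\<^bsub>FinKer\<^esub> g) \<otimes>\<^bsub>FinKer\<^esub> \<one>\<^bsub>FinKer\<^esub> B) \<cdot>\<^bsub>FinKer\<^esub>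
        Copy FinKer B \<cdot>\<^bsub>FinKer\<^esub> f) a q"
      unfolding q(1) joint_kernel(2)[OF f j1(1) q(4) dc] joint_kernel(2)[OF f j2(1) q(4) dc]
        j1(2)[OF q(3,2)] j2(2)[OF q(3,2)]
      by (rule key[OF a q(4,3,2)])
  qed
qed


section \<open>Diagrams of finite sets\<close>

lemma Fin_Hom: "f \<in> Hom Fin A B \<longleftrightarrow> source f = A \<and> target f = B \<and> finite A \<and> finite B \<and>
    (\<forall>x\<in>A. body f x \<in> B) \<and> (\<forall>x. x \<notin> A \<longrightarrow> body f x = undefined)"
  by (auto simp: Fin_def Hom_def)

lemma Fin_simps:
  "Obj Fin = {A. finite A}"
  "\<one>\<^bsub>Fin\<^esub> A = \<lparr>source = A, target = A, body = (\<lambda>x. if x \<in> A then x else undefined)\<rparr>"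
  "g \<cdot>\<^bsub>Fin\<^esub> f = \<lparr>source = source f, target = target g,
     body = (\<lambda>x. if x \<in> source f then body g (body f x) else undefined)\<rparr>"
  by (simp_all add: Fin_def)

lemma det_kernel_of: "f \<in> Hom Fin A B \<Longrightarrow> deterministic_by (kernel_of f) A B (body f)"
  by (auto simp: Fin_Hom deterministic_by_def kernel_of_def)

lemma factors_through_Fin_unit: "factors_through_Fin (pro_unit FinKer)"
  unfolding factors_through_Fin_def
proof (intro exI conjI ballI)
  let ?F = "\<lambda>_::'a univ. {Pt} :: 'a univ set" and ?G = "\<lambda>_::'a univ. \<one>\<^bsub>Fin\<^esub> {Pt} :: 'a fun_arrow"
  show "is_functor (idx (pro_unit FinKer)) Fin ?F ?G"
    by (auto simp: is_functor_def Fin_Hom Fin_simps)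
  show "node (pro_unit FinKer) i = ?F i" for i by (simp add: FinKer_simps)
  show "edge (pro_unit FinKer) a = kernel_of (?G a)" for a
    by (auto simp: FinKer_simps Fin_simps kernel_of_def fun_kernel_def)
qed

lemma factors_through_Fin_tensor:
  assumes "factors_through_Fin X" "factors_through_Fin Y"
  shows "factors_through_Fin (pro_tensor FinKer X Y)"
proof -
  obtain F G where X: "is_functor (idx X) Fin F G" "\<forall>i\<in>Obj (idx X). node X i = F i"
    "\<forall>a\<in>Arr (idx X). edge X a = kernel_of (G a)"
    using assms(1) by (auto simp: factors_through_Fin_def)
  obtain F' G' where Y: "is_functor (idx Y) Fin F' G'" "\<forall>i\<in>Obj (idx Y). node Y i = F' i"
    "\<forall>a\<in>Arr (idx Y). edge Y a = kernel_of (G' a)"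
    using assms(2) by (auto simp: factors_through_Fin_def)
  define F2 where "F2 p = pairs (F (pfst p)) (F' (psnd p))" for p
  define G2 where "G2 p = (let f = G (pfst p); g = G' (psnd p) in
     \<lparr>source = pairs (source f) (source g), target = pairs (target f) (target g),
      body = (\<lambda>x. if x \<in> pairs (source f) (source g) then Pair (body f (pfst x)) (body g (psnd x)) else undefined)\<rparr>)"
    for p
  have GX: "G a \<in> Hom Fin (F (Dom (idx X) a)) (F (Cod (idx X) a))" if "a \<in> Arr (idx X)" for a
    using X(1) that by (auto simp: is_functor_def)
  have GY: "G' a \<in> Hom Fin (F' (Dom (idx Y) a)) (F' (Cod (idx Y) a))" if "a \<in> Arr (idx Y)" for a
    using Y(1) that by (auto simp: is_functor_def)
  have G2: "G2 (Pair a b) \<in> Hom Fin (pairs (F (Dom (idx X) a)) (F' (Dom (idx Y) b)))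
      (pairs (F (Cod (idx X) a)) (F' (Cod (idx Y) b)))"
    if "a \<in> Arr (idx X)" "b \<in> Arr (idx Y)" for a b
    using GX[OF that(1)] GY[OF that(2)] by (auto simp: G2_def Fin_Hom Let_def)
  have "is_functor (idx (pro_tensor FinKer X Y)) Fin F2 G2"
    unfolding is_functor_def
  proof (intro conjI ballI impI)
    fix p assume "p \<in> Obj (idx (pro_tensor FinKer X Y))"
    then obtain i j where p: "p = Pair i j" "i \<in> Obj (idx X)" "j \<in> Obj (idx Y)" by auto
    have "F i \<in> Obj Fin" "G (\<one>\<^bsub>idx X\<^esub> i) = \<one>\<^bsub>Fin\<^esub> (F i)" "F' j \<in> Obj Fin" "G' (\<one>\<^bsub>idx Y\<^esub> j) = \<one>\<^bsub>Fin\<^esub> (F' j)"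
      using X(1) Y(1) p by (auto simp: is_functor_def)
    then show "F2 p \<in> Obj Fin" "G2 (\<one>\<^bsub>idx (pro_tensor FinKer X Y)\<^esub> p) = \<one>\<^bsub>Fin\<^esub> (F2 p)"
      by (auto simp: p F2_def G2_def Fin_simps Let_def fun_eq_iff)
  next
    fix p assume "p \<in> Arr (idx (pro_tensor FinKer X Y))"
    then show "G2 p \<in> Hom Fin (F2 (Dom (idx (pro_tensor FinKer X Y)) p)) (F2 (Cod (idx (pro_tensor FinKer X Y)) p))"
      using G2 by (auto simp: F2_def)
  next
    fix p q assume "p \<in> Arr (idx (pro_tensor FinKer X Y))" "q \<in> Arr (idx (pro_tensor FinKer X Y))"
      and dc: "Dom (idx (pro_tensor FinKer X Y)) q = Cod (idx (pro_tensor FinKer X Y)) p"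
    then obtain a b a' b' where p: "p = Pair a b" "q = Pair a' b'" and
      ab: "a \<in> Arr (idx X)" "b \<in> Arr (idx Y)" "a' \<in> Arr (idx X)" "b' \<in> Arr (idx Y)" by auto
    have d: "Dom (idx X) a' = Cod (idx X) a" "Dom (idx Y) b' = Cod (idx Y) b"
      using dc by (auto simp: p)
    have "G (a' \<cdot>\<^bsub>idx X\<^esub> a) = G a' \<cdot>\<^bsub>Fin\<^esub> G a" "G' (b' \<cdot>\<^bsub>idx Y\<^esub> b) = G' b' \<cdot>\<^bsub>Fin\<^esub> G' b"
      using X(1) Y(1) ab d by (auto simp: is_functor_def)
    then show "G2 (q \<cdot>\<^bsub>idx (pro_tensor FinKer X Y)\<^esub> p) = G2 q \<cdot>\<^bsub>Fin\<^esub> G2 p"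
      using GX[OF ab(1)] GX[OF ab(3)] GY[OF ab(2)] GY[OF ab(4)] d
      by (auto simp: p G2_def Fin_simps Let_def Fin_Hom fun_eq_iff)
  qed
  moreover have "\<forall>p\<in>Obj (idx (pro_tensor FinKer X Y)). node (pro_tensor FinKer X Y) p = F2 p"
    using X(2) Y(2) by (auto simp: F2_def FinKer_simps)
  moreover have "edge (pro_tensor FinKer X Y) p = kernel_of (G2 p)"
    if m: "p \<in> Arr (idx (pro_tensor FinKer X Y))" for p
  proof -
    obtain a b where p: "p = Pair a b" and ab: "a \<in> Arr (idx X)" "b \<in> Arr (idx Y)"
      using m by auto
    show ?thesis
      unfolding p using X(3) Y(3) ab GX[OF ab(1)] GY[OF ab(2)]
      by (simp, intro det_eqI[OF det_Tensor[OF det_kernel_of det_kernel_of] det_kernel_of[OF G2]])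
        (auto simp: G2_def Let_def Fin_Hom)
  qed
  ultimately show ?thesis unfolding factors_through_Fin_def by blast
qed

text \<open>
  A transition kernel that comes from a function commutes with copying, since duplicating \<open>u x\<close> is the
  same as applying \<open>u\<close> to both copies of \<open>x\<close>.
\<close>

lemma factors_through_Fin_Copy:
  assumes X: "factors_through_Fin X" "pro_object FinKer X" and a: "a \<in> Hom (idx X) i j"
  shows "Copy FinKer (node X j) \<cdot>\<^bsub>FinKer\<^esub> edge X a =
    (edge X a \<otimes>\<^bsub>FinKer\<^esub> edge X a) \<cdot>\<^bsub>FinKer\<^esub> Copy FinKer (node X i)"
proof -
  interpret I: cofiltered_category "idx X" using pro_objectD(1)[OF X(2)] .
  obtain F G where F: "is_functor (idx X) Fin F G" "\<forall>i\<in>Obj (idx X). node X i = F i"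
    "\<forall>a\<in>Arr (idx X). edge X a = kernel_of (G a)"
    using X(1) by (auto simp: factors_through_Fin_def)
  have "G a \<in> Hom Fin (node X i) (node X j)"
    using F I.Hom_objs[OF a] HomD[OF a] by (auto simp: is_functor_def)
  then have d: "deterministic_by (edge X a) (node X i) (node X j) (body (G a))"
    using F(3) HomD(1)[OF a] det_kernel_of by auto
  then have fin: "finite (node X i)" "finite (node X j)" by (auto simp: deterministic_by_def)
  show ?thesis
    by (rule det_eqI, (rule d det_rules | simp add: fin)+)
qed

theorem mainTheorem4:
  shows "causal_markov_category
    (ProDet_FinKer ::
      (('a, 'a univ set, 'a kernel) diagram, ('a, 'a univ set, 'a kernel) pro_arrow) markov_data)"
proof -
  interpret causal_markov_category FinKer by (rule FinKer_causal)
  interpret pro_causal_markov_category FinKer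
    "{X :: ('a, 'a univ set, 'a kernel) diagram. factors_through_Fin X}"
    by unfold_locales
      (auto simp: factors_through_Fin_unit factors_through_Fin_tensor factors_through_Fin_Copy)
  show ?thesis
    unfolding ProDet_FinKer_def by (rule N_causal)
qed

end
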